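(* Let $(X,Y)_{1:\infty}=((X_k,Y_k))_{k\in\mathbb{N}}$ be a random sequence in $(\mathbb{R}^d\times\mathbb{R})^{\mathbb{N}}$ and, for each $k$, let $\Phi_k:\mathbb{R}^d\to\mathbb{R}$ be a Borel function with $\Phi_k(X_k)=\mathbb{E}[Y_k|X_k]$ $\mathbb{P}$-a.s. Let $\mathcal{F}$ be a pointwise measurable class of Borel-measurable functions $\mathbb{R}^d\to\mathbb{R}$ with VC-dimension $V_{\mathcal{F}}<\infty$, and assume that $\|Y_k\|_{\mathbb{P},\infty}\le B$ for some $B>0$ and all $k$. Let $(c,\lambda,n,m)\in(1,\infty)\times(1,\infty)\times\mathbb{N}\times\mathbb{N}$ be such that $$\lambda\le\frac{3+\sqrt{1+8c}}4,\qquad\Big\lfloor\frac nm\Big\rfloor\ge\exp\Big(\frac{c^2-71}{4V_{\mathcal{F}}}\Big)$$ (in particular $n\ge m$). Let $\widehat\Phi_n$ be a solution (assumed to exist) of the least-squares regression problem $$\widehat\Phi_n\in\arg\min_{f\in\mathcal{F}}\frac1n\sum_{k=1}^n|f(X_k)-Y_k|^2 .$$ Then $$\mathbb{E}\big[\mu_{X_{1:n}}|T_B\widehat\Phi_n-\Phi_{1:n}|^2\big]\le\frac{B^2}{\lfloor n/m\rfloor}\,\theta_0\big(1+\theta_1+V_{\mathcal{F}}(\theta_2+\log(\theta_2))\big)+16B^2(1+\lambda)\,n\,\beta_{(X,Y)_{1:\infty}}(m)+\lambda\inf_{f\in\mathcal{F}}\mu_{X_{1:n}}|f-\Phi_{1:n}|^2,$$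 where $$\theta_0=32\Big(\frac13\Big(1-\frac1c\Big)\Big(1-\frac1\lambda\Big)+(2\lambda-1)\Big)^2\Big(\frac c{c-1}\Big)^3\frac\lambda{\lambda-1},$$ $$\theta_1=\log(6(c+1)(2c+3))+\log m,$$ $$\theta_2=1+\log24+\log\Big(1+\sqrt{1+\frac{c(c+1)}{\lfloor n/m\rfloor+1}}\Big)-\log\Big(c-\frac1c\Big)+\log\Big(\Big\lfloor\frac nm\Big\rfloor+1\Big).$$
   Context: All random variables live on a probability space $(\Omega,\mathcal{E},\mathbb{P})$, which by convention is rich enough to support all the random variables considered. $\mathbb{N}=\{1,2,\dots\}$. $\|\cdot\|_{\mathbb{P},\infty}$ is the $L^\infty(\mathbb{P})$ norm; $\mathbb{P}_{X_k}$ is the law of $X_k$. For $f:\mathbb{R}^d\to\mathbb{R}$, write $$\mu_{X_{1:n}}|f-\Phi_{1:n}|^2:=\frac1n\sum_{k=1}^n\int_{\mathbb{R}^d}|f(x)-\Phi_k(x)|^2\,\mathbb{P}_{X_k}(dx).$$ $\widehat\Phi_n$ depends on the data $((X_k,Y_k))_{k=1}^n$, so $\mu_{X_{1:n}}|T_B\widehat\Phi_n-\Phi_{1:n}|^2$ is the random variable obtained by taking $f=T_B\widehat\Phi_n$ for the realized data (the integrals are with respect to $x$ only, the data being held fixed). The truncation operator is $T_Bg(x):=\max\{\min\{g(x),B\},-B\}$. $\mathcal{F}$ is pointwise measurable if there is a countable subset of $\mathcal{F}$ such that every $f\in\mathcal{F}$ is the pointwise limit of a sequence from that subset. VC-dimension: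 for $f:\mathbb{R}^d\to\mathbb{R}$ let $G_f^+:=\{(x,y)\in\mathbb{R}^d\times\mathbb{R}:y\le f(x)\}$. $V_{\mathcal{F}}$ is the supremum of the natural numbers $l$ for which there is a set $G\subset\mathbb{R}^d\times\mathbb{R}$ with $l$ elements such that every subset $G'\subset G$ has the form $G'=G\cap G_f^+$ for some $f\in\mathcal{F}$. $\beta$-mixing coefficients: for sub-sigma-algebras $\mathcal{E}_1,\mathcal{E}_2$ of $\mathcal{E}$, $$\beta(\mathcal{E}_1,\mathcal{E}_2):=\mathbb{E}\Big[\operatorname{ess\,sup}_{E_1\in\mathcal{E}_1}|\mathbb{P}(E_1)-\mathbb{P}[E_1|\mathcal{E}_2]|\Big],$$ where $\operatorname{ess\,sup}$ denotes the essential supremum of a family of random variables. For $m\in\mathbb{N}$, $$\beta_{(X,Y)_{1:\infty}}(m):=\sup_{l\in\mathbb{N}}\beta\big(\sigma((X_k,Y_k):1\le k\le l-m),\sigma((X_l,Y_l))\big),$$ where the first sigma-algebra is trivial if $l\le m$. *)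

theory Defs
  imports "HOL-Probability.Probability"
begin

definition pointwise_measurable :: "('x \<Rightarrow> real) set \<Rightarrow> bool" where
  "pointwise_measurable F \<longleftrightarrow>
     (\<exists>G\<subseteq>F. countable G \<and>
        (\<forall>f\<in>F. \<exists>g :: nat \<Rightarrow> 'x \<Rightarrow> real. range g \<subseteq> G \<and> (\<forall>x. (\<lambda>j. g j x) \<longlonglongrightarrow> f x)))"

definition subgraph :: "('x \<Rightarrow> real) \<Rightarrow> ('x \<times> real) set" where
  "subgraph f = {(x, y). y \<le> f x}"

definition vc_dim :: "('x \<Rightarrow> real) set \<Rightarrow> enat" where
  "vc_dim F =
     Sup {enat l | l. \<exists>G :: ('x \<times> real) set. finite G \<and> card G = l \<and>
                        (\<forall>G'\<subseteq>G. \<exists>f\<in>F. G' = G \<inter> subgraph f)}"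

definition truncate :: "real \<Rightarrow> ('x \<Rightarrow> real) \<Rightarrow> 'x \<Rightarrow> real" where
  "truncate B g x = max (min (g x) B) (- B)"

text \<open>The value is in \<^typ>\<open>ennreal\<close>: a function that is not square-integrable under some
  of the laws yields \<open>\<infinity>\<close>, whereas a Bochner integral would yield \<open>0\<close>.\<close>

definition mu_sq_dist ::
  "'w measure \<Rightarrow> (nat \<Rightarrow> 'w \<Rightarrow> 'x::topological_space) \<Rightarrow> nat \<Rightarrow> (nat \<Rightarrow> 'x \<Rightarrow> real) \<Rightarrow> ('x \<Rightarrow> real) \<Rightarrow> ennreal"
where
  "mu_sq_dist M X n \<Phi> f =
     (\<Sum>k=1..n. \<integral>\<^sup>+ x. ennreal (\<bar>f x - \<Phi> k x\<bar>\<^sup>2) \<partial>distr M borel (X k)) / of_nat n"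

definition least_squares_solution ::
  "('x \<Rightarrow> real) set \<Rightarrow> nat \<Rightarrow> (nat \<Rightarrow> 'x) \<Rightarrow> (nat \<Rightarrow> real) \<Rightarrow> ('x \<Rightarrow> real) \<Rightarrow> bool"
where
  "least_squares_solution F n x y g \<longleftrightarrow>
     is_arg_min (\<lambda>f. (1 / real n) * (\<Sum>k=1..n. \<bar>f (x k) - y k\<bar>\<^sup>2)) (\<lambda>f. f \<in> F) g"

text \<open>For \<open>I = {}\<close> this is the trivial sigma-algebra \<open>{{}, space M}\<close>.  (A supremum of
  \<^const>\<open>vimage_algebra\<close>s over \<open>I = {}\<close> would instead have an empty space.)\<close>

definition generated_sigma ::
  "'w measure \<Rightarrow> (nat \<Rightarrow> 'w \<Rightarrow> 'z::topological_space) \<Rightarrow> nat set \<Rightarrow> 'w measure"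
where
  "generated_sigma M Z I =
     sigma (space M) {Z k -` A \<inter> space M | k A. k \<in> I \<and> A \<in> sets borel}"

text \<open>The essential supremum of a family of random variables is its least upper bound with
  respect to almost sure domination, which is unique up to null sets.\<close>

definition is_ess_sup_family ::
  "'w measure \<Rightarrow> ('w \<Rightarrow> ennreal) set \<Rightarrow> ('w \<Rightarrow> ennreal) \<Rightarrow> bool"
where
  "is_ess_sup_family M S Z \<longleftrightarrow>
     Z \<in> borel_measurable M \<and>
     (\<forall>f\<in>S. AE \<omega> in M. f \<omega> \<le> Z \<omega>) \<and>
     (\<forall>Z'\<in>borel_measurable M. (\<forall>f\<in>S. AE \<omega> in M. f \<omega> \<le> Z' \<omega>) \<longrightarrow> (AE \<omega> in M. Z \<omega> \<le> Z' \<omega>))"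

definition ess_sup_family :: "'w measure \<Rightarrow> ('w \<Rightarrow> ennreal) set \<Rightarrow> 'w \<Rightarrow> ennreal" where
  "ess_sup_family M S = (SOME Z. is_ess_sup_family M S Z)"

text \<open>The choice is never vacuous for the uniformly bounded families needed here.\<close>

lemma is_ess_sup_family_exists:
  fixes M :: "'w measure" and K :: real
  assumes "finite_measure M"
    and meas: "\<And>f. f \<in> S \<Longrightarrow> f \<in> borel_measurable M"
    and bound: "\<And>f. f \<in> S \<Longrightarrow> AE \<omega> in M. f \<omega> \<le> ennreal K"
  shows "is_ess_sup_family M S (ess_sup_family M S)"
proof -
  interpret finite_measure M by fact
  define I where "I A = (\<integral>\<^sup>+ \<omega>. (SUP f\<in>A. f \<omega>) \<partial>M)" for A :: "('w \<Rightarrow> ennreal) set"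
  define C where "C = {A. A \<subseteq> S \<and> countable A}"
  have msup: "(\<lambda>\<omega>. SUP f\<in>A. f \<omega>) \<in> borel_measurable M" if "A \<in> C" for A
    using that meas by (intro borel_measurable_SUP) (auto simp: C_def)
  have "C \<noteq> {}" by (auto simp: C_def)
  from ennreal_SUP_countable_SUP[OF this, of I]
  obtain a where a: "range a \<subseteq> I ` C" "Sup (I ` C) = (SUP i::nat. a i)" by auto
  then have "\<forall>i. \<exists>A\<in>C. a i = I A" by blast
  then obtain A where A: "\<And>i. A i \<in> C" "\<And>i. a i = I (A i)" by metis
  define U where "U = (\<Union>i. A i)"
  have U: "U \<in> C" using A by (auto simp: U_def C_def)
  have I_mono: "I P \<le> I Q" if "P \<subseteq> Q" for P Q
    unfolding I_def using that by (intro nn_integral_mono SUP_subset_mono) auto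
  have IU: "I P \<le> I U" if "P \<in> C" for P
  proof -
    have "I P \<le> (SUP i. a i)" using that a(2) by (metis SUP_upper)
    also have "\<dots> \<le> I U" by (intro SUP_least) (auto simp: A(2) U_def intro!: I_mono)
    finally show ?thesis .
  qed
  let ?Z = "\<lambda>\<omega>. SUP f\<in>U. f \<omega>"
  have fin: "I U \<noteq> \<infinity>"
  proof -
    have "AE \<omega> in M. \<forall>f\<in>U. f \<omega> \<le> ennreal K"
      using U bound by (subst AE_ball_countable) (auto simp: C_def)
    then have "AE \<omega> in M. ?Z \<omega> \<le> ennreal K" by (rule eventually_mono) (simp add: SUP_least)
    then have "I U \<le> (\<integral>\<^sup>+ \<omega>. ennreal K \<partial>M)" unfolding I_def by (rule nn_integral_mono_AE)
    also have "\<dots> < \<infinity>"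
      by (simp add: ennreal_mult_eq_top_iff less_top[symmetric])
    finally show ?thesis by simp
  qed
  have "is_ess_sup_family M S ?Z"
    unfolding is_ess_sup_family_def
  proof (intro conjI ballI impI)
    show "?Z \<in> borel_measurable M" by (rule msup[OF U])
  next
    fix f assume f: "f \<in> S"
    let ?W = "\<lambda>\<omega>. SUP g\<in>insert f U. g \<omega>"
    have fU: "insert f U \<in> C" using U f by (auto simp: C_def)
    have "AE \<omega> in M. ?W \<omega> \<le> ?Z \<omega>"
    proof -
      have "(\<integral>\<^sup>+ \<omega>. (?W \<omega> - ?Z \<omega>) \<partial>M) = I (insert f U) - I U"
        unfolding I_def using fin msup[OF U] msup[OF fU]
        by (intro nn_integral_diff) (auto simp: I_def intro!: SUP_subset_mono)
      also have "\<dots> = 0" using IU[OF fU] fin by (metis diff_eq_0_ennreal infinity_ennreal_def le_less_trans less_top)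
      finally have "AE \<omega> in M. ?W \<omega> - ?Z \<omega> = 0"
        using msup[OF U] msup[OF fU] by (subst (asm) nn_integral_0_iff_AE) auto
      then show ?thesis by (rule eventually_mono) (rule ennreal_minus_eq_0)
    qed
    then show "AE \<omega> in M. f \<omega> \<le> ?Z \<omega>"
      by (rule eventually_mono) simp
  next
    fix Z' assume "\<forall>f\<in>S. AE \<omega> in M. f \<omega> \<le> Z' \<omega>"
    then have "AE \<omega> in M. \<forall>f\<in>U. f \<omega> \<le> Z' \<omega>"
      using U by (subst AE_ball_countable) (auto simp: C_def)
    then show "AE \<omega> in M. ?Z \<omega> \<le> Z' \<omega>" by (rule eventually_mono) (simp add: SUP_least)
  qed
  then show ?thesis unfolding ess_sup_family_def by (rule someI[of "is_ess_sup_family M S"])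
qed

definition beta_coeff :: "'w measure \<Rightarrow> 'w measure \<Rightarrow> 'w measure \<Rightarrow> ennreal" where
  "beta_coeff M \<E>1 \<E>2 =
     (\<integral>\<^sup>+ \<omega>. ess_sup_family M
        ((\<lambda>E \<omega>'. ennreal \<bar>measure M E - real_cond_exp M \<E>2 (indicator E) \<omega>'\<bar>) ` sets \<E>1) \<omega> \<partial>M)"

text \<open>The truncated subtraction \<open>l - m\<close> is intended: for \<open>l \<le> m\<close> the index set is empty.\<close>

definition beta_mixing :: "'w measure \<Rightarrow> (nat \<Rightarrow> 'w \<Rightarrow> 'z::topological_space) \<Rightarrow> nat \<Rightarrow> ennreal" where
  "beta_mixing M Z m =
     (SUP l\<in>{1..}. beta_coeff M (generated_sigma M Z {1..l - m}) (generated_sigma M Z {l}))"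

text \<open>In \<open>theta2\<close>, the argument \<open>N\<close> stands for \<open>\<lfloor>n / m\<rfloor>\<close>.\<close>

definition theta0 :: "real \<Rightarrow> real \<Rightarrow> real" where
  "theta0 c lam =
     32 * ((1/3) * (1 - 1/c) * (1 - 1/lam) + (2 * lam - 1))\<^sup>2 * (c / (c - 1)) ^ 3 * (lam / (lam - 1))"

definition theta1 :: "real \<Rightarrow> nat \<Rightarrow> real" where
  "theta1 c m = ln (6 * (c + 1) * (2 * c + 3)) + ln (real m)"

definition theta2 :: "real \<Rightarrow> real \<Rightarrow> real" where
  "theta2 c N =
     1 + ln 24 + ln (1 + sqrt (1 + c * (c + 1) / (N + 1))) - ln (c - 1/c) + ln (N + 1)"

end

theory Submission
  imports Defs
begin

text \<open>For an excess loss \<open>h\<close>, \<open>E h\<^sup>2 \<le> 16 B\<^sup>2 E h\<close>. Hence the part \<open>(\<lambda> - 1) E h\<close> of the empirical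
  term \<open>\<lambda> E\<^sub>n h\<close> pays for a quadratic offset, and the expected supremum of \<open>E h - \<lambda> E\<^sub>n h\<close> over the class is
  controlled by an offset Rademacher complexity. This needs no concentration inequality: for a finite
  class the offset cancels the sub-Gaussian variance and leaves \<open>ln\<close> of the cardinality. A general class
  is replaced by a maximal packing for the empirical \<open>L\<^sup>1\<close> distance, whose cardinality is bounded through
  the Sauer--Shelah lemma; since the admissible discretisation error is as large as the entropy itself,
  that bound is self-improving and the logarithmic factor appears with the coefficient \<open>V\<close> only once.
  Dependence is handled by splitting the indices into residue classes modulo \<open>m\<close> and decoupling the
  observations of a class from their past one at a time, each at the cost of one mixing
  coefficient.\<close>

section \<open>The Sauer--Shelah lemma\<close>

text \<open>A mixing coefficient compares one observation with its past, so it does not hand over an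
  independent copy of a whole block at once. The induction along a block therefore passes through
  mixed states, in which some observations are still dependent while the later ones are already
  arbitrary fixed points carrying signs. Two features keep this affordable. The cost of one
  replacement depends on the range of the replaced summand alone, not on the accumulated sum. And
  the terminal estimate is deterministic, required at every configuration of points, so the packing
  may depend on the points with no question of measurable choice. The offset is attached to the
  population mean only; the sample enters the decoupling as \<open>- lam * h\<close>. Its
  coefficient \<open>2 * \<gamma>\<close> with
  \<open>\<gamma> = (lam - 1) / (32 * B\<^sup>2)\<close> is fixed by
  \<open>2 * \<gamma> * 16 * B\<^sup>2 = lam - 1\<close>. The bracket of the theorem, called
  \<open>W\<close>, has two roles: the packing scale is \<open>6 * B * W\<close>, and the logarithm
  of the packing number is at most \<open>W\<close>.\<close>

text \<open>Pajor's form, whose induction on the ground set involves no numerical bound. Forgetting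
  \<open>x\<close> merges \<open>A\<close> with \<open>insert x A\<close>, and \<open>?Q\<close>
  records the merged pairs. A set shattered by \<open>?Q\<close> stays shattered by
  \<open>\<A>\<close> after \<open>x\<close> is added, which yields new shattered sets, all
  containing \<open>x\<close>.\<close>

lemma card_le_card_shattered:
  assumes "finite G" "\<A> \<subseteq> Pow G"
  shows "card \<A> \<le> card {S. S \<subseteq> G \<and> (\<forall>T\<subseteq>S. \<exists>A\<in>\<A>. T = S \<inter> A)}"
  using assms
proof (induction G arbitrary: \<A> rule: finite_induct)
  case empty
  then have "\<A> = {} \<or> \<A> = {{}}" by auto
  then show ?case by (auto simp: card_gt_0_iff Suc_le_eq)
next
  case (insert x G)
  define sh :: "'a set \<Rightarrow> 'a set set \<Rightarrow> 'a set set"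
    where "sh H \<B> = {S. S \<subseteq> H \<and> (\<forall>T\<subseteq>S. \<exists>A\<in>\<B>. T = S \<inter> A)}" for H \<B>
  have shI: "S \<in> sh H \<B>" if "S \<subseteq> H" "\<And>T. T \<subseteq> S \<Longrightarrow> \<exists>A\<in>\<B>. T = S \<inter> A" for S H \<B>
    using that by (simp add: sh_def)
  have shD: "S \<subseteq> H" "T \<subseteq> S \<Longrightarrow> \<exists>A\<in>\<B>. T = S \<inter> A" if "S \<in> sh H \<B>" for S T H \<B>
    using that by (simp_all add: sh_def)
  let ?P = "(\<lambda>A. A - {x}) ` \<A>" and ?Q = "{A\<in>\<A>. x \<notin> A \<and> insert x A \<in> \<A>}"
  have finA: "finite \<A>" using insert by (meson finite.insertI finite_Pow_iff finite_subset)
  have PG: "?P \<subseteq> Pow G" "?Q \<subseteq> Pow G" using insert by auto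
  have finsh: "finite (sh H \<B>)" if "finite H" for H \<B> using that unfolding sh_def by auto
  \<comment> \<open>\<open>?P\<close> counts each pair \<open>A\<close>, \<open>insert x A\<close>
    once instead of twice; \<open>?Q\<close> restores the missing one.\<close>
  have "card \<A> \<le> card ?P + card ?Q"
  proof -
    define A0 A1 where "A0 = {A\<in>\<A>. x \<notin> A}" and "A1 = {A\<in>\<A>. x \<in> A}"
    define R1 where "R1 = (\<lambda>A. A - {x}) ` A1"
    have fin: "finite A0" "finite A1" "finite R1" using finA by (auto simp: A0_def A1_def R1_def)
    have "inj_on (\<lambda>A. A - {x}) A1" by (rule inj_onI) (auto simp: A1_def)
    then have c1: "card R1 = card A1" unfolding R1_def by (rule card_image)
    have A: "\<A> = A0 \<union> A1" by (auto simp: A0_def A1_def)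
    then have "card \<A> = card (A0 \<union> A1)" by (rule arg_cong)
    also have "\<dots> = card A0 + card A1"
      using fin by (intro card_Un_disjoint) (auto simp: A0_def A1_def)
    also have "\<dots> = card (A0 \<union> R1) + card (A0 \<inter> R1)"
      unfolding c1[symmetric] using fin by (intro card_Un_Int)
    also have "A0 \<union> R1 = ?P"
    proof -
      have "(\<lambda>A. A - {x}) ` A0 = id ` A0" by (rule image_cong) (auto simp: A0_def)
      then show ?thesis by (simp add: A image_Un R1_def)
    qed
    also have "card (A0 \<inter> R1) \<le> card ?Q"
    proof (rule card_mono)
      show "A0 \<inter> R1 \<subseteq> ?Q"
      proof
        fix A assume A: "A \<in> A0 \<inter> R1"
        then obtain A' where "A' \<in> A1" "A = A' - {x}" unfolding R1_def by blast
        with A show "A \<in> ?Q" by (simp add: A0_def A1_def insert_absorb)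
      qed
    qed (use finA in simp)
    finally show ?thesis by simp
  qed
  also have "\<dots> \<le> card (sh G ?P) + card (sh G ?Q)"
    using insert.IH[OF PG(1)] insert.IH[OF PG(2)] by (simp add: sh_def)
  also have "card (sh G ?Q) = card (insert x ` sh G ?Q)"
  proof (rule card_image[symmetric], rule inj_onI)
    fix R S assume "R \<in> sh G ?Q" "S \<in> sh G ?Q" "insert x R = insert x S"
    moreover then have "x \<notin> R" "x \<notin> S" using insert.hyps(2) unfolding sh_def by blast+
    ultimately show "R = S" by (metis insert_ident)
  qed
  also have "card (sh G ?P) + card (insert x ` sh G ?Q) = card (sh G ?P \<union> insert x ` sh G ?Q)"
  proof (intro card_Un_disjoint[symmetric] finsh finite_imageI)
    show "sh G ?P \<inter> insert x ` sh G ?Q = {}" using insert.hyps(2) unfolding sh_def by blast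
  qed (use insert.hyps in auto)
  also have "\<dots> \<le> card (sh (insert x G) \<A>)"
  proof (intro card_mono finsh Un_least subsetI)
    fix S assume S: "S \<in> sh G ?P"
    then have xS: "x \<notin> S" using insert.hyps(2) shD(1) by blast
    show "S \<in> sh (insert x G) \<A>"
    proof (rule shI)
      fix T assume "T \<subseteq> S"
      from shD(2)[OF S this] obtain A where "A \<in> \<A>" "T = S \<inter> (A - {x})" by blast
      then show "\<exists>A\<in>\<A>. T = S \<inter> A" using xS by blast
    qed (use shD(1)[OF S] in blast)
  next
    fix S assume "S \<in> insert x ` sh G ?Q"
    then obtain R where R: "R \<in> sh G ?Q" "S = insert x R" by blast
    then have xR: "x \<notin> R" using insert.hyps(2) shD(1) by blast
    show "S \<in> sh (insert x G) \<A>"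
    proof (rule shI)
      fix T assume T: "T \<subseteq> S"
      have "T - {x} \<subseteq> R" using T R(2) by blast
      from shD(2)[OF R(1) this] obtain A
        where A: "A \<in> \<A>" "x \<notin> A" "insert x A \<in> \<A>" "T - {x} = R \<inter> A" by blast
      \<comment> \<open>Both \<open>A\<close> and \<open>insert x A\<close> belong to
        \<open>\<A>\<close>, so membership of \<open>x\<close> in the trace can be chosen
        freely.\<close>
      show "\<exists>A\<in>\<A>. T = S \<inter> A"
      proof (cases "x \<in> T")
        case True
        then have "T = S \<inter> insert x A" using A R(2) xR by blast
        then show ?thesis using A by blast
      next
        case False
        then have "T = S \<inter> A" using A R(2) xR by blast
        then show ?thesis using A by blast
      qed
    qed (use shD(1)[OF R(1)] R(2) in blast)
  qed (use insert.hyps(1) in simp)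
  finally show ?case unfolding sh_def by simp
qed

text \<open>Weighting the terms by powers of \<open>r = V / k \<le> 1\<close> turns the partial sum
  into part of the expansion of \<open>(1 + r) ^ k \<le> exp V\<close>. For \<open>V = 0\<close> the
  right side is \<open>0 ^ 0 = 1\<close>.\<close>

lemma sum_binomial_le:
  assumes "V \<le> k" "0 < k"
  shows "(\<Sum>i\<le>V. real (k choose i)) \<le> (exp 1 * real k / real V) ^ V"
proof (cases "V = 0")
  case False
  define r where "r = real V / real k"
  have r: "0 < r" "r \<le> 1" using False assms by (auto simp: r_def)
  have "r ^ V * (\<Sum>i\<le>V. real (k choose i)) = (\<Sum>i\<le>V. real (k choose i) * r ^ V)"
    by (simp add: sum_distrib_left mult.commute)
  also have "\<dots> \<le> (\<Sum>i\<le>V. real (k choose i) * r ^ i)"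
    using r by (intro sum_mono mult_left_mono power_decreasing) auto
  also have "\<dots> \<le> (\<Sum>i\<le>k. real (k choose i) * r ^ i)"
    using r assms by (intro sum_mono2) auto
  also have "\<dots> = (r + 1) ^ k" by (subst binomial_ring) simp
  also have "\<dots> \<le> exp r ^ k"
    using r exp_ge_add_one_self[of r] by (intro power_mono) (auto simp: add.commute)
  also have "\<dots> = exp 1 ^ V"
    using assms by (simp add: exp_of_nat_mult[symmetric] r_def)
  finally have "(\<Sum>i\<le>V. real (k choose i)) \<le> exp 1 ^ V / r ^ V"
    using r by (simp add: pos_le_divide_eq mult.commute)
  then show ?thesis by (simp add: r_def power_divide power_mult_distrib)
qed simp

lemma card_bounded_card_subsets:
  assumes "finite G"
  shows "card {S. S \<subseteq> G \<and> card S \<le> V} = (\<Sum>i\<le>V. card G choose i)"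
proof -
  have "{S. S \<subseteq> G \<and> card S \<le> V} = (\<Union>i\<le>V. {S. S \<subseteq> G \<and> card S = i})" by auto
  also have "card \<dots> = (\<Sum>i\<le>V. card {S. S \<subseteq> G \<and> card S = i})"
    using assms by (intro card_UN_disjoint) auto
  finally show ?thesis using n_subsets[OF assms] by simp
qed

lemma card_shattered_le_vc_dim:
  assumes "vc_dim F = enat V" "finite S" "\<And>T. T \<subseteq> S \<Longrightarrow> \<exists>f\<in>F. T = S \<inter> subgraph f"
  shows "card S \<le> V"
proof -
  have "enat (card S) \<le> vc_dim F"
    unfolding vc_dim_def using assms(2,3) by (intro Sup_upper) blast
  then show ?thesis using assms(1) by simp
qed

lemma card_traces_le:
  assumes "vc_dim F = enat V" "finite G" "card G \<le> k"
  shows "card ((\<lambda>f. G \<inter> subgraph f) ` F) \<le> (\<Sum>i\<le>V. k choose i)"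
proof -
  let ?A = "(\<lambda>f. G \<inter> subgraph f) ` F"
  have "card ?A \<le> card {S. S \<subseteq> G \<and> (\<forall>T\<subseteq>S. \<exists>A\<in>?A. T = S \<inter> A)}"
    using assms by (intro card_le_card_shattered) auto
  also have "\<dots> \<le> card {S. S \<subseteq> G \<and> card S \<le> V}"
  proof (intro card_mono subsetI CollectI conjI)
    fix S assume S: "S \<in> {S. S \<subseteq> G \<and> (\<forall>T\<subseteq>S. \<exists>A\<in>?A. T = S \<inter> A)}"
    then show "card S \<le> V"
    proof (intro card_shattered_le_vc_dim[OF assms(1)])
      fix T assume "T \<subseteq> S"
      with S obtain f where "f \<in> F" "T = S \<inter> (G \<inter> subgraph f)" by blast
      then show "\<exists>f\<in>F. T = S \<inter> subgraph f" using S by (intro bexI[of _ f]) auto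
    qed (use S assms in \<open>auto intro: finite_subset\<close>)
  qed (use assms in auto)
  also have "\<dots> = (\<Sum>i\<le>V. card G choose i)" by (rule card_bounded_card_subsets) fact
  also have "\<dots> \<le> (\<Sum>i\<le>V. k choose i)" using assms by (intro sum_mono binomial_right_mono) auto
  finally show ?thesis .
qed

section \<open>Packing numbers of VC subgraph classes\<close>

text \<open>\<open>\<bar>v p - w p\<bar>\<close> is the length of the set of levels at which
  \<open>v p\<close> and \<open>w p\<close> fall on different sides. After summing over
  \<open>P\<close> and integrating over levels, the best level in an interval of length
  \<open>2 * B\<close> does at least as well as the average.\<close>

lemma ex_separating_level:
  fixes v w :: "'p \<Rightarrow> real"
  assumes "finite P" "B > 0"
    and v: "\<And>p. p \<in> P \<Longrightarrow> \<bar>v p\<bar> \<le> B" and w: "\<And>p. p \<in> P \<Longrightarrow> \<bar>w p\<bar> \<le> B"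
  shows "\<exists>u\<in>{-B<..B}. (\<Sum>p\<in>P. \<bar>v p - w p\<bar>) \<le> 2 * B * card {p\<in>P. (u \<le> v p) \<noteq> (u \<le> w p)}"
proof -
  define c where "c u = card {p\<in>P. (u \<le> v p) \<noteq> (u \<le> w p)}" for u
  \<comment> \<open>The number of separated indices is a natural number at most
    \<open>card P\<close>, so a best level exists.\<close>
  have "\<exists>u. u \<in> {-B<..B} \<and> (\<forall>u'. u' \<in> {-B<..B} \<longrightarrow> c u' \<le> c u)"
    using \<open>B > 0\<close> \<open>finite P\<close>
    by (intro ex_has_greatest_nat[of _ B _ "Suc (card P)"])
       (auto simp: c_def less_Suc_eq_le intro!: card_mono)
  then obtain u where u: "u \<in> {-B<..B}" "\<And>u'. u' \<in> {-B<..B} \<Longrightarrow> c u' \<le> c u" by blast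
  let ?I = "\<lambda>p. {min (v p) (w p)<..max (v p) (w p)}"
  have "(\<Sum>p\<in>P. \<bar>v p - w p\<bar>) = (\<Sum>p\<in>P. measure lborel (?I p))"
    by (intro sum.cong) auto
  also have "\<dots> = (\<integral>t. (\<Sum>p\<in>P. indicator (?I p) t) \<partial>lborel)"
    by (subst Bochner_Integration.integral_sum) (auto simp: integrable_indicator_iff)
  also have "\<dots> \<le> (\<integral>t. real (c u) * indicator {-B<..B} t \<partial>lborel)"
  proof (intro integral_mono)
    fix t
    have eq: "(\<Sum>p\<in>P. indicator (?I p) t) = real (c t)"
    proof -
      have "(\<Sum>p\<in>P. indicator (?I p) t) = (\<Sum>p\<in>P. if (t \<le> v p) \<noteq> (t \<le> w p) then 1 else 0 :: real)"
        by (intro sum.cong) (auto simp: indicator_def)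
      then show ?thesis using \<open>finite P\<close> by (simp add: c_def sum.If_cases Collect_conj_eq Int_commute)
    qed
    show "(\<Sum>p\<in>P. indicator (?I p) t) \<le> real (c u) * indicator {-B<..B} t"
    proof (cases "t \<in> {-B<..B}")
      case True
      then show ?thesis unfolding eq using u(2) by simp
    next
      case False
      have "t \<notin> ?I p" if "p \<in> P" for p using v[OF that] w[OF that] False by auto
      then have "(\<Sum>p\<in>P. indicator (?I p) t) = (0::real)" by (intro sum.neutral) auto
      then show ?thesis using False by simp
    qed
  qed (use \<open>B > 0\<close> in \<open>auto simp: integrable_indicator_iff\<close>)
  also have "\<dots> = 2 * B * c u" using \<open>B > 0\<close> by simp
  finally show ?thesis using u(1) unfolding c_def by blast
qed

text \<open>A second averaging, now over the points: if every point and level fell short of the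
  average share, summing over the points would contradict the assumed separation.\<close>

lemma ex_separating_point:
  fixes v w :: "'p \<Rightarrow> 'j \<Rightarrow> real" and D :: real
  assumes "finite P" "finite J" "J \<noteq> {}" "B > 0"
    and "\<And>p j. p \<in> P \<Longrightarrow> j \<in> J \<Longrightarrow> \<bar>v p j\<bar> \<le> B" "\<And>p j. p \<in> P \<Longrightarrow> j \<in> J \<Longrightarrow> \<bar>w p j\<bar> \<le> B"
    and sep: "\<And>p. p \<in> P \<Longrightarrow> 2 * B * D \<le> (\<Sum>j\<in>J. \<bar>v p j - w p j\<bar>)"
  shows "\<exists>j\<in>J. \<exists>u\<in>{-B<..B}. card P * D \<le> card J * card {p\<in>P. (u \<le> v p j) \<noteq> (u \<le> w p j)}"
proof (rule ccontr)
  assume contr: "\<not> ?thesis"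
  have "card P * (2 * B * D) \<le> (\<Sum>p\<in>P. \<Sum>j\<in>J. \<bar>v p j - w p j\<bar>)"
    using sum_mono[of P "\<lambda>_. 2 * B * D", OF sep] by simp
  also have "\<dots> = (\<Sum>j\<in>J. \<Sum>p\<in>P. \<bar>v p j - w p j\<bar>)" by (rule sum.swap)
  also have "\<dots> < (\<Sum>j\<in>J. 2 * B * (card P * D / card J))"
  proof (intro sum_strict_mono assms)
    fix j assume j: "j \<in> J"
    obtain u where u: "u \<in> {-B<..B}"
      "(\<Sum>p\<in>P. \<bar>v p j - w p j\<bar>) \<le> 2 * B * card {p\<in>P. (u \<le> v p j) \<noteq> (u \<le> w p j)}"
      using ex_separating_level[of P B "\<lambda>p. v p j" "\<lambda>p. w p j"] assms j by blast
    have "card J * card {p\<in>P. (u \<le> v p j) \<noteq> (u \<le> w p j)} < card P * D"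
      using contr u(1) j by force
    then have "card {p\<in>P. (u \<le> v p j) \<noteq> (u \<le> w p j)} < card P * D / card J"
      using assms by (simp add: pos_less_divide_eq card_gt_0_iff mult.commute)
    then have "2 * B * card {p\<in>P. (u \<le> v p j) \<noteq> (u \<le> w p j)} < 2 * B * (card P * D / card J)"
      using \<open>B > 0\<close> by (intro mult_strict_left_mono) auto
    with u(2) show "(\<Sum>p\<in>P. \<bar>v p j - w p j\<bar>) < 2 * B * (card P * D / card J)" by linarith
  qed
  also have "\<dots> = card P * (2 * B * D)" using assms by (simp add: field_simps)
  finally show False by simp
qed

text \<open>Derandomised form of Pollard's argument: among all levels at all points, some pair
  (point, level) separates at least an average share of the pairs not separated so far.\<close>

lemma ex_separating_set:
  fixes v :: "'f \<Rightarrow> 'j \<Rightarrow> real" and D :: real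
  assumes "finite H" "finite J" "J \<noteq> {}" "B > 0"
    and v: "\<And>f j. f \<in> H \<Longrightarrow> j \<in> J \<Longrightarrow> \<bar>v f j\<bar> \<le> B"
    and sep: "\<And>f g. f \<in> H \<Longrightarrow> g \<in> H \<Longrightarrow> f \<noteq> g \<Longrightarrow> 2 * B * D \<le> (\<Sum>j\<in>J. \<bar>v f j - v g j\<bar>)"
  shows "\<exists>G. finite G \<and> card G \<le> k \<and> G \<subseteq> J \<times> {-B<..B} \<and>
    card {p\<in>H \<times> H. fst p \<noteq> snd p \<and> (\<forall>(j, u)\<in>G. u \<le> v (fst p) j \<longleftrightarrow> u \<le> v (snd p) j)}
      \<le> (real (card H))\<^sup>2 * exp (- (k * D / card J))"
proof (induction k)
  case 0
  have "card {p\<in>H \<times> H. fst p \<noteq> snd p} \<le> card (H \<times> H)" using assms by (intro card_mono) auto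
  also have "\<dots> = (card H)\<^sup>2" by (simp add: card_cartesian_product power2_eq_square)
  finally show ?case by (intro exI[of _ "{}"]) (simp flip: of_nat_power)
next
  case (Suc k)
  define R where "R G = {p\<in>H \<times> H. fst p \<noteq> snd p \<and> (\<forall>(j, u)\<in>G. u \<le> v (fst p) j \<longleftrightarrow> u \<le> v (snd p) j)}" for G
  obtain G where G: "finite G" "card G \<le> k" "G \<subseteq> J \<times> {-B<..B}"
    "card (R G) \<le> (real (card H))\<^sup>2 * exp (- (k * D / card J))"
    using Suc.IH unfolding R_def by blast
  have fin: "finite (R G)" using assms by (auto simp: R_def)
  obtain j u where ju: "j \<in> J" "u \<in> {-B<..B}"
    "card (R G) * D \<le> card J * card {p\<in>R G. (u \<le> v (fst p) j) \<noteq> (u \<le> v (snd p) j)}"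
    using ex_separating_point[of "R G" J B "\<lambda>p. v (fst p)" "\<lambda>p. v (snd p)" D] fin assms
    by (force simp: R_def)
  let ?S = "{p\<in>R G. (u \<le> v (fst p) j) \<noteq> (u \<le> v (snd p) j)}"
  have nJ: "real (card J) > 0" using assms by (simp add: card_gt_0_iff)
  have "R (insert (j, u) G) = R G - ?S" by (auto simp: R_def)
  then have "real (card (R (insert (j, u) G))) = card (R G) - real (card ?S)"
    using fin by (subst of_nat_diff[symmetric]) (auto intro!: card_mono card_Diff_subset)
  \<comment> \<open>Each round separates at least the fraction \<open>D / card J\<close> of the
    remaining ordered pairs; \<open>1 - x \<le> exp (- x)\<close> turns the rounds into an
    exponential.\<close>
  also have "\<dots> \<le> card (R G) * (1 - D / card J)"
    using ju(3) nJ by (simp add: field_simps)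
  also have "\<dots> \<le> card (R G) * exp (- (D / card J))"
    using exp_ge_add_one_self[of "- (D / card J)"] by (intro mult_left_mono) auto
  also have "\<dots> \<le> (real (card H))\<^sup>2 * exp (- (k * D / card J)) * exp (- (D / card J))"
    using G(4) by (intro mult_right_mono) auto
  also have "\<dots> = (real (card H))\<^sup>2 * exp (- (Suc k * D / card J))"
    by (simp add: exp_add[symmetric] algebra_simps add_divide_distrib)
  finally have "card (R (insert (j, u) G)) \<le> (real (card H))\<^sup>2 * exp (- (Suc k * D / card J))" .
  then show ?case unfolding R_def
    using G ju by (intro exI[of _ "insert (j, u) G"]) (auto simp: card_insert_if)
qed

lemma abs_truncate_le: "B \<ge> 0 \<Longrightarrow> \<bar>truncate B f x\<bar> \<le> B"
  by (auto simp: truncate_def)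

text \<open>Once \<open>k\<close> pushes the bound of \<open>ex_separating_set\<close> below 1, no
  pair is left unseparated. Members of \<open>H\<close> then have distinct traces on at most
  \<open>k\<close> points of the product space, and Sauer--Shelah counts these traces.\<close>

lemma card_packing_le:
  fixes x :: "'j \<Rightarrow> 'x"
  assumes vc: "vc_dim F = enat V" and H: "finite H" "H \<subseteq> F" "H \<noteq> {}"
    and J: "finite J" "J \<noteq> {}" and "B > 0"
    and sep: "\<And>f g. f \<in> H \<Longrightarrow> g \<in> H \<Longrightarrow> f \<noteq> g \<Longrightarrow>
        2 * B * D \<le> (\<Sum>j\<in>J. \<bar>truncate B f (x j) - truncate B g (x j)\<bar>)"
    and k: "2 * ln (card H) < k * D / card J"
  shows "card H \<le> (\<Sum>i\<le>V. k choose i)"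
proof -
  obtain G where G: "finite G" "card G \<le> k" "G \<subseteq> J \<times> {-B<..B}" and
    c: "card {p\<in>H \<times> H. fst p \<noteq> snd p \<and> (\<forall>(j, u)\<in>G. u \<le> truncate B (fst p) (x j) \<longleftrightarrow> u \<le> truncate B (snd p) (x j))}
      \<le> (real (card H))\<^sup>2 * exp (- (k * D / card J))" (is "real (card ?R) \<le> _")
    using ex_separating_set[OF H(1) J \<open>B > 0\<close>, of "\<lambda>f j. truncate B f (x j)" D k] sep \<open>B > 0\<close>
    by (force simp: abs_truncate_le)
  have M: "real (card H) > 0" using H by (simp add: card_gt_0_iff)
  note c
  also have "(real (card H))\<^sup>2 * exp (- (k * D / card J)) < (real (card H))\<^sup>2 * exp (- (2 * ln (card H)))"
    using k M by (intro mult_strict_left_mono) auto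
  also have "\<dots> = 1"
  proof -
    have "exp (2 * ln (card H)) = (real (card H))\<^sup>2" 
      using M exp_of_nat_mult[of 2 "ln (card H)"] by simp
    then show ?thesis using M by (simp add: exp_minus)
  qed
  finally have "card ?R = 0" by simp
  then have R: "?R = {}" using H by simp
  let ?G = "(\<lambda>(j, u). (x j, u)) ` G"
  have "inj_on (\<lambda>f. ?G \<inter> subgraph f) H"
  proof (intro inj_onI, rule ccontr)
    fix f g assume fg: "f \<in> H" "g \<in> H" "?G \<inter> subgraph f = ?G \<inter> subgraph g" "f \<noteq> g"
    have "u \<le> truncate B f (x j) \<longleftrightarrow> u \<le> truncate B g (x j)" if "(j, u) \<in> G" for j u
    proof -
      have "(x j, u) \<in> ?G" using that by force
      then have "(x j, u) \<in> subgraph f \<longleftrightarrow> (x j, u) \<in> subgraph g" using fg(3) by blast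
      then have "u \<le> f (x j) \<longleftrightarrow> u \<le> g (x j)" by (simp add: subgraph_def)
      \<comment> \<open>For levels in \<open>{-B<..B}\<close>, comparison with the truncated value
        and with the value itself agree, so the VC bound of the untruncated class applies. The left
        end is open because every truncated value is at least \<open>- B\<close>.\<close>
      then show ?thesis using that G(3) by (auto simp: truncate_def)
    qed
    then have "(f, g) \<in> ?R" using fg by auto
    then show False using R by blast
  qed
  then have "card H = card ((\<lambda>f. ?G \<inter> subgraph f) ` H)" by (simp add: card_image)
  also have "\<dots> \<le> card ((\<lambda>f. ?G \<inter> subgraph f) ` F)"
  proof (intro card_mono image_mono H)
    show "finite ((\<lambda>f. ?G \<inter> subgraph f) ` F)"
      by (rule finite_subset[of _ "Pow ?G"]) (use G in auto)
  qed
  also have "\<dots> \<le> (\<Sum>i\<le>V. k choose i)"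
    using G by (intro card_traces_le[OF vc]) (auto intro: order.trans[OF card_image_le])
  finally show ?thesis .
qed

text \<open>The self-improvement. If \<open>w = ln (card H)\<close> exceeded \<open>W\<close>,
  separation at scale \<open>3 * W\<close> would take about \<open>2 * card J * w / (3 * W)\<close>
  points, and Sauer--Shelah would give \<open>w \<le> W + V * ln (w / W)\<close>. By
  \<open>ln t \<le> t - 1\<close> and \<open>V < W\<close> the right side is below \<open>w\<close>,
  a contradiction.\<close>

lemma ln_card_packing_le:
  fixes x :: "'j \<Rightarrow> 'x"
  assumes vc: "vc_dim F = enat V" and H: "finite H" "H \<subseteq> F" "H \<noteq> {}"
    and J: "finite J" "J \<noteq> {}" and "B > 0" and W: "W > real V"
    and W_ge: "V * ln (exp 1 * (2 * real (card J) / 3 + 1) / V) \<le> W"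
    and sep: "\<And>f g. f \<in> H \<Longrightarrow> g \<in> H \<Longrightarrow> f \<noteq> g \<Longrightarrow>
        6 * B * W \<le> (\<Sum>j\<in>J. \<bar>truncate B f (x j) - truncate B g (x j)\<bar>)"
  shows "ln (card H) \<le> W"
proof (rule ccontr)
  define w where "w = ln (card H)"
  assume "\<not> ?thesis"
  then have w: "w > W" by (simp add: w_def)
  have W0: "W > 0" using W by simp
  have M: "real (card H) > 0" using H by (simp add: card_gt_0_iff)
  have nJ: "real (card J) > 0" using J by (simp add: card_gt_0_iff)
  \<comment> \<open>\<open>card_packing_le\<close> asks for a strict inequality, hence the floor
    plus one; the maximum with \<open>V\<close> in \<open>k\<close> serves
    \<open>sum_binomial_le\<close>.\<close>
  define k0 where "k0 = nat \<lfloor>2 * real (card J) * w / (3 * W)\<rfloor> + 1"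
  define k where "k = max k0 V"
  have pos: "2 * real (card J) * w / (3 * W) \<ge> 0" using w W0 by simp
  have k0: "2 * real (card J) * w / (3 * W) < k0" "k0 \<le> 2 * real (card J) * w / (3 * W) + 1"
    using pos unfolding k0_def by linarith+
  have "2 * ln (card H) < k0 * (3 * W) / card J"
    using k0(1) W0 nJ by (simp add: field_simps w_def)
  also have "\<dots> \<le> k * (3 * W) / card J"
    using W0 by (intro divide_right_mono mult_right_mono) (auto simp: k_def)
  finally have "card H \<le> (\<Sum>i\<le>V. k choose i)"
    using sep by (intro card_packing_le[OF vc H J \<open>B > 0\<close>, of "3 * W"]) (auto simp: mult_ac)
  then have "real (card H) \<le> (\<Sum>i\<le>V. real (k choose i))" by (simp flip: of_nat_sum)
  also have "\<dots> \<le> (exp 1 * k / V) ^ V" by (intro sum_binomial_le) (auto simp: k_def k0_def)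
  finally have bound: "real (card H) \<le> (exp 1 * k / V) ^ V" .
  show False
  proof (cases "V = 0")
    case True
    with bound M have "card H = 1" by (simp add: w_def)
    then show False using w W0 by (simp add: w_def)
  next
    case False
    have k1: "real k > 0" by (simp add: k_def k0_def)
    have "w \<le> ln ((exp 1 * k / V) ^ V)" unfolding w_def using bound M by (intro ln_mono) auto
    also have "\<dots> = V * ln (exp 1 * k / V)" using False k1 by (simp add: ln_realpow)
    finally have w_le: "w \<le> V * ln (exp 1 * k / V)" .
    show False
    proof (cases "k0 \<le> V")
      case True
      then have "w \<le> V" using w_le False by (simp add: k_def)
      then show False using w W by simp
    next
      case False
      have "k \<le> 2 * real (card J) * w / (3 * W) + 1" using k0 False by (simp add: k_def)
      \<comment> \<open>Since \<open>w / W > 1\<close>, the 1 lost in rounding up can be multiplied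
        by it.\<close>
      also have "\<dots> \<le> (2 * real (card J) / 3 + 1) * (w / W)" using w W0 by (simp add: field_simps)
      finally have "exp 1 / V * k \<le> exp 1 / V * ((2 * real (card J) / 3 + 1) * (w / W))"
        by (intro mult_left_mono) auto
      then have "exp 1 * k / V \<le> exp 1 * (2 * real (card J) / 3 + 1) / V * (w / W)" by simp
      then have "ln (exp 1 * k / V) \<le> ln (exp 1 * (2 * real (card J) / 3 + 1) / V * (w / W))"
        using k1 \<open>V \<noteq> 0\<close> by (intro ln_mono) auto
      also have "\<dots> = ln (exp 1 * (2 * real (card J) / 3 + 1) / V) + ln (w / W)"
        using \<open>V \<noteq> 0\<close> w W0 by (intro ln_mult_pos divide_pos_pos mult_pos_pos add_nonneg_pos) auto
      also have "ln (w / W) \<le> w / W - 1" using w W0 by (intro ln_le_minus_one) auto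
      finally have "V * ln (exp 1 * k / V) \<le> V * (ln (exp 1 * (2 * real (card J) / 3 + 1) / V) + (w / W - 1))"
        by (intro mult_left_mono) auto
      also have "\<dots> = V * ln (exp 1 * (2 * real (card J) / 3 + 1) / V) + V * (w / W - 1)"
        by (simp add: distrib_left)
      also have "\<dots> \<le> W + V * (w / W - 1)" using W_ge by simp
      also have "V * (w / W - 1) < W * (w / W - 1)" using W w W0 by (intro mult_strict_right_mono) auto
      also have "W + W * (w / W - 1) = w" using W0 by (simp add: field_simps)
      finally show False using w_le by simp
    qed
  qed
qed

section \<open>Offset Rademacher averages of finite classes\<close>

text \<open>The sub-Gaussian bound for a random sign, by comparing the power series term by term:
  \<open>2 ^ n * n! \<le> (2 * n)!\<close>.\<close>

lemma cosh_le_exp_half_square: "cosh (x::real) \<le> exp (x\<^sup>2 / 2)"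
proof -
  have f: "2 ^ n * fact n \<le> (fact (2 * n) :: real)" for n
  proof (induction n)
    case (Suc n)
    have "(2::real) ^ Suc n * fact (Suc n) = (2 * real (Suc n)) * (2 ^ n * fact n)" by simp
    also have "\<dots> \<le> (2 * real (Suc n)) * fact (2 * n)" by (intro mult_left_mono Suc.IH) auto
    also have "\<dots> \<le> (real (2 * n + 2) * real (2 * n + 1)) * fact (2 * n)"
      by (intro mult_right_mono) auto
    also have "\<dots> = fact (2 * Suc n)" by (simp add: algebra_simps)
    finally show ?case .
  qed simp
  have s1: "(\<lambda>n. x ^ (2 * n) /\<^sub>R fact (2 * n)) sums cosh x"
  proof -
    have "(\<lambda>n. if even n then x ^ n /\<^sub>R fact n else 0) sums cosh x" by (rule cosh_converges)
    then have "(\<lambda>n. (\<lambda>n. if even n then x ^ n /\<^sub>R fact n else 0) (2 * n)) sums cosh x"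
      by (subst sums_mono_reindex[of "\<lambda>n. 2 * n"]) (auto simp: strict_mono_def elim!: evenE)
    then show ?thesis by simp
  qed
  have s2: "(\<lambda>n. (x\<^sup>2 / 2) ^ n /\<^sub>R fact n) sums exp (x\<^sup>2 / 2)" by (rule exp_converges)
  show ?thesis
  proof (rule sums_le[OF _ s1 s2])
    fix n
    have "x ^ (2 * n) / fact (2 * n) \<le> x ^ (2 * n) / (2 ^ n * fact n)"
      by (intro divide_left_mono f) (auto simp: power_mult)
    also have "\<dots> = (x\<^sup>2 / 2) ^ n / fact n" by (simp add: power_mult power_divide)
    finally show "x ^ (2 * n) /\<^sub>R fact (2 * n) \<le> (x\<^sup>2 / 2) ^ n /\<^sub>R fact n"
      by (simp add: field_simps)
  qed
qed

text \<open>The Massart-type bound: the quadratic offset cancels the sub-Gaussian variance term.\<close>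

lemma sum_Pow_Max_offset_le:
  fixes p q :: "'i \<Rightarrow> 'j \<Rightarrow> real"
  assumes I: "finite I" "I \<noteq> {}" and J: "finite J" and "s > 0"
    and pq: "\<And>i j. i \<in> I \<Longrightarrow> j \<in> J \<Longrightarrow> s * (p i j)\<^sup>2 \<le> 2 * q i j"
  shows "(\<Sum>S\<in>Pow J. MAX i\<in>I. \<Sum>j\<in>J. (if j \<in> S then p i j else - p i j) - q i j)
    \<le> 2 ^ card J * (ln (card I) / s)"
proof -
  define Z where "Z S i = (\<Sum>j\<in>J. (if j \<in> S then p i j else - p i j) - q i j)" for S i
  have cI: "real (card I) > 0" using I by (simp add: card_gt_0_iff)
  \<comment> \<open>Up to the factor \<open>2 ^ card J\<close>, summing over \<open>Pow J\<close> is
    averaging over independent signs, so the exponential moment factorises over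
    \<open>J\<close>.\<close>
  have exp_Z: "(\<Sum>S\<in>Pow J. exp (s * Z S i)) \<le> 2 ^ card J" if i: "i \<in> I" for i
  proof -
    have "exp (s * Z S i) = (\<Prod>j\<in>S. exp (s * (p i j - q i j))) * (\<Prod>j\<in>J-S. exp (s * (- p i j - q i j)))"
      if S: "S \<in> Pow J" for S
    proof -
      have "s * Z S i = (\<Sum>j\<in>J. s * ((if j \<in> S then p i j else - p i j) - q i j))"
        by (simp add: Z_def sum_distrib_left)
      also have "\<dots> = (\<Sum>j\<in>S. s * (p i j - q i j)) + (\<Sum>j\<in>J-S. s * (- p i j - q i j))"
        using S J by (subst sum.subset_diff[of S J]) (auto simp: add.commute intro!: arg_cong2[where f="(+)"] sum.cong)
      finally show ?thesis using S J
        by (simp add: exp_add exp_sum finite_subset[of S J])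
    qed
    then have "(\<Sum>S\<in>Pow J. exp (s * Z S i)) = (\<Prod>j\<in>J. exp (s * (p i j - q i j)) + exp (s * (- p i j - q i j)))"
      by (simp add: prod_add[OF J])
    also have "\<dots> \<le> (\<Prod>j\<in>J. 2)"
    proof (intro prod_mono conjI)
      fix j assume j: "j \<in> J"
      have e: "exp (s * (a - b)) = exp (s * a) * exp (- (s * b))" for a b
        by (simp add: exp_add[symmetric] right_diff_distrib)
      \<comment> \<open>The hypothesis \<open>s * p^2 \<le> 2 * q\<close> says exactly that the
        resulting exponent \<open>(s * p)^2 / 2 - s * q\<close> is not positive.\<close>
      have "exp (s * (p i j - q i j)) + exp (s * (- p i j - q i j)) = 2 * cosh (s * p i j) * exp (- (s * q i j))"
        by (simp only: e cosh_field_def) (simp add: distrib_right)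
      also have "\<dots> \<le> 2 * exp ((s * p i j)\<^sup>2 / 2) * exp (- (s * q i j))"
        using cosh_le_exp_half_square[of "s * p i j"] by (intro mult_right_mono mult_left_mono) auto
      also have "\<dots> = 2 * exp (s * (s * (p i j)\<^sup>2 - 2 * q i j) / 2)"
        by (simp add: exp_add[symmetric] algebra_simps power2_eq_square diff_divide_distrib)
      also have "\<dots> \<le> 2 * exp 0"
        using pq[OF i j] \<open>s > 0\<close> by (intro mult_left_mono exp_le_cancel_iff[THEN iffD2])
          (auto intro!: divide_nonpos_pos mult_nonneg_nonpos)
      finally show "exp (s * (p i j - q i j)) + exp (s * (- p i j - q i j)) \<le> 2" by simp
    qed (auto intro: add_nonneg_nonneg)
    finally show ?thesis by simp
  qed
  \<comment> \<open>In place of Jensen's inequality for \<open>ln\<close>, the tangent bound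
    \<open>ln y \<le> y - 1\<close> is used: it is linear in the exponential moments, and the
    correction term is at most zero after summing over \<open>S\<close>.\<close>
  have "s * (MAX i\<in>I. Z S i) \<le> ln (card I) + ((\<Sum>i\<in>I. exp (s * Z S i)) / card I - 1)" for S
  proof -
    have "Max (Z S ` I) \<in> Z S ` I" using I by (intro Max_in) auto
    then obtain i where i: "i \<in> I" "Max (Z S ` I) = Z S i" by auto
    have "s * Z S i = ln (card I) + ln (exp (s * Z S i) / card I)"
      using cI by (simp add: ln_div)
    also have "ln (exp (s * Z S i) / card I) \<le> exp (s * Z S i) / card I - 1"
      using cI by (intro ln_le_minus_one) auto
    also have "exp (s * Z S i) \<le> (\<Sum>i\<in>I. exp (s * Z S i))"
      using I i by (intro member_le_sum) auto
    finally show ?thesis using i cI by (simp add: divide_right_mono)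
  qed
  then have "(\<Sum>S\<in>Pow J. s * (MAX i\<in>I. Z S i))
      \<le> (\<Sum>S\<in>Pow J. ln (card I) + ((\<Sum>i\<in>I. exp (s * Z S i)) / card I - 1))" by (intro sum_mono)
  also have "\<dots> = 2 ^ card J * ln (card I) + ((\<Sum>S\<in>Pow J. \<Sum>i\<in>I. exp (s * Z S i)) / card I - 2 ^ card J)"
    by (simp add: sum.distrib sum_subtractf card_Pow J sum_divide_distrib)
  also have "(\<Sum>S\<in>Pow J. \<Sum>i\<in>I. exp (s * Z S i)) = (\<Sum>i\<in>I. \<Sum>S\<in>Pow J. exp (s * Z S i))"
    by (rule sum.swap)
  also have "\<dots> \<le> (\<Sum>i\<in>I. 2 ^ card J)" using exp_Z by (intro sum_mono)
  also have "(\<Sum>i\<in>I. 2 ^ card J) / real (card I) - 2 ^ card J = 0" using cI by simp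
  finally have "s * (\<Sum>S\<in>Pow J. MAX i\<in>I. Z S i) \<le> 2 ^ card J * ln (card I)"
    using cI by (simp add: sum_distrib_left divide_right_mono)
  then show ?thesis using \<open>s > 0\<close> unfolding Z_def by (simp add: field_simps)
qed

section \<open>Mixing coefficients and decoupling\<close>

lemma space_generated_sigma [simp]: "space (generated_sigma M Z I) = space M"
  by (auto simp: generated_sigma_def intro!: space_measure_of)

lemma sets_generated_sigma:
  "sets (generated_sigma M Z I) = sigma_sets (space M) {Z k -` A \<inter> space M | k A. k \<in> I \<and> A \<in> sets borel}"
  unfolding generated_sigma_def by (intro sets_measure_of) auto

lemma subalgebra_generated_sigma:
  assumes "\<And>k. k \<in> I \<Longrightarrow> Z k \<in> borel_measurable M"
  shows "subalgebra M (generated_sigma M Z I)"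
proof -
  have "{Z k -` A \<inter> space M | k A. k \<in> I \<and> A \<in> sets borel} \<subseteq> sets M"
    using assms by (auto intro: measurable_sets)
  then show ?thesis unfolding subalgebra_def sets_generated_sigma
    by (simp add: sets.sigma_sets_subset)
qed

lemma measurable_generated_sigma:
  assumes "k \<in> I" shows "Z k \<in> borel_measurable (generated_sigma M Z I)"
  using assms by (intro measurableI) (auto simp: sets_generated_sigma)

lemma ennreal_integral_le_nn_integral:
  fixes f :: "'a \<Rightarrow> real"
  assumes "integrable M f"
  shows "ennreal (\<integral>x. f x \<partial>M) \<le> (\<integral>\<^sup>+x. ennreal (f x) \<partial>M)"
proof -
  have "ennreal (\<integral>x. f x \<partial>M) \<le> ennreal (enn2real (\<integral>\<^sup>+x. f x \<partial>M))"
    unfolding real_lebesgue_integral_def[OF assms] by (intro ennreal_leI) simp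
  also have "\<dots> \<le> (\<integral>\<^sup>+x. f x \<partial>M)" by (simp add: ennreal_enn2real_if)
  finally show ?thesis .
qed

text \<open>Conditional probabilities lie in \<open>[0, 1]\<close>, so the family is bounded by 1
  and the chosen function really is an essential supremum.\<close>

lemma AE_cond_prob_diff_le_ess_sup:
  assumes "prob_space M" "subalgebra M \<E>1" "subalgebra M \<E>2" "A \<in> sets \<E>1"
  shows "AE \<omega> in M. ennreal \<bar>measure M A - real_cond_exp M \<E>2 (indicator A) \<omega>\<bar> \<le>
    ess_sup_family M ((\<lambda>E \<omega>'. ennreal \<bar>measure M E - real_cond_exp M \<E>2 (indicator E) \<omega>'\<bar>) ` sets \<E>1) \<omega>"
proof -
  interpret prob_space M by fact
  interpret finite_measure_subalgebra M \<E>2 by standard fact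
  let ?S = "(\<lambda>E \<omega>'. ennreal \<bar>measure M E - real_cond_exp M \<E>2 (indicator E) \<omega>'\<bar>) ` sets \<E>1"
  have "is_ess_sup_family M ?S (ess_sup_family M ?S)"
  proof (rule is_ess_sup_family_exists[where K = 1])
    fix f assume "f \<in> ?S"
    then obtain E where E: "E \<in> sets \<E>1"
      and f: "f = (\<lambda>\<omega>'. ennreal \<bar>measure M E - real_cond_exp M \<E>2 (indicator E) \<omega>'\<bar>)" by auto
    have [measurable]: "E \<in> sets M" using E assms(2) by (auto simp: subalgebra_def)
    show "f \<in> borel_measurable M" unfolding f by measurable
    have int: "integrable M (indicator E :: _ \<Rightarrow> real)" by (simp add: integrable_indicator_iff less_top[symmetric])
    have "AE \<omega> in M. real_cond_exp M \<E>2 (indicator E) \<omega> \<ge> 0" by (rule real_cond_exp_ge_c[OF int]) simp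
    moreover have "AE \<omega> in M. real_cond_exp M \<E>2 (indicator E) \<omega> \<le> 1"
      by (rule real_cond_exp_le_c[OF int]) (simp add: indicator_def)
    ultimately show "AE \<omega> in M. f \<omega> \<le> ennreal 1"
    proof eventually_elim
      case (elim \<omega>)
      then show ?case unfolding f using prob_le_1[of E] measure_nonneg[of M E]
        by (intro ennreal_leI) linarith
    qed
  qed (rule finite_measure_axioms)
  then have "\<forall>f\<in>?S. AE \<omega> in M. f \<omega> \<le> ess_sup_family M ?S \<omega>"
    unfolding is_ess_sup_family_def by (elim conjE)
  from bspec[OF this imageI[OF assms(4)]] show ?thesis .
qed

text \<open>As \<open>B v\<close> lies in \<open>\<E>2\<close>, each summand is the integral over
  \<open>B v\<close> of the conditional minus the unconditional probability of \<open>A v\<close>.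
  The cells are disjoint, so at most one summand acts at a given point, and the essential supremum
  bounds it whatever event the cell selects. One coefficient thus pays for all cells
  together.\<close>

lemma sum_dependence_le_beta_coeff:
  assumes M: "prob_space M" and E1: "subalgebra M \<E>1" and E2: "subalgebra M \<E>2" and Q: "finite Q"
    and A: "\<And>v. v \<in> Q \<Longrightarrow> A v \<in> sets \<E>1" and B: "\<And>v. v \<in> Q \<Longrightarrow> B v \<in> sets \<E>2"
    and disj: "disjoint_family_on B Q"
  shows "ennreal (\<Sum>v\<in>Q. measure M (A v \<inter> B v) - measure M (A v) * measure M (B v))
    \<le> beta_coeff M \<E>1 \<E>2"
proof -
  interpret prob_space M by fact
  interpret finite_measure_subalgebra M \<E>2 by standard fact
  define W where "W = ess_sup_family M ((\<lambda>E \<omega>'. ennreal \<bar>measure M E - real_cond_exp M \<E>2 (indicator E) \<omega>'\<bar>) ` sets \<E>1)"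
  define r where "r v = real_cond_exp M \<E>2 (indicator (A v))" for v
  have AM: "A v \<in> sets M" if "v \<in> Q" for v using A[OF that] E1 by (auto simp: subalgebra_def)
  have BM: "B v \<in> sets M" if "v \<in> Q" for v using B[OF that] E2 by (auto simp: subalgebra_def)
  have intA: "integrable M (indicator (A v) :: _ \<Rightarrow> real)" if "v \<in> Q" for v
    using AM[OF that] by (simp add: integrable_indicator_iff less_top[symmetric])
  have int_r: "integrable M (r v)" if "v \<in> Q" for v
    unfolding r_def by (rule real_cond_exp_int(1)[OF intA[OF that]])
  have int: "integrable M (\<lambda>\<omega>. indicator (B v) \<omega> * (r v \<omega> - measure M (A v)))" if "v \<in> Q" for v
    using integrable_mult_indicator[OF BM[OF that], of "\<lambda>\<omega>. r v \<omega> - measure M (A v)"] int_r[OF that]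
    by simp
  have eq: "measure M (A v \<inter> B v) - measure M (A v) * measure M (B v) =
      (\<integral>\<omega>. indicator (B v) \<omega> * (r v \<omega> - measure M (A v)) \<partial>M)" if v: "v \<in> Q" for v
  proof -
    have "measure M (A v \<inter> B v) = (\<integral>\<omega>. indicator (B v) \<omega> * indicator (A v) \<omega> \<partial>M)"
      using AM[OF v] BM[OF v] by (simp add: indicator_inter_arith[symmetric] Int_commute)
    also have "\<dots> = (\<integral>\<omega>. indicator (B v) \<omega> * r v \<omega> \<partial>M)"
      using real_cond_exp_intA[OF intA[OF v] B[OF v]]
      by (simp add: set_lebesgue_integral_def r_def)
    finally have 1: "measure M (A v \<inter> B v) = (\<integral>\<omega>. indicator (B v) \<omega> * r v \<omega> \<partial>M)" .
    have 2: "measure M (A v) * measure M (B v) = (\<integral>\<omega>. indicator (B v) \<omega> * measure M (A v) \<partial>M)"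
      using BM[OF v] by simp
    show ?thesis
      unfolding 1 2 right_diff_distrib
      using integrable_mult_indicator[OF BM[OF v] int_r[OF v]] BM[OF v]
      by (intro Bochner_Integration.integral_diff[symmetric])
         (auto simp: integrable_indicator_iff less_top[symmetric])
  qed
  have "(\<Sum>v\<in>Q. measure M (A v \<inter> B v) - measure M (A v) * measure M (B v)) =
      (\<integral>\<omega>. (\<Sum>v\<in>Q. indicator (B v) \<omega> * (r v \<omega> - measure M (A v))) \<partial>M)"
    using int by (simp add: eq)
  also have "ennreal \<dots> \<le> (\<integral>\<^sup>+\<omega>. ennreal (\<Sum>v\<in>Q. indicator (B v) \<omega> * (r v \<omega> - measure M (A v))) \<partial>M)"
    by (intro ennreal_integral_le_nn_integral Bochner_Integration.integrable_sum int)
  also have "\<dots> \<le> (\<integral>\<^sup>+\<omega>. W \<omega> \<partial>M)"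
  proof (rule nn_integral_mono_AE)
    have "AE \<omega> in M. \<forall>v\<in>Q. ennreal \<bar>measure M (A v) - r v \<omega>\<bar> \<le> W \<omega>"
      unfolding W_def r_def using AE_cond_prob_diff_le_ess_sup[OF M E1 E2 A]
      by (intro AE_finite_allI Q)
    then show "AE \<omega> in M. ennreal (\<Sum>v\<in>Q. indicator (B v) \<omega> * (r v \<omega> - measure M (A v))) \<le> W \<omega>"
    proof eventually_elim
      case (elim \<omega>)
      show ?case
      proof (cases "\<exists>v\<in>Q. \<omega> \<in> B v")
        case True
        then obtain v where v: "v \<in> Q" "\<omega> \<in> B v" by blast
        then have "\<omega> \<notin> B v'" if "v' \<in> Q" "v' \<noteq> v" for v'
          using disj that unfolding disjoint_family_on_def by blast
        then have "(\<Sum>v\<in>Q. indicator (B v) \<omega> * (r v \<omega> - measure M (A v))) =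
            (\<Sum>v'\<in>{v}. indicator (B v') \<omega> * (r v' \<omega> - measure M (A v')))"
          using Q v by (intro sum.mono_neutral_right) auto
        also have "\<dots> \<le> \<bar>measure M (A v) - r v \<omega>\<bar>" using v by simp
        finally show ?thesis using elim v by (meson ennreal_leI order_trans)
      next
        case False
        then have "(\<Sum>v\<in>Q. indicator (B v) \<omega> * (r v \<omega> - measure M (A v))) = 0"
          by (intro sum.neutral) auto
        then show ?thesis by simp
      qed
    qed
  qed
  also have "\<dots> = beta_coeff M \<E>1 \<E>2" by (simp add: beta_coeff_def W_def)
  finally show ?thesis .
qed

text \<open>The sum counts the thresholds \<open>k / N\<close> not exceeding \<open>x\<close>, so it
  equals the floor of \<open>x * N\<close>. This is the passage from events to bounded
  functions.\<close>

lemma layer_cake_approx: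
  assumes "0 \<le> x" "x \<le> 1" "N > 0"
  shows "(\<Sum>k=1..N. if real k / N \<le> x then 1 else 0) / N \<le> x"
    and "x \<le> (\<Sum>k=1..N. if real k / N \<le> x then 1 else 0) / N + 1 / N"
proof -
  define j where "j = nat \<lfloor>x * N\<rfloor>"
  have j: "real j \<le> x * N" "x * N < real j + 1"
    using assms by (simp_all add: j_def)
  have "x * real N \<le> 1 * real N" using assms by (intro mult_right_mono) auto
  then have jN: "j \<le> N" using j by simp
  have "real k / N \<le> x \<longleftrightarrow> k \<le> j" for k
    using assms j by (auto simp: pos_divide_le_eq le_nat_iff le_floor_iff j_def)
  then have "(\<Sum>k=1..N. if real k / N \<le> x then 1 else 0 :: real) = (\<Sum>k\<in>{1..N} \<inter> {..j}. 1)"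
    by (simp add: sum.If_cases atMost_def)
  also have "{1..N} \<inter> {..j} = {1..j}" using jN by auto
  finally have s: "(\<Sum>k=1..N. if real k / N \<le> x then 1 else 0 :: real) = j" by simp
  show "(\<Sum>k=1..N. if real k / N \<le> x then 1 else 0) / N \<le> x"
    "x \<le> (\<Sum>k=1..N. if real k / N \<le> x then 1 else 0) / N + 1 / N"
    unfolding s using assms j by (simp_all add: field_simps)
qed

text \<open>Slicing \<open>G v\<close> into \<open>N\<close> level events reduces the claim to
  \<open>sum_dependence_le_beta_coeff\<close> on each level. Every level has weight
  \<open>R / N\<close>, so the total cost stays \<open>R * b\<close>, and the rounding error
  vanishes as \<open>N\<close> grows.\<close>

lemma sum_covariance_le_beta_coeff:
  assumes M: "prob_space M" and E1: "subalgebra M \<E>1" and E2: "subalgebra M \<E>2" and Q: "finite Q"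
    and G: "\<And>v. v \<in> Q \<Longrightarrow> G v \<in> borel_measurable \<E>1"
    and G01: "\<And>v \<omega>. v \<in> Q \<Longrightarrow> \<omega> \<in> space M \<Longrightarrow> 0 \<le> G v \<omega> \<and> G v \<omega> \<le> R"
    and "R > 0"
    and B: "\<And>v. v \<in> Q \<Longrightarrow> B v \<in> sets \<E>2"
    and disj: "disjoint_family_on B Q"
    and b: "beta_coeff M \<E>1 \<E>2 \<le> ennreal b" "b \<ge> 0"
  shows "(\<Sum>v\<in>Q. (\<integral>\<omega>. indicator (B v) \<omega> * G v \<omega> \<partial>M) - measure M (B v) * (\<integral>\<omega>. G v \<omega> \<partial>M)) \<le> R * b"
proof -
  interpret prob_space M by fact
  have [measurable]: "G v \<in> borel_measurable M" if "v \<in> Q" for v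
    using measurable_from_subalg[OF E1 G[OF that]] .
  have BM [measurable]: "B v \<in> sets M" if "v \<in> Q" for v using B[OF that] E2 by (auto simp: subalgebra_def)
  define c where "c v = (\<integral>\<omega>. indicator (B v) \<omega> * G v \<omega> \<partial>M) - measure M (B v) * (\<integral>\<omega>. G v \<omega> \<partial>M)" for v
  have sumB: "(\<Sum>v\<in>Q. measure M (B v)) \<le> 1"
  proof -
    have "(\<Sum>v\<in>Q. measure M (B v)) = measure M (\<Union>v\<in>Q. B v)"
      using BM by (intro measure_finite_Union[symmetric] Q disj) (auto simp: emeasure_eq_measure)
    then show ?thesis by simp
  qed
  have main: "(\<Sum>v\<in>Q. c v) \<le> R * b + R / N" if N: "N > 0" for N :: nat
  proof -
    define A where "A k v = {\<omega>\<in>space M. real k / N \<le> G v \<omega> / R}" for k v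
    have A1: "A k v \<in> sets \<E>1" if "v \<in> Q" for k v
    proof -
      have [measurable]: "G v \<in> borel_measurable \<E>1" using G[OF that] .
      have sp: "space \<E>1 = space M" using E1 by (simp add: subalgebra_def)
      show ?thesis unfolding A_def sp[symmetric] by measurable
    qed
    then have AM [measurable]: "A k v \<in> sets M" if "v \<in> Q" for k v
      using E1 that by (auto simp: subalgebra_def)
    have lower: "R / N * (\<Sum>k=1..N. indicator (A k v) \<omega>) \<le> G v \<omega>"
      and upper: "G v \<omega> \<le> R / N * (\<Sum>k=1..N. indicator (A k v) \<omega>) + R / N"
      if v: "v \<in> Q" and \<omega>: "\<omega> \<in> space M" for v \<omega>
    proof -
      have s: "(\<Sum>k=1..N. indicator (A k v) \<omega> :: real) = (\<Sum>k=1..N. if real k / N \<le> G v \<omega> / R then 1 else 0)"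
        using \<omega> by (intro sum.cong) (auto simp: A_def)
      have "0 \<le> G v \<omega> / R" "G v \<omega> / R \<le> 1" using G01[OF v \<omega>] \<open>R > 0\<close> by auto
      note * = layer_cake_approx[OF this N]
      show "R / N * (\<Sum>k=1..N. indicator (A k v) \<omega>) \<le> G v \<omega>"
        using *(1) \<open>R > 0\<close> N unfolding s by (simp add: field_simps)
      show "G v \<omega> \<le> R / N * (\<Sum>k=1..N. indicator (A k v) \<omega>) + R / N"
        using *(2) \<open>R > 0\<close> N unfolding s by (simp add: field_simps)
    qed
    have intG: "integrable M (G v)" if "v \<in> Q" for v
      using that G01 by (intro integrable_const_bound[of _ R]) auto
    have intBG: "integrable M (\<lambda>\<omega>. indicator (B v) \<omega> * G v \<omega>)" if "v \<in> Q" for v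
      using integrable_mult_indicator[OF BM[OF that] intG[OF that]] by simp
    \<comment> \<open>Rounding up in one integral and down in the other loses \<open>R / N\<close>
      times the probability of \<open>B v\<close>; over disjoint cells these losses add up to at
      most \<open>R / N\<close>.\<close>
    have cv: "c v \<le> R / N * (\<Sum>k=1..N. measure M (A k v \<inter> B v) - measure M (A k v) * measure M (B v))
        + R / N * measure M (B v)" if v: "v \<in> Q" for v
    proof -
      have iA: "integrable M (indicator (A k v) :: _ \<Rightarrow> real)" for k
        using AM[OF v] by (simp add: integrable_indicator_iff less_top[symmetric])
      have iAB: "integrable M (indicator (A k v \<inter> B v) :: _ \<Rightarrow> real)" for k
        using AM[OF v] BM[OF v] by (simp add: integrable_indicator_iff less_top[symmetric])
      have iB: "integrable M (indicator (B v) :: _ \<Rightarrow> real)"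
        using BM[OF v] by (simp add: integrable_indicator_iff less_top[symmetric])
      have "(\<integral>\<omega>. indicator (B v) \<omega> * G v \<omega> \<partial>M) \<le>
          (\<integral>\<omega>. R / N * (\<Sum>k=1..N. indicator (A k v \<inter> B v) \<omega>) + R / N * indicator (B v) \<omega> \<partial>M)"
      proof (intro integral_mono intBG[OF v])
        fix \<omega> assume \<omega>: "\<omega> \<in> space M"
        show "indicator (B v) \<omega> * G v \<omega> \<le>
          R / N * (\<Sum>k=1..N. indicator (A k v \<inter> B v) \<omega>) + R / N * indicator (B v) \<omega>"
          using upper[OF v \<omega>] by (cases "\<omega> \<in> B v") (auto simp: indicator_inter_arith)
      qed (intro Bochner_Integration.integrable_add integrable_mult_right Bochner_Integration.integrable_sum iAB iB)
      also have "\<dots> = R / N * (\<Sum>k=1..N. measure M (A k v \<inter> B v)) + R / N * measure M (B v)"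
        using iAB iB AM[OF v] BM[OF v]
        by (subst Bochner_Integration.integral_add) (auto simp: Bochner_Integration.integral_sum)
      finally have 1: "(\<integral>\<omega>. indicator (B v) \<omega> * G v \<omega> \<partial>M) \<le>
        R / N * (\<Sum>k=1..N. measure M (A k v \<inter> B v)) + R / N * measure M (B v)" .
      have "R / N * (\<Sum>k=1..N. measure M (A k v)) = (\<integral>\<omega>. R / N * (\<Sum>k=1..N. indicator (A k v) \<omega>) \<partial>M)"
        using iA AM[OF v] by (simp add: Bochner_Integration.integral_sum)
      also have "\<dots> \<le> (\<integral>\<omega>. G v \<omega> \<partial>M)"
        using lower[OF v]
        by (intro integral_mono intG[OF v] integrable_mult_right Bochner_Integration.integrable_sum iA)
      finally have "measure M (B v) * (R / N * (\<Sum>k=1..N. measure M (A k v))) \<le> measure M (B v) * (\<integral>\<omega>. G v \<omega> \<partial>M)"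
        by (intro mult_left_mono) auto
      also have "measure M (B v) * (R / N * (\<Sum>k=1..N. measure M (A k v))) =
          R / N * (\<Sum>k=1..N. measure M (A k v) * measure M (B v))"
        by (simp add: sum_distrib_left sum_distrib_right mult_ac)
      finally show ?thesis using 1
        unfolding c_def sum_subtractf right_diff_distrib by linarith
    qed
    have dep: "(\<Sum>v\<in>Q. measure M (A k v \<inter> B v) - measure M (A k v) * measure M (B v)) \<le> b" for k
    proof -
      have "ennreal (\<Sum>v\<in>Q. measure M (A k v \<inter> B v) - measure M (A k v) * measure M (B v)) \<le> ennreal b"
        using A1 B disj b(1) by (intro order_trans[OF sum_dependence_le_beta_coeff[OF M E1 E2 Q]]) auto
      then show ?thesis using b(2) by simp
    qed
    have "(\<Sum>v\<in>Q. c v) \<le> (\<Sum>v\<in>Q. R / N * (\<Sum>k=1..N. measure M (A k v \<inter> B v) - measure M (A k v) * measure M (B v))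
        + R / N * measure M (B v))"
      using cv by (intro sum_mono)
    also have "\<dots> = R / N * (\<Sum>k=1..N. \<Sum>v\<in>Q. measure M (A k v \<inter> B v) - measure M (A k v) * measure M (B v))
        + R / N * (\<Sum>v\<in>Q. measure M (B v))"
      by (simp only: sum.distrib sum_distrib_left[symmetric] sum.swap[of _ "{1..N}" Q])
    also have "\<dots> \<le> R / N * (\<Sum>k=1..N. b) + R / N * 1"
      using \<open>R > 0\<close> dep sumB by (intro add_mono mult_left_mono sum_mono) auto
    also have "\<dots> = R * b + R / N" using N by (simp add: field_simps)
    finally show ?thesis .
  qed
  show ?thesis
  proof (rule LIMSEQ_le_const)
    show "(\<lambda>N. R * b + R / real (Suc N)) \<longlonglongrightarrow> R * b"
      using tendsto_add[OF tendsto_const, OF LIMSEQ_Suc[OF lim_const_over_n], of "R * b" R] by simp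
    show "\<exists>N. \<forall>n\<ge>N. (\<Sum>v\<in>Q. (\<integral>\<omega>. indicator (B v) \<omega> * G v \<omega> \<partial>M) - measure M (B v) * (\<integral>\<omega>. G v \<omega> \<partial>M)) \<le> R * b + R / real (Suc n)"
      using main unfolding c_def by blast
  qed
qed

lemma Max_image_le_add:
  fixes u v :: "'i \<Rightarrow> real"
  assumes "finite H" "H \<noteq> {}" "\<And>i. i \<in> H \<Longrightarrow> u i \<le> v i + c"
  shows "(MAX i\<in>H. u i) \<le> (MAX i\<in>H. v i) + c"
proof -
  have "u i \<le> (MAX i\<in>H. v i) + c" if "i \<in> H" for i
    using assms(3)[OF that] Max_ge[OF finite_imageI[OF assms(1)] imageI[OF that], of v] by linarith
  then show ?thesis using assms by (intro Max.boundedI) auto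
qed

lemma abs_Max_image_le:
  fixes u :: "'i \<Rightarrow> real"
  assumes "finite H" "H \<noteq> {}" "\<And>i. i \<in> H \<Longrightarrow> \<bar>u i\<bar> \<le> c"
  shows "\<bar>MAX i\<in>H. u i\<bar> \<le> c"
proof -
  have "Max (u ` H) \<in> u ` H" using assms by (intro Max_in) auto
  then show ?thesis using assms(3) by auto
qed

text \<open>An observation is replaced by an independent copy without constructing a coupling. The
  values of all \<open>\<tau> i\<close> are rounded to a grid; on each cell the maximum becomes a
  function of the past, \<open>sum_covariance_le_beta_coeff\<close> applies, and the mesh tends to
  zero.\<close>

lemma expectation_Max_decouple:
  fixes \<zeta> :: "'w \<Rightarrow> 'z::topological_space" and K R b :: real
  assumes M: "prob_space M" and E1: "subalgebra M \<E>1" and E2: "subalgebra M \<E>2"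
    and \<zeta>: "\<zeta> \<in> borel_measurable \<E>2" and H: "finite H" "H \<noteq> {}"
    and a: "\<And>i. i \<in> H \<Longrightarrow> a i \<in> borel_measurable \<E>1"
    and aK: "\<And>i \<omega>. i \<in> H \<Longrightarrow> \<omega> \<in> space M \<Longrightarrow> \<bar>a i \<omega>\<bar> \<le> K"
    and \<tau>: "\<And>i. i \<in> H \<Longrightarrow> \<tau> i \<in> borel_measurable borel"
    and \<tau>R: "\<And>i z. i \<in> H \<Longrightarrow> \<bar>\<tau> i z\<bar> \<le> R" and "R > 0"
    and b: "beta_coeff M \<E>1 \<E>2 \<le> ennreal b" "b \<ge> 0"
  shows "(\<integral>\<omega>. (MAX i\<in>H. a i \<omega> + \<tau> i (\<zeta> \<omega>)) \<partial>M)
    \<le> (\<integral>\<omega>. (\<integral>z. (MAX i\<in>H. a i \<omega> + \<tau> i z) \<partial>distr M borel \<zeta>) \<partial>M) + 2 * R * b"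
proof -
  interpret prob_space M by fact
  have \<zeta>M [measurable]: "\<zeta> \<in> borel_measurable M" using measurable_from_subalg[OF E2 \<zeta>] .
  have aM [measurable]: "a i \<in> borel_measurable M" if "i \<in> H" for i using measurable_from_subalg[OF E1 a[OF that]] .
  note \<tau> [measurable]
  define \<nu> where "\<nu> = distr M borel \<zeta>"
  interpret \<nu>: prob_space \<nu> unfolding \<nu>_def by (rule prob_space_distr) measurable
  have sets_\<nu> [measurable_cong, simp]: "sets \<nu> = sets borel" and sp_\<nu> [simp]: "space \<nu> = UNIV" by (auto simp: \<nu>_def)
  interpret P: pair_prob_space M \<nu> ..
  define g where "g \<omega> z = (MAX i\<in>H. a i \<omega> + \<tau> i z)" for \<omega> z
  have gM [measurable]: "(\<lambda>p. g (fst p) (snd p)) \<in> borel_measurable (M \<Otimes>\<^sub>M \<nu>)"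
    unfolding g_def using H by (intro borel_measurable_Max) measurable
  have gb: "\<bar>g \<omega> z\<bar> \<le> K + R" if "\<omega> \<in> space M" for \<omega> z
    unfolding g_def using H
  proof (intro abs_Max_image_le)
    fix i assume "i \<in> H"
    then show "\<bar>a i \<omega> + \<tau> i z\<bar> \<le> K + R" using aK[OF _ that, of i] \<tau>R[of i z] by linarith
  qed
  have gM2 [measurable]: "(\<lambda>\<omega>. g \<omega> (\<zeta> \<omega>)) \<in> borel_measurable M"
    unfolding g_def using H by (intro borel_measurable_Max) measurable
  have gM3 [measurable]: "g \<omega> \<in> borel_measurable borel" for \<omega>
    unfolding g_def using H by (intro borel_measurable_Max) measurable
  \<comment> \<open>Subtracting the maximum of the past leaves a quantity whose range has length
    \<open>2 * R\<close> up to the mesh. Without this the cost would grow with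
    \<open>K\<close>.\<close>
  define a0 where "a0 \<omega> = (MAX i\<in>H. a i \<omega>)" for \<omega>
  have a0E [measurable]: "a0 \<in> borel_measurable \<E>1"
    unfolding a0_def using H a by (intro borel_measurable_Max) auto
  have a0M [measurable]: "a0 \<in> borel_measurable M" using measurable_from_subalg[OF E1 a0E] .
  have a0b: "\<bar>a0 \<omega>\<bar> \<le> K" if "\<omega> \<in> space M" for \<omega>
    unfolding a0_def using H aK[OF _ that] by (intro abs_Max_image_le) auto
  have int_a0: "integrable M a0" using a0b by (intro integrable_const_bound[of _ K]) auto
  have int_g1: "integrable M (\<lambda>\<omega>. g \<omega> (\<zeta> \<omega>))" using gb by (intro integrable_const_bound[of _ "K + R"]) auto
  have int_gz: "integrable \<nu> (g \<omega>)" if "\<omega> \<in> space M" for \<omega>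
    using gb[OF that] by (intro \<nu>.integrable_const_bound[of _ "K + R"]) auto
  have int_J: "integrable M (\<lambda>\<omega>. \<integral>z. g \<omega> z \<partial>\<nu>)"
  proof (rule integrable_const_bound[of _ "K + R"])
    show "AE \<omega> in M. norm (\<integral>z. g \<omega> z \<partial>\<nu>) \<le> K + R"
    proof (rule AE_I2)
      fix \<omega> assume \<omega>: "\<omega> \<in> space M"
      have "norm (\<integral>z. g \<omega> z \<partial>\<nu>) \<le> (\<integral>z. norm (g \<omega> z) \<partial>\<nu>)" by (rule integral_norm_bound)
      also have "\<dots> \<le> (\<integral>z. K + R \<partial>\<nu>)"
        using int_gz[OF \<omega>] gb[OF \<omega>] by (intro integral_mono) auto
      finally show "norm (\<integral>z. g \<omega> z \<partial>\<nu>) \<le> K + R" by (simp add: \<nu>.prob_space[simplified])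
    qed
    show "(\<lambda>\<omega>. \<integral>z. g \<omega> z \<partial>\<nu>) \<in> borel_measurable M"
      using gM by (intro \<nu>.borel_measurable_lebesgue_integral) (simp add: case_prod_beta')
  qed
  have main: "(\<integral>\<omega>. g \<omega> (\<zeta> \<omega>) \<partial>M) \<le> (\<integral>\<omega>. (\<integral>z. g \<omega> z \<partial>\<nu>) \<partial>M) + (2 * R + \<delta>) * b + \<delta>" if \<delta>: "\<delta> > 0" for \<delta>
  proof -
    \<comment> \<open>All possible vectors of rounded values; finite because \<open>H\<close> is
      finite and the \<open>\<tau> i\<close> are bounded.\<close>
    define Q where "Q = (PiE H (\<lambda>_. {\<lfloor>- R / \<delta>\<rfloor>..\<lfloor>R / \<delta>\<rfloor>}))"
    have Q: "finite Q" unfolding Q_def using H by (intro finite_PiE) auto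
    define B' where "B' v = {z. \<forall>i\<in>H. \<lfloor>\<tau> i z / \<delta>\<rfloor> = v i}" for v
    have B'M [measurable]: "B' v \<in> sets borel" for v
    proof -
      have "{z \<in> space borel. \<forall>i\<in>H. \<lfloor>\<tau> i z / \<delta>\<rfloor> = v i} \<in> sets borel" using H(1) by measurable
      then show ?thesis by (simp add: B'_def)
    qed
    define B where "B v = \<zeta> -` B' v \<inter> space M" for v
    have B: "B v \<in> sets \<E>2" for v
      using measurable_sets[OF \<zeta> B'M] E2 by (simp add: B_def subalgebra_def)
    have PB: "measure M (B v) = measure \<nu> (B' v)" for v
      unfolding B_def \<nu>_def by (rule measure_distr[symmetric]) auto
    define vz where "vz z = restrict (\<lambda>i. \<lfloor>\<tau> i z / \<delta>\<rfloor>) H" for z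
    have vzQ: "vz z \<in> Q" for z
      unfolding Q_def vz_def
    proof (rule restrict_PiE_iff[THEN iffD2], intro ballI)
      fix i assume "i \<in> H"
      then have "- R \<le> \<tau> i z" "\<tau> i z \<le> R" using \<tau>R[of i z] by linarith+
      then show "\<lfloor>\<tau> i z / \<delta>\<rfloor> \<in> {\<lfloor>- R / \<delta>\<rfloor>..\<lfloor>R / \<delta>\<rfloor>}"
        using \<delta> divide_right_mono[of "- R" "\<tau> i z" \<delta>] divide_right_mono[of "\<tau> i z" R \<delta>]
        by (auto intro!: floor_mono)
    qed
    have vz_iff: "z \<in> B' v \<longleftrightarrow> v = vz z" if "v \<in> Q" for v z
      using that unfolding B'_def vz_def Q_def by (auto simp: PiE_iff extensional_def fun_eq_iff)
    have disj: "disjoint_family_on B Q"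
      unfolding disjoint_family_on_def B_def using vz_iff by auto
    \<comment> \<open>The shift \<open>R + \<delta>\<close> compensates for rounding down and places
      \<open>G v\<close> in \<open>[0, 2 * R + \<delta>]\<close>.\<close>
    define G where "G v \<omega> = (MAX i\<in>H. a i \<omega> + \<delta> * v i) - a0 \<omega> + R + \<delta>" for v \<omega>
    have GE: "G v \<in> borel_measurable \<E>1" for v
      unfolding G_def using H a by (intro borel_measurable_add borel_measurable_diff borel_measurable_Max a0E) auto
    then have GM [measurable]: "G v \<in> borel_measurable M" for v using measurable_from_subalg[OF E1] by blast
    have vb: "- R - \<delta> \<le> \<delta> * v i" "\<delta> * v i \<le> R" if "v \<in> Q" "i \<in> H" for v i
    proof -
      have "\<lfloor>- R / \<delta>\<rfloor> \<le> v i" "v i \<le> \<lfloor>R / \<delta>\<rfloor>" using that by (auto simp: Q_def PiE_iff)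
      then have "- R / \<delta> - 1 \<le> v i" "v i \<le> R / \<delta>" by linarith+
      then show "- R - \<delta> \<le> \<delta> * v i" "\<delta> * v i \<le> R" using \<delta> by (auto simp: field_simps)
    qed
    have Gb: "0 \<le> G v \<omega> \<and> G v \<omega> \<le> 2 * R + \<delta>" if "v \<in> Q" for v \<omega>
    proof -
      have "(MAX i\<in>H. a i \<omega> + \<delta> * v i) \<le> a0 \<omega> + R"
        unfolding a0_def using vb[OF that] H by (intro Max_image_le_add) auto
      moreover have "a0 \<omega> \<le> (MAX i\<in>H. a i \<omega> + \<delta> * v i) + (R + \<delta>)"
        unfolding a0_def
      proof (intro Max_image_le_add H)
        fix i assume "i \<in> H"
        then show "a i \<omega> \<le> a i \<omega> + \<delta> * v i + (R + \<delta>)" using vb(1)[OF that, of i] by linarith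
      qed
      ultimately show ?thesis by (simp add: G_def)
    qed
    have sumG: "(\<Sum>v\<in>Q. indicator (B' v) z * G v \<omega>) = G (vz z) \<omega>" for z \<omega>
    proof -
      have "(\<Sum>v\<in>Q. indicator (B' v) z * G v \<omega>) = (\<Sum>v\<in>{vz z}. indicator (B' v) z * G v \<omega>)"
        using Q vzQ vz_iff by (intro sum.mono_neutral_right) (auto simp: indicator_def)
      then show ?thesis using vz_iff[OF vzQ] by simp
    qed
    have vz\<tau>: "\<delta> * vz z i \<le> \<tau> i z" "\<tau> i z \<le> \<delta> * vz z i + \<delta>" if "i \<in> H" for z i
    proof -
      have "\<delta> * \<lfloor>\<tau> i z / \<delta>\<rfloor> \<le> \<delta> * (\<tau> i z / \<delta>)" "\<delta> * (\<tau> i z / \<delta>) \<le> \<delta> * (\<lfloor>\<tau> i z / \<delta>\<rfloor> + 1)"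
        using \<delta> by (intro mult_left_mono; linarith)+
      then show "\<delta> * vz z i \<le> \<tau> i z" "\<tau> i z \<le> \<delta> * vz z i + \<delta>"
        using \<delta> that by (auto simp: distrib_left vz_def)
    qed
    have up: "g \<omega> z \<le> G (vz z) \<omega> + a0 \<omega> - R" for \<omega> z
    proof -
      have "g \<omega> z \<le> (MAX i\<in>H. a i \<omega> + \<delta> * vz z i) + \<delta>"
        unfolding g_def using H vz\<tau>(2) by (intro Max_image_le_add) (auto simp: algebra_simps)
      then show ?thesis by (simp add: G_def)
    qed
    have lo: "G (vz z) \<omega> + a0 \<omega> - R - \<delta> \<le> g \<omega> z" for \<omega> z
    proof -
      have "(MAX i\<in>H. a i \<omega> + \<delta> * vz z i) \<le> g \<omega> z + 0"
        unfolding g_def using H vz\<tau>(1) by (intro Max_image_le_add) auto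
      then show ?thesis by (simp add: G_def)
    qed
    have intG: "integrable M (G v)" if "v \<in> Q" for v
      using Gb[OF that] by (intro integrable_const_bound[of _ "2 * R + \<delta>"]) auto
    have BM: "B v \<in> sets M" for v using B E2 by (auto simp: subalgebra_def)
    have intBG: "integrable M (\<lambda>\<omega>. indicator (B v) \<omega> * G v \<omega>)" if "v \<in> Q" for v
      using integrable_mult_indicator[OF BM intG[OF that]] by simp
    have "(\<integral>\<omega>. g \<omega> (\<zeta> \<omega>) \<partial>M) \<le> (\<integral>\<omega>. (\<Sum>v\<in>Q. indicator (B v) \<omega> * G v \<omega>) + a0 \<omega> - R \<partial>M)"
    proof (intro integral_mono int_g1)
      fix \<omega> assume \<omega>: "\<omega> \<in> space M"
      have "indicator (B v) \<omega> = (indicator (B' v) (\<zeta> \<omega>) :: real)" for v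
        using \<omega> by (simp add: B_def indicator_def)
      then show "g \<omega> (\<zeta> \<omega>) \<le> (\<Sum>v\<in>Q. indicator (B v) \<omega> * G v \<omega>) + a0 \<omega> - R"
        using up[of \<omega> "\<zeta> \<omega>"] sumG[of "\<zeta> \<omega>" \<omega>] by simp
    qed (intro Bochner_Integration.integrable_diff Bochner_Integration.integrable_add
        Bochner_Integration.integrable_sum intBG int_a0 integrable_const)
    also have "\<dots> = (\<Sum>v\<in>Q. \<integral>\<omega>. indicator (B v) \<omega> * G v \<omega> \<partial>M) + (\<integral>\<omega>. a0 \<omega> \<partial>M) - R"
      using intBG int_a0 by (simp add: prob_space)
    finally have 1: "(\<integral>\<omega>. g \<omega> (\<zeta> \<omega>) \<partial>M) \<le> (\<Sum>v\<in>Q. \<integral>\<omega>. indicator (B v) \<omega> * G v \<omega> \<partial>M) + (\<integral>\<omega>. a0 \<omega> \<partial>M) - R" .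
    have "(\<Sum>v\<in>Q. measure M (B v) * (\<integral>\<omega>. G v \<omega> \<partial>M)) + (\<integral>\<omega>. a0 \<omega> \<partial>M) - R - \<delta> =
      (\<integral>\<omega>. (\<Sum>v\<in>Q. measure M (B v) * G v \<omega>) + a0 \<omega> - R - \<delta> \<partial>M)"
      using intG int_a0 by (simp add: prob_space)
    also have "\<dots> \<le> (\<integral>\<omega>. (\<integral>z. g \<omega> z \<partial>\<nu>) \<partial>M)"
    proof (intro integral_mono int_J)
      fix \<omega> assume \<omega>: "\<omega> \<in> space M"
      have iB: "integrable \<nu> (indicator (B' v) :: _ \<Rightarrow> real)" for v
        by (simp add: integrable_indicator_iff less_top[symmetric])
      have "(\<Sum>v\<in>Q. measure M (B v) * G v \<omega>) + a0 \<omega> - R - \<delta> =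
        (\<integral>z. (\<Sum>v\<in>Q. indicator (B' v) z * G v \<omega>) + (a0 \<omega> - R - \<delta>) \<partial>\<nu>)"
        using iB by (simp add: PB \<nu>.prob_space[simplified])
      also have "\<dots> \<le> (\<integral>z. g \<omega> z \<partial>\<nu>)"
      proof (intro integral_mono int_gz[OF \<omega>])
        fix z
        show "(\<Sum>v\<in>Q. indicator (B' v) z * G v \<omega>) + (a0 \<omega> - R - \<delta>) \<le> g \<omega> z"
          using lo[of z \<omega>] unfolding sumG by simp
      qed (intro Bochner_Integration.integrable_add Bochner_Integration.integrable_sum
          integrable_mult_left iB \<nu>.integrable_const)
      finally show "(\<Sum>v\<in>Q. measure M (B v) * G v \<omega>) + a0 \<omega> - R - \<delta> \<le> (\<integral>z. g \<omega> z \<partial>\<nu>)" .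
    qed (intro Bochner_Integration.integrable_diff Bochner_Integration.integrable_add
        Bochner_Integration.integrable_sum intG int_a0 integrable_const integrable_mult_right)
    finally have 2: "(\<Sum>v\<in>Q. measure M (B v) * (\<integral>\<omega>. G v \<omega> \<partial>M)) + (\<integral>\<omega>. a0 \<omega> \<partial>M) - R - \<delta>
      \<le> (\<integral>\<omega>. (\<integral>z. g \<omega> z \<partial>\<nu>) \<partial>M)" .
    have 3: "(\<Sum>v\<in>Q. (\<integral>\<omega>. indicator (B v) \<omega> * G v \<omega> \<partial>M) - measure M (B v) * (\<integral>\<omega>. G v \<omega> \<partial>M)) \<le> (2 * R + \<delta>) * b"
      using \<open>R > 0\<close> \<delta> by (intro sum_covariance_le_beta_coeff[OF M E1 E2 Q] GE Gb B disj b) auto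
    show ?thesis using 1 2 3 unfolding sum_subtractf by linarith
  qed
  have "(\<integral>\<omega>. g \<omega> (\<zeta> \<omega>) \<partial>M) \<le> (\<integral>\<omega>. (\<integral>z. g \<omega> z \<partial>\<nu>) \<partial>M) + 2 * R * b + e" if "e > 0" for e
  proof -
    \<comment> \<open>With this mesh the total error \<open>\<delta> * b + \<delta>\<close> equals
      \<open>e\<close>.\<close>
    have "e / (b + 1) > 0" using that b by simp
    note main[OF this]
    also have "(\<integral>\<omega>. (\<integral>z. g \<omega> z \<partial>\<nu>) \<partial>M) + (2 * R + e / (b + 1)) * b + e / (b + 1) =
        (\<integral>\<omega>. (\<integral>z. g \<omega> z \<partial>\<nu>) \<partial>M) + 2 * R * b + e / (b + 1) * (b + 1)"
      by (simp only: distrib_right distrib_left mult_1_right add.assoc)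
    also have "e / (b + 1) * (b + 1) = e" using b(2) by simp
    finally show ?thesis .
  qed
  then show ?thesis unfolding g_def \<nu>_def by (rule field_le_epsilon)
qed

section \<open>Symmetrisation along a block\<close>

text \<open>Each set containing \<open>l\<close> is hit twice by \<open>insert l\<close>, each other
  set twice by removal of \<open>l\<close>: redrawing one fair sign leaves the uniform law
  unchanged.\<close>

lemma sum_Pow_toggle:
  fixes f :: "'j set \<Rightarrow> real"
  assumes "finite J" "l \<in> J"
  shows "(\<Sum>S\<in>Pow J. f (insert l S) + f (S - {l})) = 2 * (\<Sum>S\<in>Pow J. f S)"
proof -
  define J' where "J' = J - {l}"
  have J: "J = insert l J'" "finite J'" "l \<notin> J'" using assms by (auto simp: J'_def)
  have split: "(\<Sum>S\<in>Pow J. g S) = (\<Sum>S\<in>Pow J'. g S + g (insert l S))" for g :: "'j set \<Rightarrow> real"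
  proof -
    have "inj_on (insert l) (Pow J')"
      using J(3) by (intro inj_onI) (metis PowD insert_ident subsetD)
    moreover have "Pow J' \<inter> insert l ` Pow J' = {}" using J(3) by blast
    ultimately show ?thesis
      unfolding J(1) Pow_insert using J(2)
      by (simp add: sum.union_disjoint sum.reindex sum.distrib)
  qed
  have "f (insert l S) + f (S - {l}) + (f (insert l (insert l S)) + f (insert l S - {l})) = 2 * (f S + f (insert l S))"
    if "S \<in> Pow J'" for S
  proof -
    have "S - {l} = S" "insert l S - {l} = S" using that J(3) by auto
    then show ?thesis by simp
  qed
  then show ?thesis unfolding split by (simp add: sum_distrib_left add.commute)
qed

text \<open>\<open>a + p + w\<close> is the mean of \<open>a + 2 * p\<close> and
  \<open>a + 2 * w\<close>; the maximum is convex, and Jensen's inequality moves the integral of the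
  ghost part \<open>wp\<close> outside. One fair sign then chooses between the halves, which is the
  origin of the factor 2 in the symmetrised sums.\<close>

lemma integral_Max_symmetrize:
  fixes \<nu> :: "'z measure" and Rp Rm :: real
  assumes "prob_space \<nu>" and H: "finite H" "H \<noteq> {}"
    and wp: "\<And>i. i \<in> H \<Longrightarrow> wp i \<in> borel_measurable \<nu>" "\<And>i z. i \<in> H \<Longrightarrow> \<bar>wp i z\<bar> \<le> Rp"
    and wm: "\<And>i. i \<in> H \<Longrightarrow> wm i \<in> borel_measurable \<nu>" "\<And>i z. i \<in> H \<Longrightarrow> \<bar>wm i z\<bar> \<le> Rm"
  shows "(\<integral>z. (MAX i\<in>H. a i + ((\<integral>z. wp i z \<partial>\<nu>) + wm i z)) \<partial>\<nu>)
    \<le> ((\<integral>z. (MAX i\<in>H. a i + 2 * wp i z) \<partial>\<nu>) + (\<integral>z. (MAX i\<in>H. a i + 2 * wm i z) \<partial>\<nu>)) / 2"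
proof -
  interpret prob_space \<nu> by fact
  define A where "A = (MAX i\<in>H. \<bar>a i\<bar>)"
  have A: "\<bar>a i\<bar> \<le> A" if "i \<in> H" for i unfolding A_def using H that by (intro Max_ge) auto
  have int_Max: "integrable \<nu> (\<lambda>z. MAX i\<in>H. c i + d * w i z)"
    if "\<And>i. i \<in> H \<Longrightarrow> w i \<in> borel_measurable \<nu>" "\<And>i z. i \<in> H \<Longrightarrow> \<bar>w i z\<bar> \<le> R" for w c R and d :: real
  proof (rule integrable_const_bound[of _ "(MAX i\<in>H. \<bar>c i\<bar>) + \<bar>d\<bar> * R"])
    show "AE z in \<nu>. norm (MAX i\<in>H. c i + d * w i z) \<le> (MAX i\<in>H. \<bar>c i\<bar>) + \<bar>d\<bar> * R"
      unfolding real_norm_def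
    proof (intro AE_I2 abs_Max_image_le H)
      fix z i assume i: "i \<in> H"
      have "\<bar>c i\<bar> \<le> (MAX i\<in>H. \<bar>c i\<bar>)" using H i by (intro Max_ge) auto
      moreover have "\<bar>d * w i z\<bar> \<le> \<bar>d\<bar> * R" unfolding abs_mult using that(2)[OF i, of z] by (intro mult_left_mono) auto
      ultimately show "\<bar>c i + d * w i z\<bar> \<le> (MAX i\<in>H. \<bar>c i\<bar>) + \<bar>d\<bar> * R" by linarith
    qed
    show "(\<lambda>z. MAX i\<in>H. c i + d * w i z) \<in> borel_measurable \<nu>"
      using H that(1) by (intro borel_measurable_Max borel_measurable_add borel_measurable_times) auto
  qed
  have int_wp: "integrable \<nu> (wp i)" if "i \<in> H" for i
    using wp that by (intro integrable_const_bound[of _ Rp]) auto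
  have jensen: "(MAX i\<in>H. a i + 2 * (\<integral>z. wp i z \<partial>\<nu>)) \<le> (\<integral>z. (MAX i\<in>H. a i + 2 * wp i z) \<partial>\<nu>)"
  proof (rule Max.boundedI)
    fix x assume "x \<in> (\<lambda>i. a i + 2 * (\<integral>z. wp i z \<partial>\<nu>)) ` H"
    then obtain i where i: "i \<in> H" "x = a i + 2 * (\<integral>z. wp i z \<partial>\<nu>)" by auto
    have "x = (\<integral>z. a i + 2 * wp i z \<partial>\<nu>)" using int_wp[OF i(1)] by (simp add: i(2) prob_space)
    also have "\<dots> \<le> (\<integral>z. (MAX i\<in>H. a i + 2 * wp i z) \<partial>\<nu>)"
      using int_wp[OF i(1)] H i(1) wp by (intro integral_mono int_Max[of wp Rp] Max_ge) auto
    finally show "x \<le> (\<integral>z. (MAX i\<in>H. a i + 2 * wp i z) \<partial>\<nu>)" .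
  qed (use H in auto)
  have "(\<integral>z. (MAX i\<in>H. a i + ((\<integral>z. wp i z \<partial>\<nu>) + wm i z)) \<partial>\<nu>)
    \<le> (\<integral>z. ((MAX i\<in>H. a i + 2 * (\<integral>z. wp i z \<partial>\<nu>)) + (MAX i\<in>H. a i + 2 * wm i z)) / 2 \<partial>\<nu>)"
  proof (rule integral_mono)
    show "integrable \<nu> (\<lambda>z. MAX i\<in>H. a i + ((\<integral>z. wp i z \<partial>\<nu>) + wm i z))"
      using int_Max[of wm Rm "\<lambda>i. a i + (\<integral>z. wp i z \<partial>\<nu>)" 1] wm by (simp add: add.assoc)
    show "integrable \<nu> (\<lambda>z. ((MAX i\<in>H. a i + 2 * (\<integral>z. wp i z \<partial>\<nu>)) + (MAX i\<in>H. a i + 2 * wm i z)) / 2)"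
      using wm by (intro integrable_divide_zero Bochner_Integration.integrable_add integrable_const int_Max) auto
    fix z
    show "(MAX i\<in>H. a i + ((\<integral>z. wp i z \<partial>\<nu>) + wm i z))
      \<le> ((MAX i\<in>H. a i + 2 * (\<integral>z. wp i z \<partial>\<nu>)) + (MAX i\<in>H. a i + 2 * wm i z)) / 2"
    proof (rule Max.boundedI)
      fix x assume "x \<in> (\<lambda>i. a i + ((\<integral>z. wp i z \<partial>\<nu>) + wm i z)) ` H"
      then obtain i where i: "i \<in> H" "x = a i + ((\<integral>z. wp i z \<partial>\<nu>) + wm i z)" by auto
      have "a i + 2 * (\<integral>z. wp i z \<partial>\<nu>) \<le> (MAX i\<in>H. a i + 2 * (\<integral>z. wp i z \<partial>\<nu>))"
        "a i + 2 * wm i z \<le> (MAX i\<in>H. a i + 2 * wm i z)"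
        using H i(1) by (intro Max_ge; simp)+
      then show "x \<le> ((MAX i\<in>H. a i + 2 * (\<integral>z. wp i z \<partial>\<nu>)) + (MAX i\<in>H. a i + 2 * wm i z)) / 2"
        unfolding i(2) by (simp add: field_simps)
    qed (use H in auto)
  qed
  also have "\<dots> = ((MAX i\<in>H. a i + 2 * (\<integral>z. wp i z \<partial>\<nu>)) + (\<integral>z. (MAX i\<in>H. a i + 2 * wm i z) \<partial>\<nu>)) / 2"
    using int_Max[of wm Rm a 2] wm by (simp add: prob_space)
  also have "\<dots> \<le> ((\<integral>z. (MAX i\<in>H. a i + 2 * wp i z) \<partial>\<nu>) + (\<integral>z. (MAX i\<in>H. a i + 2 * wm i z) \<partial>\<nu>)) / 2"
    using jensen by simp
  finally show ?thesis .
qed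

lemma Fubini_Max:
  fixes \<nu> :: "'z measure" and K R :: real
  assumes M: "prob_space M" and N: "prob_space \<nu>" and H: "finite H" "H \<noteq> {}"
    and a: "\<And>i. i \<in> H \<Longrightarrow> a i \<in> borel_measurable M" "\<And>i \<omega>. i \<in> H \<Longrightarrow> \<omega> \<in> space M \<Longrightarrow> \<bar>a i \<omega>\<bar> \<le> K"
    and w: "\<And>i. i \<in> H \<Longrightarrow> w i \<in> borel_measurable \<nu>" "\<And>i z. i \<in> H \<Longrightarrow> \<bar>w i z\<bar> \<le> R"
  shows "(\<integral>z. (\<integral>\<omega>. (MAX i\<in>H. a i \<omega> + 2 * w i z) \<partial>M) \<partial>\<nu>) = (\<integral>\<omega>. (\<integral>z. (MAX i\<in>H. a i \<omega> + 2 * w i z) \<partial>\<nu>) \<partial>M)"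
    and "integrable \<nu> (\<lambda>z. \<integral>\<omega>. (MAX i\<in>H. a i \<omega> + 2 * w i z) \<partial>M)"
    and "integrable M (\<lambda>\<omega>. \<integral>z. (MAX i\<in>H. a i \<omega> + 2 * w i z) \<partial>\<nu>)"
proof -
  interpret M: prob_space M by fact
  interpret N: prob_space \<nu> by fact
  interpret P: pair_prob_space M \<nu> ..
  note a(1)[measurable] w(1)[measurable]
  have int: "integrable (M \<Otimes>\<^sub>M \<nu>) (\<lambda>(\<omega>, z). MAX i\<in>H. a i \<omega> + 2 * w i z)"
  proof (rule P.integrable_const_bound[of _ "K + 2 * R"])
    show "AE p in M \<Otimes>\<^sub>M \<nu>. norm (case p of (\<omega>, z) \<Rightarrow> MAX i\<in>H. a i \<omega> + 2 * w i z) \<le> K + 2 * R"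
    proof (rule AE_I2)
      fix p assume p: "p \<in> space (M \<Otimes>\<^sub>M \<nu>)"
      obtain \<omega> z where p': "p = (\<omega>, z)" by force
      have "\<bar>MAX i\<in>H. a i \<omega> + 2 * w i z\<bar> \<le> K + 2 * R"
      proof (intro abs_Max_image_le H)
        fix i assume i: "i \<in> H"
        have "\<omega> \<in> space M" using p p' by (simp add: space_pair_measure)
        then show "\<bar>a i \<omega> + 2 * w i z\<bar> \<le> K + 2 * R" using a(2)[OF i, of \<omega>] w(2)[OF i, of z] by linarith
      qed
      then show "norm (case p of (\<omega>, z) \<Rightarrow> MAX i\<in>H. a i \<omega> + 2 * w i z) \<le> K + 2 * R" by (simp add: p')
    qed
    show "(\<lambda>(\<omega>, z). MAX i\<in>H. a i \<omega> + 2 * w i z) \<in> borel_measurable (M \<Otimes>\<^sub>M \<nu>)"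
      unfolding case_prod_beta' using H by (intro borel_measurable_Max) measurable
  qed
  show "(\<integral>z. (\<integral>\<omega>. (MAX i\<in>H. a i \<omega> + 2 * w i z) \<partial>M) \<partial>\<nu>) = (\<integral>\<omega>. (\<integral>z. (MAX i\<in>H. a i \<omega> + 2 * w i z) \<partial>\<nu>) \<partial>M)"
    using int by (rule P.Fubini_integral)
  show "integrable \<nu> (\<lambda>z. \<integral>\<omega>. (MAX i\<in>H. a i \<omega> + 2 * w i z) \<partial>M)"
    using P.integrable_snd[OF int] .
  show "integrable M (\<lambda>\<omega>. \<integral>z. (MAX i\<in>H. a i \<omega> + 2 * w i z) \<partial>\<nu>)"
    using P.integrable_fst[OF int] .
qed

text \<open>One observation at a time, starting with the latest, is decoupled from the past at the cost
  of one mixing coefficient and then symmetrised; \<open>S\<close> records the signs.\<close>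

lemma expectation_Max_block_le:
  fixes Z :: "nat \<Rightarrow> 'w \<Rightarrow> 'z::topological_space" and wp wm :: "'i \<Rightarrow> nat \<Rightarrow> 'z \<Rightarrow> real"
    and b C Rp Rm :: real
  assumes M: "prob_space M" and Z: "\<And>k. k \<ge> 1 \<Longrightarrow> Z k \<in> borel_measurable M"
    and H: "finite H" "H \<noteq> {}"
    and wp: "\<And>i k. i \<in> H \<Longrightarrow> k \<in> J \<Longrightarrow> wp i k \<in> borel_measurable borel"
      "\<And>i k z. i \<in> H \<Longrightarrow> k \<in> J \<Longrightarrow> \<bar>wp i k z\<bar> \<le> Rp"
    and wm: "\<And>i k. i \<in> H \<Longrightarrow> k \<in> J \<Longrightarrow> wm i k \<in> borel_measurable borel"
      "\<And>i k z. i \<in> H \<Longrightarrow> k \<in> J \<Longrightarrow> \<bar>wm i k z\<bar> \<le> Rm" and "Rm > 0"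
    and J: "finite J" "J \<subseteq> {1..}" and gap: "\<And>k l. k \<in> J \<Longrightarrow> l \<in> J \<Longrightarrow> k < l \<Longrightarrow> k + m \<le> l"
    and b: "beta_mixing M Z m \<le> ennreal b" "b \<ge> 0"
    and C: "\<And>z. (\<Sum>S\<in>Pow J. MAX i\<in>H. \<Sum>k\<in>J. 2 * (if k \<in> S then wp i k (z k) else wm i k (z k)))
      \<le> 2 ^ card J * C"
  shows "(\<integral>\<omega>. (MAX i\<in>H. \<Sum>k\<in>J. (\<integral>z. wp i k z \<partial>distr M borel (Z k)) + wm i k (Z k \<omega>)) \<partial>M)
    \<le> C + card J * (2 * Rm * b)"
proof -
  interpret prob_space M by fact
  define r where "r i k S x = 2 * (if k \<in> S then wp i k x else wm i k x)" for i k S x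
  define T where "T i k x = (\<integral>z. wp i k z \<partial>distr M borel (Z k)) + wm i k x" for i k x
  \<comment> \<open>The intermediate state: indices in \<open>L\<close> are still random, those in
    \<open>J - L\<close> are fixed at \<open>z\<close> and carry the signs given by
    \<open>S\<close>.\<close>
  define h where "h L S z = (\<integral>\<omega>. (MAX i\<in>H. (\<Sum>k\<in>L. T i k (Z k \<omega>)) + (\<Sum>k\<in>J-L. r i k S (z k))) \<partial>M)" for L S z
  have T: "T i k \<in> borel_measurable borel" if "i \<in> H" "k \<in> J" for i k
    unfolding T_def using wm(1)[OF that] by measurable
  have prob_\<nu>: "prob_space (distr M borel (Z k))" if "k \<ge> 1" for k
    using Z[OF that] by (rule prob_space_distr)
  have Tb: "\<bar>T i k x\<bar> \<le> Rp + Rm" if "i \<in> H" "k \<in> J" for i k x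
  proof -
    interpret \<nu>: prob_space "distr M borel (Z k)" using J(2) that by (intro prob_\<nu>) auto
    have "\<bar>\<integral>z. wp i k z \<partial>distr M borel (Z k)\<bar> \<le> (\<integral>z. \<bar>wp i k z\<bar> \<partial>distr M borel (Z k))" by (rule integral_abs_bound)
    also have "\<dots> \<le> (\<integral>z. Rp \<partial>distr M borel (Z k))"
      using wp[OF that] order_trans[OF abs_ge_zero wp(2)[OF that]]
      by (intro integral_mono integrable_abs \<nu>.integrable_const_bound[of _ Rp]) auto
    also have "\<dots> = Rp" using \<nu>.prob_space by simp
    finally show ?thesis unfolding T_def using wm(2)[OF that, of x] by linarith
  qed
  have "L \<subseteq> J \<Longrightarrow> \<forall>z. (\<Sum>S\<in>Pow J. h L S z) \<le> 2 ^ card J * (C + card L * (2 * Rm * b))"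
    if "finite L" for L
    using that
  \<comment> \<open>The added index \<open>l\<close> is the largest, so the random part
    \<open>A\<close> lies before it and, by the gap, at distance at least \<open>m\<close>. The
    empty set is the hypothesis \<open>C\<close>, and \<open>J\<close> itself gives the
    claim.\<close>
  proof (induction L rule: finite_linorder_max_induct)
    case empty
    then show ?case using C by (simp add: h_def r_def prob_space)
  next
    case (insert l A)
    then have l: "l \<in> J" "l \<ge> 1" "A \<subseteq> J" "l \<notin> A" and fA: "finite A" using J(2) by auto
    define \<nu> where "\<nu> = distr M borel (Z l)"
    interpret \<nu>: prob_space \<nu> unfolding \<nu>_def by (rule prob_\<nu>[OF l(2)])
    have JA: "J - A = insert l (J - insert l A)" using l by auto
    have past: "A \<subseteq> {1..l - m}"
    proof
      fix k assume k: "k \<in> A"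
      then have "k \<in> J" "k < l" using l(3) insert.hyps(2) by auto
      then have "k + m \<le> l" "1 \<le> k" using gap[OF _ l(1)] J(2) by auto
      then show "k \<in> {1..l - m}" by auto
    qed
    let ?E1 = "generated_sigma M Z {1..l - m}" and ?E2 = "generated_sigma M Z {l}"
    have E1: "subalgebra M ?E1" and E2: "subalgebra M ?E2"
      using Z l by (auto intro!: subalgebra_generated_sigma)
    have beta: "beta_coeff M ?E1 ?E2 \<le> ennreal b"
    proof -
      have "beta_coeff M ?E1 ?E2 \<le> beta_mixing M Z m"
        unfolding beta_mixing_def using l(2) by (intro SUP_upper) auto
      then show ?thesis using b(1) by simp
    qed
    \<comment> \<open>Index \<open>l\<close> is decoupled and symmetrised: a sign with
      \<open>l\<close> in the set selects the ghost half \<open>wp\<close>, the other sign the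
      sample half \<open>wm\<close>.\<close>
    have step: "h (insert l A) S z \<le> 2 * Rm * b +
        ((\<integral>x. h A (insert l S) (z(l := x)) \<partial>\<nu>) + (\<integral>x. h A (S - {l}) (z(l := x)) \<partial>\<nu>)) / 2"
      and int1: "integrable \<nu> (\<lambda>x. h A (insert l S) (z(l := x)))"
      and int2: "integrable \<nu> (\<lambda>x. h A (S - {l}) (z(l := x)))" for S z
    proof -
      define a where "a i \<omega> = (\<Sum>k\<in>A. T i k (Z k \<omega>)) + (\<Sum>k\<in>J - insert l A. r i k S (z k))" for i \<omega>
      define \<nu>p where "\<nu>p i = (\<integral>z. wp i l z \<partial>\<nu>)" for i
      obtain K where K: "\<And>i \<omega>. i \<in> H \<Longrightarrow> \<bar>a i \<omega>\<bar> \<le> K"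
      proof
        fix i \<omega> assume i: "i \<in> H"
        have "\<bar>a i \<omega>\<bar> \<le> (\<Sum>k\<in>A. \<bar>T i k (Z k \<omega>)\<bar>) + (\<Sum>k\<in>J - insert l A. \<bar>r i k S (z k)\<bar>)"
          unfolding a_def by (intro order_trans[OF abs_triangle_ineq] add_mono sum_abs)
        also have "\<dots> \<le> (\<Sum>k\<in>A. Rp + Rm) + (\<Sum>k\<in>J - insert l A. 2 * (\<bar>Rp\<bar> + \<bar>Rm\<bar>))"
        proof (intro add_mono sum_mono)
          fix k assume "k \<in> J - insert l A"
          then show "\<bar>r i k S (z k)\<bar> \<le> 2 * (\<bar>Rp\<bar> + \<bar>Rm\<bar>)"
            using wp(2)[OF i, of k "z k"] wm(2)[OF i, of k "z k"] by (auto simp: r_def abs_mult)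
        qed (use Tb[OF i] l in auto)
        finally show "\<bar>a i \<omega>\<bar> \<le> (\<Sum>k\<in>A. Rp + Rm) + (\<Sum>k\<in>J - insert l A. 2 * (\<bar>Rp\<bar> + \<bar>Rm\<bar>))" .
      qed
      have aE: "a i \<in> borel_measurable ?E1" if "i \<in> H" for i
        unfolding a_def
      proof (intro borel_measurable_add borel_measurable_sum borel_measurable_const)
        fix k assume k: "k \<in> A"
        then have "Z k \<in> borel_measurable ?E1" using past by (intro measurable_generated_sigma) auto
        moreover have "T i k \<in> borel_measurable borel" using T that k l by auto
        ultimately show "(\<lambda>\<omega>. T i k (Z k \<omega>)) \<in> borel_measurable ?E1" by simp
      qed
      have aM: "a i \<in> borel_measurable M" if "i \<in> H" for i using measurable_from_subalg[OF E1 aE[OF that]] .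
      obtain Kp where Kp: "\<And>i. i \<in> H \<Longrightarrow> \<bar>\<nu>p i\<bar> \<le> Kp"
        using H that[of "MAX i\<in>H. \<bar>\<nu>p i\<bar>"] by simp
      have hp: "h A (insert l S) (z(l := x)) = (\<integral>\<omega>. (MAX i\<in>H. a i \<omega> + 2 * wp i l x) \<partial>M)" for x
      proof -
        have "(\<Sum>k\<in>J-A. r i k (insert l S) ((z(l := x)) k)) = 2 * wp i l x + (\<Sum>k\<in>J - insert l A. r i k S (z k))" for i
        proof -
          have "(\<Sum>k\<in>J - insert l A. r i k (insert l S) ((z(l := x)) k)) = (\<Sum>k\<in>J - insert l A. r i k S (z k))"
            by (intro sum.cong) (auto simp: r_def)
          then show ?thesis unfolding JA using J(1) by (subst sum.insert) (simp_all add: r_def)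
        qed
        then have "(\<Sum>k\<in>A. T i k (Z k \<omega>)) + (\<Sum>k\<in>J-A. r i k (insert l S) ((z(l := x)) k)) = a i \<omega> + 2 * wp i l x" for i \<omega>
          unfolding a_def by simp
        then show ?thesis unfolding h_def by simp
      qed
      have hm: "h A (S - {l}) (z(l := x)) = (\<integral>\<omega>. (MAX i\<in>H. a i \<omega> + 2 * wm i l x) \<partial>M)" for x
      proof -
        have "(\<Sum>k\<in>J-A. r i k (S - {l}) ((z(l := x)) k)) = 2 * wm i l x + (\<Sum>k\<in>J - insert l A. r i k S (z k))" for i
        proof -
          have "(\<Sum>k\<in>J - insert l A. r i k (S - {l}) ((z(l := x)) k)) = (\<Sum>k\<in>J - insert l A. r i k S (z k))"
            by (intro sum.cong) (auto simp: r_def)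
          then show ?thesis unfolding JA using J(1) by (subst sum.insert) (simp_all add: r_def)
        qed
        then have "(\<Sum>k\<in>A. T i k (Z k \<omega>)) + (\<Sum>k\<in>J-A. r i k (S - {l}) ((z(l := x)) k)) = a i \<omega> + 2 * wm i l x" for i \<omega>
          unfolding a_def by simp
        then show ?thesis unfolding h_def by simp
      qed
      have wp\<nu>: "wp i l \<in> borel_measurable \<nu>" "wm i l \<in> borel_measurable \<nu>" if "i \<in> H" for i
        using wp(1)[OF that l(1)] wm(1)[OF that l(1)] by (simp_all add: \<nu>_def)
      have F: "(\<integral>z. (\<integral>\<omega>. (MAX i\<in>H. a i \<omega> + 2 * w i z) \<partial>M) \<partial>\<nu>) = (\<integral>\<omega>. (\<integral>z. (MAX i\<in>H. a i \<omega> + 2 * w i z) \<partial>\<nu>) \<partial>M)"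
        "integrable \<nu> (\<lambda>z. \<integral>\<omega>. (MAX i\<in>H. a i \<omega> + 2 * w i z) \<partial>M)"
        "integrable M (\<lambda>\<omega>. \<integral>z. (MAX i\<in>H. a i \<omega> + 2 * w i z) \<partial>\<nu>)"
        if "\<And>i. i \<in> H \<Longrightarrow> w i \<in> borel_measurable \<nu>" "\<And>i z. i \<in> H \<Longrightarrow> \<bar>w i z\<bar> \<le> R" for w and R :: real
        by (rule Fubini_Max[OF M \<nu>.prob_space_axioms H, where K = K and R = R]; use aM K that in simp)+
      note Fp = F[of "\<lambda>i. wp i l" Rp, OF wp\<nu>(1) wp(2)[OF _ l(1)]]
      note Fm = F[of "\<lambda>i. wm i l" Rm, OF wp\<nu>(2) wm(2)[OF _ l(1)]]
      show "integrable \<nu> (\<lambda>x. h A (insert l S) (z(l := x)))" unfolding hp by (rule Fp(2))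
      show "integrable \<nu> (\<lambda>x. h A (S - {l}) (z(l := x)))" unfolding hm by (rule Fm(2))
      have "h (insert l A) S z = (\<integral>\<omega>. (MAX i\<in>H. (a i \<omega> + \<nu>p i) + wm i l (Z l \<omega>)) \<partial>M)"
      proof -
        have "(\<Sum>k\<in>insert l A. T i k (Z k \<omega>)) + (\<Sum>k\<in>J - insert l A. r i k S (z k)) =
            (a i \<omega> + \<nu>p i) + wm i l (Z l \<omega>)" for i \<omega>
        proof -
          have "(\<Sum>k\<in>insert l A. T i k (Z k \<omega>)) = (\<nu>p i + wm i l (Z l \<omega>)) + (\<Sum>k\<in>A. T i k (Z k \<omega>))"
            unfolding sum.insert[OF fA l(4)] by (simp only: T_def \<nu>p_def \<nu>_def)
          then show ?thesis unfolding a_def by linarith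
        qed
        then show ?thesis unfolding h_def by simp
      qed
      \<comment> \<open>The ghost mean \<open>\<nu>p i\<close> is a constant and is counted with the
        past, so only the range of \<open>wm\<close> is charged.\<close>
      also have "\<dots> \<le> (\<integral>\<omega>. (\<integral>z. (MAX i\<in>H. (a i \<omega> + \<nu>p i) + wm i l z) \<partial>distr M borel (Z l)) \<partial>M) + 2 * Rm * b"
      proof (rule expectation_Max_decouple[OF M E1 E2 _ H, where K = "K + Kp"])
        fix i \<omega> assume "i \<in> H"
        then show "\<bar>a i \<omega> + \<nu>p i\<bar> \<le> K + Kp" using K[of i \<omega>] Kp[of i] by linarith
      qed (use aE wm l \<open>Rm > 0\<close> b beta measurable_generated_sigma[of l "{l}"] in auto)
      also have "(\<integral>\<omega>. (\<integral>z. (MAX i\<in>H. (a i \<omega> + \<nu>p i) + wm i l z) \<partial>distr M borel (Z l)) \<partial>M) =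
        (\<integral>\<omega>. (\<integral>z. (MAX i\<in>H. a i \<omega> + (\<nu>p i + wm i l z)) \<partial>\<nu>) \<partial>M)"
        by (simp add: \<nu>_def add.assoc)
      also have "\<dots> \<le> (\<integral>\<omega>. ((\<integral>z. (MAX i\<in>H. a i \<omega> + 2 * wp i l z) \<partial>\<nu>) + (\<integral>z. (MAX i\<in>H. a i \<omega> + 2 * wm i l z) \<partial>\<nu>)) / 2 \<partial>M)"
      proof (rule integral_mono)
        fix \<omega>
        show "(\<integral>z. (MAX i\<in>H. a i \<omega> + (\<nu>p i + wm i l z)) \<partial>\<nu>)
          \<le> ((\<integral>z. (MAX i\<in>H. a i \<omega> + 2 * wp i l z) \<partial>\<nu>) + (\<integral>z. (MAX i\<in>H. a i \<omega> + 2 * wm i l z) \<partial>\<nu>)) / 2"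
          unfolding \<nu>p_def using wp\<nu> wp(2)[OF _ l(1)] wm(2)[OF _ l(1)]
          by (intro integral_Max_symmetrize[OF \<nu>.prob_space_axioms H]) auto
      next
        \<comment> \<open>\<open>Fubini_Max\<close> has a factor 2 built in, hence the halved
          argument.\<close>
        have "integrable M (\<lambda>\<omega>. \<integral>z. (MAX i\<in>H. (a i \<omega> + \<nu>p i) + 2 * (wm i l z / 2)) \<partial>\<nu>)"
        proof (rule Fubini_Max(3)[OF M \<nu>.prob_space_axioms H])
          fix i \<omega> assume "i \<in> H"
          then show "\<bar>a i \<omega> + \<nu>p i\<bar> \<le> K + Kp" using K[of i \<omega>] Kp[of i] by linarith
        next
          fix i z assume "i \<in> H"
          then show "\<bar>wm i l z / 2\<bar> \<le> Rm / 2" using wm(2)[of i l z] l by simp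
        qed (use aM wp\<nu> in auto)
        then show "integrable M (\<lambda>\<omega>. \<integral>z. (MAX i\<in>H. a i \<omega> + (\<nu>p i + wm i l z)) \<partial>\<nu>)"
          by (simp add: add.assoc)
      qed (intro integrable_divide_zero Bochner_Integration.integrable_add Fp(3) Fm(3))
      also have "\<dots> = ((\<integral>x. h A (insert l S) (z(l := x)) \<partial>\<nu>) + (\<integral>x. h A (S - {l}) (z(l := x)) \<partial>\<nu>)) / 2"
        unfolding hp hm using Fp Fm by simp
      finally show "h (insert l A) S z \<le> 2 * Rm * b +
        ((\<integral>x. h A (insert l S) (z(l := x)) \<partial>\<nu>) + (\<integral>x. h A (S - {l}) (z(l := x)) \<partial>\<nu>)) / 2" by linarith
    qed
    show ?case
    proof
      fix z
      let ?D = "2 ^ card J * (C + card A * (2 * Rm * b))"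
      have "(\<Sum>S\<in>Pow J. h (insert l A) S z) \<le> (\<Sum>S\<in>Pow J. 2 * Rm * b +
        ((\<integral>x. h A (insert l S) (z(l := x)) \<partial>\<nu>) + (\<integral>x. h A (S - {l}) (z(l := x)) \<partial>\<nu>)) / 2)"
        by (intro sum_mono step)
      also have "\<dots> = 2 ^ card J * (2 * Rm * b) +
          (\<integral>x. (\<Sum>S\<in>Pow J. h A (insert l S) (z(l := x)) + h A (S - {l}) (z(l := x))) \<partial>\<nu>) / 2"
        using int1 int2 J(1)
        by (simp add: sum.distrib card_Pow sum_divide_distrib[symmetric] Bochner_Integration.integral_sum)
      \<comment> \<open>Both signs see the same fixed value \<open>x\<close> at \<open>l\<close>, so
        the sum over all \<open>S\<close> reappears at the configuration \<open>z(l := x)\<close>,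
        where the induction hypothesis holds for every \<open>x\<close>.\<close>
      also have "(\<lambda>x. \<Sum>S\<in>Pow J. h A (insert l S) (z(l := x)) + h A (S - {l}) (z(l := x))) =
          (\<lambda>x. 2 * (\<Sum>S\<in>Pow J. h A S (z(l := x))))"
        by (intro ext sum_Pow_toggle J(1) l(1))
      also have "2 ^ card J * (2 * Rm * b) + (\<integral>x. 2 * (\<Sum>S\<in>Pow J. h A S (z(l := x))) \<partial>\<nu>) / 2
          \<le> 2 ^ card J * (2 * Rm * b) + ?D"
      proof -
        have "integrable \<nu> (\<lambda>x. 2 * (\<Sum>S\<in>Pow J. h A S (z(l := x))))"
          unfolding sum_Pow_toggle[OF J(1) l(1), symmetric]
          by (intro Bochner_Integration.integrable_sum Bochner_Integration.integrable_add int1 int2)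
        then have "(\<integral>x. 2 * (\<Sum>S\<in>Pow J. h A S (z(l := x))) \<partial>\<nu>) \<le> (\<integral>x. 2 * ?D \<partial>\<nu>)"
          using insert.IH l(3) by (intro integral_mono \<nu>.integrable_const mult_left_mono) auto
        also have "\<dots> = 2 * ?D" by (simp add: \<nu>.prob_space)
        finally show ?thesis by simp
      qed
      also have "\<dots> = 2 ^ card J * (C + card (insert l A) * (2 * Rm * b))"
        using fA l(4) by (simp add: algebra_simps)
      finally show "(\<Sum>S\<in>Pow J. h (insert l A) S z) \<le> 2 ^ card J * (C + card (insert l A) * (2 * Rm * b))" .
    qed
  qed
  \<comment> \<open>No index is fixed any more, so the configuration does not matter and all
    \<open>2 ^ card J\<close> terms coincide.\<close>
  from this[OF J(1)] have "(\<Sum>S\<in>Pow J. h J S undefined) \<le> 2 ^ card J * (C + card J * (2 * Rm * b))" by blast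
  moreover have "h J S undefined = (\<integral>\<omega>. (MAX i\<in>H. \<Sum>k\<in>J. T i k (Z k \<omega>)) \<partial>M)" for S
    by (simp add: h_def)
  ultimately show ?thesis using J(1) by (simp add: card_Pow T_def)
qed

section \<open>Offset complexity of the excess losses\<close>

text \<open>Truncating all three entries makes the bounds hold at every point, as estimates at
  arbitrary configurations require; for the regression function and the response this changes
  nothing almost surely. \<open>truncate B id\<close> clips a number.\<close>

definition excess :: "real \<Rightarrow> ('x \<Rightarrow> real) \<Rightarrow> ('x \<Rightarrow> real) \<Rightarrow> 'x \<times> real \<Rightarrow> real" where
  "excess B \<phi> f z = (truncate B f (fst z) - truncate B id (snd z))\<^sup>2
     - (truncate B \<phi> (fst z) - truncate B id (snd z))\<^sup>2"

lemma excess_eq: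
  "excess B \<phi> f z = (truncate B f (fst z) - truncate B \<phi> (fst z)) *
     (truncate B f (fst z) + truncate B \<phi> (fst z) - 2 * truncate B id (snd z))"
  by (simp add: excess_def power2_eq_square algebra_simps)

lemma abs_excess_le:
  assumes "B \<ge> 0"
  shows "\<bar>excess B \<phi> f z\<bar> \<le> 4 * B * \<bar>truncate B f (fst z) - truncate B \<phi> (fst z)\<bar>"
    and "\<bar>excess B \<phi> f z\<bar> \<le> 4 * B\<^sup>2"
proof -
  note t = abs_truncate_le[OF assms, of f "fst z"] abs_truncate_le[OF assms, of \<phi> "fst z"]
    abs_truncate_le[OF assms, of id "snd z"]
  have "\<bar>truncate B f (fst z) + truncate B \<phi> (fst z) - 2 * truncate B id (snd z)\<bar> \<le> 4 * B"
    using t by linarith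
  then show "\<bar>excess B \<phi> f z\<bar> \<le> 4 * B * \<bar>truncate B f (fst z) - truncate B \<phi> (fst z)\<bar>"
    unfolding excess_eq abs_mult by (subst mult.commute) (intro mult_right_mono; simp)
  \<comment> \<open>The factorised form would give only \<open>8 * B^2\<close>; a difference of two
    squares from \<open>[0, 4 * B^2]\<close> gives half of that.\<close>
  have "\<bar>truncate B h x - truncate B id y\<bar> \<le> 2 * B" for h :: "'a \<Rightarrow> real" and x y
    using abs_truncate_le[OF assms, of h x] abs_truncate_le[OF assms, of id y] by linarith
  then have "(truncate B h x - truncate B id y)\<^sup>2 \<le> (2 * B)\<^sup>2" for h :: "'a \<Rightarrow> real" and x y
    by (metis abs_ge_zero power2_abs power_mono)
  from this[of f "fst z" "snd z"] this[of \<phi> "fst z" "snd z"]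
  show "\<bar>excess B \<phi> f z\<bar> \<le> 4 * B\<^sup>2"
    using zero_le_power2[of "truncate B f (fst z) - truncate B id (snd z)"]
      zero_le_power2[of "truncate B \<phi> (fst z) - truncate B id (snd z)"]
    unfolding excess_def four_x_squared by linarith
qed

text \<open>The reference function cancels, so the difference is again an excess loss, with
  \<open>g\<close> as reference.\<close>

lemma abs_excess_diff_le:
  assumes "B \<ge> 0"
  shows "\<bar>excess B \<phi> f z - excess B \<phi> g z\<bar> \<le> 4 * B * \<bar>truncate B f (fst z) - truncate B g (fst z)\<bar>"
  using abs_excess_le(1)[OF assms, of g f z] by (simp add: excess_def)

text \<open>A separated subset of largest cardinality cannot be enlarged, hence it covers. Taking
  the maximum of both directions stands in for symmetry of \<open>d\<close>.\<close>

lemma ex_maximal_packing: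
  fixes d :: "'f \<Rightarrow> 'f \<Rightarrow> real"
  assumes "finite H" "H \<noteq> {}"
  obtains P where "P \<subseteq> H" "P \<noteq> {}" "\<And>f g. f \<in> P \<Longrightarrow> g \<in> P \<Longrightarrow> f \<noteq> g \<Longrightarrow> e \<le> max (d f g) (d g f)"
    "\<And>f. f \<in> H - P \<Longrightarrow> \<exists>g\<in>P. d f g < e"
proof -
  define sep where "sep P \<longleftrightarrow> P \<subseteq> H \<and> (\<forall>f\<in>P. \<forall>g\<in>P. f \<noteq> g \<longrightarrow> e \<le> max (d f g) (d g f))" for P
  obtain h where h: "h \<in> H" using assms by auto
  have "\<exists>P. sep P \<and> (\<forall>Q. sep Q \<longrightarrow> card Q \<le> card P)"
    using assms h
    by (intro ex_has_greatest_nat[of sep "{h}" card "Suc (card H)"])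
       (auto simp: sep_def less_Suc_eq_le intro: card_mono)
  then obtain P where P: "sep P" "\<And>Q. sep Q \<Longrightarrow> card Q \<le> card P" by blast
  have fP: "finite P" using P(1) assms by (auto simp: sep_def intro: finite_subset)
  have "P \<noteq> {}" using P(2)[of "{h}"] h by (auto simp: sep_def)
  moreover have "\<exists>g\<in>P. d f g < e" if f: "f \<in> H - P" for f
  proof (rule ccontr)
    assume "\<not> ?thesis"
    then have "\<And>g. g \<in> P \<Longrightarrow> e \<le> d f g" by force
    then have "sep (insert f P)" using P(1) f by (auto simp: sep_def intro: le_max_iff_disj[THEN iffD2])
    from P(2)[OF this] show False using f fP by simp
  qed
  ultimately show ?thesis using P(1) by (intro that[of P]) (auto simp: sep_def)
qed

text \<open>The offset complexity at fixed points. Passing to a packing of \<open>L^1\<close> scale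
  \<open>6 * B * W\<close> costs \<open>72 * B^2 * lam * W\<close>; the finite-class bound on the
  packing costs \<open>32 * B^2 * K^2 * W / (lam - 1)\<close>. Both are linear in \<open>W\<close>,
  which is why this scale is affordable.\<close>

lemma sum_Pow_Max_excess_le:
  fixes \<Phi> :: "'j \<Rightarrow> 'x \<Rightarrow> real" and z :: "'j \<Rightarrow> 'x \<times> real" and lam :: real
  assumes vc: "vc_dim F = enat V" and H: "finite H" "H \<subseteq> F" "H \<noteq> {}"
    and J: "finite J" "J \<noteq> {}" and "B > 0" "lam > 1" and W: "W > real V"
    and W_ge: "V * ln (exp 1 * (2 * real (card J) / 3 + 1) / V) \<le> W"
    and \<gamma>: "\<gamma> = (lam - 1) / (32 * B\<^sup>2)"
  shows "(\<Sum>S\<in>Pow J. MAX f\<in>H. \<Sum>k\<in>J. 2 * (if k \<in> S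
        then lam * excess B (\<Phi> k) f (z k) - 2 * \<gamma> * (excess B (\<Phi> k) f (z k))\<^sup>2
        else - lam * excess B (\<Phi> k) f (z k)))
    \<le> 2 ^ card J * (32 * (2 * lam - 1)\<^sup>2 * (lam / (lam - 1)) * B\<^sup>2 * W)"
proof -
  define E where "E f k = excess B (\<Phi> k) f (z k)" for f k
  define v where "v f k = truncate B f (fst (z k))" for f k
  define w where "w f S k = 2 * (if k \<in> S then lam * E f k - 2 * \<gamma> * (E f k)\<^sup>2 else - lam * E f k)" for f S k
  have W0: "W > 0" using W by simp
  have \<gamma>0: "\<gamma> > 0" using \<open>B > 0\<close> \<open>lam > 1\<close> by (simp add: \<gamma>)
  have \<gamma>B: "32 * B\<^sup>2 * \<gamma> = lam - 1" using \<open>B > 0\<close> by (simp add: \<gamma>)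
  have Eb: "\<bar>E f k\<bar> \<le> 4 * B\<^sup>2" for f k using abs_excess_le(2)[of B "\<Phi> k" f "z k"] \<open>B > 0\<close> by (simp add: E_def)
  have Ed: "\<bar>E f k - E g k\<bar> \<le> 4 * B * \<bar>v f k - v g k\<bar>" for f g k
    using abs_excess_diff_le[of B "\<Phi> k" f "z k" g] \<open>B > 0\<close> by (simp add: E_def v_def)
  \<comment> \<open>By \<open>Eb\<close> the slope of either branch as a function of
    \<open>E\<close> is at most \<open>3 * lam\<close>, and \<open>E\<close> is
    \<open>4 * B\<close>-Lipschitz in the truncated value.\<close>
  have lip: "w f S k \<le> w g S k + 12 * B * lam * \<bar>v f k - v g k\<bar>" for f g S k
  proof -
    have s: "\<bar>\<gamma> * (E f k + E g k)\<bar> \<le> (lam - 1) / 4"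
    proof -
      have "\<bar>E f k + E g k\<bar> \<le> 8 * B\<^sup>2" using Eb[of f k] Eb[of g k] by linarith
      then have "\<gamma> * \<bar>E f k + E g k\<bar> \<le> \<gamma> * (8 * B\<^sup>2)" using \<gamma>0 by (intro mult_left_mono) auto
      also have "\<dots> = 32 * B\<^sup>2 * \<gamma> / 4" by simp
      finally show ?thesis unfolding \<gamma>B using \<gamma>0 by (simp add: abs_mult)
    qed
    have 1: "\<bar>(E f k - E g k) * (lam - 2 * (\<gamma> * (E f k + E g k)))\<bar> \<le> 4 * B * \<bar>v f k - v g k\<bar> * (3 / 2 * lam)"
      unfolding abs_mult using s \<open>lam > 1\<close> Ed[of f k g] by (intro mult_mono) auto
    have 2: "\<bar>(E f k - E g k) * lam\<bar> \<le> 4 * B * \<bar>v f k - v g k\<bar> * (3 / 2 * lam)"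
      unfolding abs_mult using \<open>lam > 1\<close> Ed[of f k g] by (intro mult_mono) auto
    have "w f S k - w g S k = 2 * (if k \<in> S then (E f k - E g k) * (lam - 2 * (\<gamma> * (E f k + E g k)))
        else - ((E f k - E g k) * lam))"
      by (auto simp: w_def power2_eq_square algebra_simps)
    also have "\<dots> \<le> 2 * (4 * B * \<bar>v f k - v g k\<bar> * (3 / 2 * lam))"
      using 1 2 by (auto simp only: split: if_splits)
    finally show ?thesis by (simp add: algebra_simps)
  qed
  obtain P where P: "P \<subseteq> H" "P \<noteq> {}"
    and sep: "\<And>f g. f \<in> P \<Longrightarrow> g \<in> P \<Longrightarrow> f \<noteq> g \<Longrightarrow>
      6 * B * W \<le> max (\<Sum>k\<in>J. \<bar>v f k - v g k\<bar>) (\<Sum>k\<in>J. \<bar>v g k - v f k\<bar>)"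
    and cover: "\<And>f. f \<in> H - P \<Longrightarrow> \<exists>g\<in>P. (\<Sum>k\<in>J. \<bar>v f k - v g k\<bar>) < 6 * B * W"
    by (rule ex_maximal_packing[OF H(1,3), of "6 * B * W" "\<lambda>f g. \<Sum>k\<in>J. \<bar>v f k - v g k\<bar>"]) blast
  have fP: "finite P" using P(1) H(1) by (rule finite_subset)
  have lnP: "ln (card P) \<le> W"
  proof (rule ln_card_packing_le[OF vc fP _ P(2) J \<open>B > 0\<close> W W_ge])
    show "P \<subseteq> F" using P H by blast
    fix f g assume "f \<in> P" "g \<in> P" "f \<noteq> g"
    from sep[OF this] show "6 * B * W \<le> (\<Sum>k\<in>J. \<bar>truncate B f (fst (z k)) - truncate B g (fst (z k))\<bar>)"
      by (simp add: v_def abs_minus_commute)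
  qed
  have to_P: "(MAX f\<in>H. \<Sum>k\<in>J. w f S k) \<le> (MAX f\<in>P. \<Sum>k\<in>J. w f S k) + 72 * B\<^sup>2 * lam * W" for S
  proof (rule Max.boundedI)
    fix y assume "y \<in> (\<lambda>f. \<Sum>k\<in>J. w f S k) ` H"
    then obtain f where f: "f \<in> H" "y = (\<Sum>k\<in>J. w f S k)" by auto
    have "\<exists>g\<in>P. (\<Sum>k\<in>J. \<bar>v f k - v g k\<bar>) < 6 * B * W"
      using cover[of f] f \<open>B > 0\<close> W0 by (cases "f \<in> P") (auto intro!: bexI[of _ f])
    then obtain g where g: "g \<in> P" "(\<Sum>k\<in>J. \<bar>v f k - v g k\<bar>) < 6 * B * W" by blast
    have "y \<le> (\<Sum>k\<in>J. w g S k + 12 * B * lam * \<bar>v f k - v g k\<bar>)"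
      unfolding f(2) by (intro sum_mono lip)
    also have "\<dots> = (\<Sum>k\<in>J. w g S k) + 12 * B * lam * (\<Sum>k\<in>J. \<bar>v f k - v g k\<bar>)"
      by (simp add: sum.distrib sum_distrib_left)
    also have "\<dots> \<le> (MAX f\<in>P. \<Sum>k\<in>J. w f S k) + 12 * B * lam * (6 * B * W)"
      using g fP \<open>B > 0\<close> \<open>lam > 1\<close> by (intro add_mono Max_ge mult_left_mono) auto
    finally show "y \<le> (MAX f\<in>P. \<Sum>k\<in>J. w f S k) + 72 * B\<^sup>2 * lam * W"
      by (simp add: power2_eq_square algebra_simps)
  qed (use H in auto)
  \<comment> \<open>\<open>\<gamma> * E\<close> is at most \<open>(lam - 1) / 8\<close> in absolute
    value, so \<open>K\<close> bounds the factor \<open>lam - \<gamma> * E\<close> of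
    \<open>p\<close>.\<close>
  define K where "K = lam + (lam - 1) / 8"
  define p where "p f k = 2 * (lam * E f k - \<gamma> * (E f k)\<^sup>2)" for f k
  have K0: "K > 0" using \<open>lam > 1\<close> unfolding K_def by argo
  \<comment> \<open>Splitting the offset evenly between the signs turns the unsymmetric pair into a
    signed term \<open>p\<close> minus a common offset, the shape of
    \<open>sum_Pow_Max_offset_le\<close>.\<close>
  have w_pq: "w f S k = (if k \<in> S then p f k else - p f k) - 2 * \<gamma> * (E f k)\<^sup>2" for f S k
    by (simp add: w_def p_def algebra_simps)
  have pK: "(p f k)\<^sup>2 \<le> 4 * (K\<^sup>2 * (E f k)\<^sup>2)" for f k
  proof -
    have "\<bar>\<gamma> * E f k\<bar> \<le> (lam - 1) / 8"
    proof -
      have "\<gamma> * \<bar>E f k\<bar> \<le> \<gamma> * (4 * B\<^sup>2)" using \<gamma>0 Eb by (intro mult_left_mono) auto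
      also have "\<dots> = 32 * B\<^sup>2 * \<gamma> / 8" by simp
      finally show ?thesis unfolding \<gamma>B using \<gamma>0 by (simp add: abs_mult)
    qed
    then have "\<bar>lam - \<gamma> * E f k\<bar> \<le> K" using \<open>lam > 1\<close> unfolding K_def by linarith
    then have "(lam - \<gamma> * E f k)\<^sup>2 \<le> K\<^sup>2" by (metis abs_ge_zero power2_abs power_mono)
    then have "(lam - \<gamma> * E f k)\<^sup>2 * (E f k)\<^sup>2 \<le> K\<^sup>2 * (E f k)\<^sup>2" by (intro mult_right_mono) auto
    moreover have "p f k = 2 * ((lam - \<gamma> * E f k) * E f k)"
      by (simp add: p_def power2_eq_square algebra_simps)
    ultimately show ?thesis by (simp add: power_mult_distrib)
  qed
  \<comment> \<open>The parameter \<open>s = \<gamma> / K^2\<close> is where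
    \<open>p^2 \<le> 4 * K^2 * E^2\<close> and the offset \<open>2 * \<gamma> * E^2\<close> meet the
    hypothesis \<open>s * p^2 \<le> 2 * q\<close>.\<close>
  have "(\<Sum>S\<in>Pow J. MAX f\<in>P. \<Sum>k\<in>J. w f S k) \<le> 2 ^ card J * (ln (card P) / (\<gamma> / K\<^sup>2))"
    unfolding w_pq
  proof (rule sum_Pow_Max_offset_le[OF fP P(2) J(1)])
    show "\<gamma> / K\<^sup>2 > 0" using \<gamma>0 K0 by simp
    fix f k
    have "\<gamma> / K\<^sup>2 * (p f k)\<^sup>2 \<le> \<gamma> / K\<^sup>2 * (4 * (K\<^sup>2 * (E f k)\<^sup>2))"
      using \<gamma>0 pK by (intro mult_left_mono) auto
    also have "\<dots> = 2 * (2 * \<gamma> * (E f k)\<^sup>2)" using K0 by simp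
    finally show "\<gamma> / K\<^sup>2 * (p f k)\<^sup>2 \<le> 2 * (2 * \<gamma> * (E f k)\<^sup>2)" .
  qed
  also have "\<dots> \<le> 2 ^ card J * (W / (\<gamma> / K\<^sup>2))"
    using lnP \<gamma>0 K0 by (intro mult_left_mono divide_right_mono) auto
  also have "W / (\<gamma> / K\<^sup>2) = 32 * B\<^sup>2 * K\<^sup>2 * W / (lam - 1)"
    using \<gamma>0 K0 \<open>B > 0\<close> by (simp add: \<gamma> field_simps)
  finally have P_le: "(\<Sum>S\<in>Pow J. MAX f\<in>P. \<Sum>k\<in>J. w f S k) \<le> 2 ^ card J * (32 * B\<^sup>2 * K\<^sup>2 * W / (lam - 1))" .
  have "(\<Sum>S\<in>Pow J. MAX f\<in>H. \<Sum>k\<in>J. w f S k)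
      \<le> (\<Sum>S\<in>Pow J. (MAX f\<in>P. \<Sum>k\<in>J. w f S k) + 72 * B\<^sup>2 * lam * W)"
    by (intro sum_mono to_P)
  also have "\<dots> = (\<Sum>S\<in>Pow J. MAX f\<in>P. \<Sum>k\<in>J. w f S k) + 2 ^ card J * (72 * B\<^sup>2 * lam * W)"
    using J by (simp add: sum.distrib card_Pow)
  also have "\<dots> \<le> 2 ^ card J * (32 * B\<^sup>2 * K\<^sup>2 * W / (lam - 1) + 72 * B\<^sup>2 * lam * W)"
    using P_le by (simp add: distrib_left)
  also have "\<dots> \<le> 2 ^ card J * (32 * (2 * lam - 1)\<^sup>2 * (lam / (lam - 1)) * B\<^sup>2 * W)"
  proof (rule mult_left_mono)
    define t where "t = lam - 1"
    have t: "t > 0" "lam = 1 + t" using \<open>lam > 1\<close> by (auto simp: t_def)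
    \<comment> \<open>What remains after cancelling \<open>32 * B^2 * W / t\<close>;
      \<open>9 / 4\<close> is \<open>72 / 32\<close>. As a polynomial in \<open>t\<close> the
      difference has nonnegative coefficients.\<close>
    have "K\<^sup>2 + 9 / 4 * t * lam \<le> (2 * lam - 1)\<^sup>2 * lam"
    proof -
      have "(2 * lam - 1)\<^sup>2 * lam - (K\<^sup>2 + 9 / 4 * t * lam) = t / 2 + t\<^sup>2 * (287 / 64) + 4 * (t\<^sup>2 * t)"
        unfolding K_def t by (simp add: power2_eq_square field_simps)
      also have "\<dots> \<ge> 0" using t by simp
      finally show ?thesis by simp
    qed
    then have "32 * B\<^sup>2 * W / t * (K\<^sup>2 + 9 / 4 * t * lam) \<le> 32 * B\<^sup>2 * W / t * ((2 * lam - 1)\<^sup>2 * lam)"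
      using t W0 by (intro mult_left_mono) auto
    moreover have "32 * B\<^sup>2 * W / t * (K\<^sup>2 + 9 / 4 * t * lam) = 32 * B\<^sup>2 * K\<^sup>2 * W / t + 72 * B\<^sup>2 * lam * W"
      using t(1) by (simp add: field_simps)
    ultimately show "32 * B\<^sup>2 * K\<^sup>2 * W / (lam - 1) + 72 * B\<^sup>2 * lam * W
        \<le> 32 * (2 * lam - 1)\<^sup>2 * (lam / (lam - 1)) * B\<^sup>2 * W"
      unfolding t_def[symmetric] by (simp add: mult_ac)
  qed simp
  finally show ?thesis unfolding w_def E_def .
qed

section \<open>The constants of the theorem\<close>

text \<open>Links the constant reached for one block to that of the theorem:
  \<open>c / (c - 1)\<close> exceeds 1, and the further summand inside the square is
  nonnegative.\<close>

lemma theta0_ge: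
  assumes "c > 1" "lam > 1"
  shows "32 * (2 * lam - 1)\<^sup>2 * (lam / (lam - 1)) \<le> theta0 c lam"
proof -
  have "1 \<le> (c / (c - 1)) ^ 3" using assms by (intro one_le_power) simp
  moreover have "(2 * lam - 1)\<^sup>2 \<le> ((1/3) * (1 - 1/c) * (1 - 1/lam) + (2 * lam - 1))\<^sup>2"
    using assms by (intro power_mono) auto
  ultimately have "(2 * lam - 1)\<^sup>2 * 1 \<le> ((1/3) * (1 - 1/c) * (1 - 1/lam) + (2 * lam - 1))\<^sup>2 * (c / (c - 1)) ^ 3"
    by (intro mult_mono) auto
  then have "32 * ((2 * lam - 1)\<^sup>2 * 1) * (lam / (lam - 1)) \<le>
    32 * (((1/3) * (1 - 1/c) * (1 - 1/lam) + (2 * lam - 1))\<^sup>2 * (c / (c - 1)) ^ 3) * (lam / (lam - 1))"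
    using assms by (intro mult_right_mono mult_left_mono) auto
  then show ?thesis by (simp add: theta0_def mult.assoc)
qed

lemma theta1_nonneg:
  assumes "c > 1" "m \<ge> 1" shows "0 \<le> theta1 c m"
proof -
  have "1 * 1 \<le> (6 * (c + 1)) * (2 * c + 3)" using assms by (intro mult_mono) auto
  then show ?thesis using assms by (simp add: theta1_def)
qed

text \<open>In the first bound the square root is at least \<open>c / sqrt (N + 1)\<close>, which
  offsets \<open>- ln (c - 1 / c)\<close>, so a large \<open>c\<close> does no harm. The second uses
  that the square root is at least 1 and that \<open>c - 1 / c < c\<close>.\<close>

lemma theta2_ge:
  assumes "c > 1" "N \<ge> 1"
  shows "4 + ln (N + 1) / 2 \<le> theta2 c N"
    and "48 * exp 1 * (N + 1) / c \<le> exp (theta2 c N)"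
proof -
  define q where "q = sqrt (1 + c * (c + 1) / (N + 1))"
  define d where "d = c - 1 / c"
  have d: "0 < d" "d < c" using assms by (auto simp: d_def field_simps) (smt (verit) mult_less_cancel_left2)
  have q1: "q \<ge> 1" unfolding q_def using assms by simp
  have \<theta>: "theta2 c N = 1 + ln 24 + ln (1 + q) - ln d + ln (N + 1)" by (simp add: theta2_def q_def d_def)
  have "c / sqrt (N + 1) = sqrt (c\<^sup>2 / (N + 1))" using assms by (simp add: real_sqrt_divide)
  also have "\<dots> \<le> q" unfolding q_def using assms
    by (intro real_sqrt_le_mono) (simp add: power2_eq_square field_simps)
  finally have "d / sqrt (N + 1) \<le> 1 + q"
    using d divide_right_mono[of d c "sqrt (N + 1)"] real_sqrt_ge_zero[of "N + 1"] assms by linarith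
  then have "ln (d / sqrt (N + 1)) \<le> ln (1 + q)" using d assms q1 by (intro ln_mono) auto
  then have "ln d - ln (N + 1) / 2 \<le> ln (1 + q)" using d assms by (simp add: ln_div ln_sqrt)
  moreover have "ln (24::real) \<ge> 3"
  proof -
    have "ln (24::real) = 3 * ln 2 + ln 3"
      using ln_mult_pos[of "2 ^ 3 :: real" 3] ln_realpow[of "2::real" 3] by simp
    moreover have "ln 3 \<ge> (1::real)" using exp_le by (subst ln_ge_iff) auto
    ultimately show ?thesis using ln2_ge_two_thirds by linarith
  qed
  ultimately show "4 + ln (N + 1) / 2 \<le> theta2 c N" unfolding \<theta> by argo
  have "48 * exp 1 * (N + 1) / c \<le> 24 * exp 1 * (1 + q) * (N + 1) / d"
    using d q1 assms by (intro frac_le mult_right_mono) auto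
  also have "\<dots> = exp (theta2 c N)"
    unfolding \<theta> using d q1 assms by (simp add: exp_add exp_diff mult_ac)
  finally show "48 * exp 1 * (N + 1) / c \<le> exp (theta2 c N)" .
qed

text \<open>Here \<open>n\<close> is a block length. With \<open>t = theta2 c N\<close>, the entropy
  is at most \<open>V * (t + ln t)\<close> as soon as the argument of its logarithm is at most
  \<open>t * exp t\<close>. By \<open>theta2_ge\<close> this reduces to \<open>c\<close> being at
  most a multiple of \<open>V * t\<close>, which the growth hypothesis on \<open>N\<close>
  supplies.\<close>

lemma theta2_entropy_bounds:
  fixes V :: nat
  assumes "c > 1" "N \<ge> 1" and N: "N \<ge> exp ((c\<^sup>2 - 71) / (4 * real V))" and n: "real n \<le> N + 1"
    and m: "m \<ge> 1"
    and W: "W = 1 + theta1 c m + real V * (theta2 c N + ln (theta2 c N))"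
  shows "W > real V" "V * ln (exp 1 * (2 * real n / 3 + 1) / V) \<le> W"
proof -
  let ?t = "theta2 c N"
  have t: "?t \<ge> 4 + ln (N + 1) / 2" using theta2_ge(1)[OF assms(1,2)] .
  have t4: "?t \<ge> 4" using t \<open>N \<ge> 1\<close> ln_ge_zero[of "N + 1"] by linarith
  have lnt: "ln ?t \<ge> 0" using t4 by simp
  have "1 \<le> ?t + ln ?t" using t4 lnt by linarith
  then have "real V * 1 \<le> real V * (?t + ln ?t)" by (intro mult_left_mono) auto
  then show "W > real V" unfolding W using theta1_nonneg[OF assms(1) m] by simp
  show "V * ln (exp 1 * (2 * real n / 3 + 1) / V) \<le> W"
  proof (cases "V = 0")
    case True
    then show ?thesis unfolding W using theta1_nonneg[OF assms(1) m] by simp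
  next
    case False
    then have V1: "real V \<ge> 1" by simp
    have "(c\<^sup>2 - 71) / (4 * real V) \<le> ln N" using N \<open>N \<ge> 1\<close> by (simp add: ln_ge_iff)
    also have "\<dots> \<le> ln (N + 1)" using \<open>N \<ge> 1\<close> by simp
    finally have "c\<^sup>2 - 71 \<le> 4 * real V * ln (N + 1)" using V1 by (simp add: field_simps)
    moreover have "real V * (4 + ln (N + 1) / 2) \<le> real V * ?t" using t by (intro mult_left_mono) auto
    ultimately have Vt: "4 * real V + (c\<^sup>2 - 71) / 8 \<le> real V * ?t"
      by argo
    \<comment> \<open>The factor 41 satisfies \<open>41 * 7 / 6 \<le> 48\<close>. Up to
      \<open>164 = 41 * 4\<close> the bound \<open>V * t \<ge> 4\<close> suffices; beyond that the
      quadratic term in \<open>Vt\<close> dominates.\<close>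
    have c_le: "c \<le> 41 * (real V * ?t)"
    proof (cases "c \<le> 164")
      case True
      have "1 * 4 \<le> real V * ?t" using V1 t4 by (intro mult_mono) auto
      then show ?thesis using True by simp
    next
      case False
      then have "164 * c \<le> c\<^sup>2" by (simp add: power2_eq_square)
      then show ?thesis using Vt V1 False by argo
    qed
    \<comment> \<open>From \<open>n \<le> N + 1\<close> and \<open>1 \<le> (N + 1) / 2\<close>;
      \<open>2 / 3 + 1 / 2 = 7 / 6\<close>.\<close>
    have "exp 1 * (2 * real n / 3 + 1) / V \<le> exp 1 * (7 / 6 * (N + 1)) / V"
      using n \<open>N \<ge> 1\<close> by (intro divide_right_mono mult_left_mono) auto
    also have "\<dots> \<le> 48 * exp 1 * (N + 1) / c * ?t"
    proof -
      have "7 / 6 * c \<le> 48 * (real V * ?t)" using c_le \<open>c > 1\<close> by linarith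
      then have "exp 1 * (N + 1) * (7 / 6 * c) \<le> exp 1 * (N + 1) * (48 * (real V * ?t))"
        using \<open>N \<ge> 1\<close> by (intro mult_left_mono) auto
      then show ?thesis using V1 \<open>c > 1\<close> by (simp add: field_simps)
    qed
    also have "\<dots> \<le> exp ?t * ?t"
      using theta2_ge(2)[OF assms(1,2)] t4 by (intro mult_right_mono) auto
    finally have "ln (exp 1 * (2 * real n / 3 + 1) / V) \<le> ln (exp ?t * ?t)"
      using V1 by (intro ln_mono divide_pos_pos mult_pos_pos) auto
    also have "\<dots> = ?t + ln ?t" using t4 by (simp add: ln_mult_pos)
    finally have "V * ln (exp 1 * (2 * real n / 3 + 1) / V) \<le> V * (?t + ln ?t)" by (intro mult_left_mono) auto
    then show ?thesis unfolding W using theta1_nonneg[OF assms(1) m] by simp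
  qed
qed

section \<open>Least-squares regression with bounded responses\<close>

lemma truncate_measurable [measurable (raw)]:
  "f \<in> borel_measurable N \<Longrightarrow> truncate B f \<in> borel_measurable N"
  unfolding truncate_def[abs_def] by measurable

text \<open>The covariate space is abstract; second countability makes the pairs of covariate and
  response Borel measurable.\<close>

locale bounded_regression = prob_space M for M :: "'w measure" +
  fixes X :: "nat \<Rightarrow> 'w \<Rightarrow> 'x::second_countable_topology" and Y :: "nat \<Rightarrow> 'w \<Rightarrow> real"
    and \<Phi> :: "nat \<Rightarrow> 'x \<Rightarrow> real" and B :: real
  assumes X_meas: "\<And>k. k \<ge> 1 \<Longrightarrow> X k \<in> borel_measurable M"
    and Y_meas: "\<And>k. k \<ge> 1 \<Longrightarrow> Y k \<in> borel_measurable M"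
    and \<Phi>_meas: "\<And>k. k \<ge> 1 \<Longrightarrow> \<Phi> k \<in> borel_measurable borel"
    and \<Phi>_cond: "\<And>k. k \<ge> 1 \<Longrightarrow>
       AE \<omega> in M. \<Phi> k (X k \<omega>) = real_cond_exp M (vimage_algebra (space M) (X k) borel) (Y k) \<omega>"
    and B_pos: "B > 0"
    and Y_bound: "\<And>k. k \<ge> 1 \<Longrightarrow> AE \<omega> in M. \<bar>Y k \<omega>\<bar> \<le> B"
begin

lemma subalgebra_X: "k \<ge> 1 \<Longrightarrow> finite_measure_subalgebra M (vimage_algebra (space M) (X k) borel)"
proof
  assume "k \<ge> 1"
  then show "subalgebra M (vimage_algebra (space M) (X k) borel)"
    using X_meas[of k] by (auto simp: subalgebra_def sets_vimage_algebra2 intro: measurable_sets)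
qed

lemma integrable_Y: "k \<ge> 1 \<Longrightarrow> integrable M (Y k)"
  using Y_bound[of k] Y_meas[of k] by (intro integrable_const_bound[of _ B]) auto

lemma \<Phi>_bound: assumes "k \<ge> 1" shows "AE \<omega> in M. \<bar>\<Phi> k (X k \<omega>)\<bar> \<le> B"
proof -
  interpret finite_measure_subalgebra M "vimage_algebra (space M) (X k) borel" by (rule subalgebra_X) fact
  note Y = Y_bound[OF assms]
  have "AE \<omega> in M. real_cond_exp M (vimage_algebra (space M) (X k) borel) (Y k) \<omega> \<le> B"
    using Y by (intro real_cond_exp_le_c integrable_Y assms) auto
  moreover have "AE \<omega> in M. real_cond_exp M (vimage_algebra (space M) (X k) borel) (Y k) \<omega> \<ge> - B"
    using Y by (intro real_cond_exp_ge_c integrable_Y assms) auto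
  ultimately show ?thesis using \<Phi>_cond[OF assms] by eventually_elim auto
qed

text \<open>Pythagoras for conditional expectations: the difference of \<open>g\<close> and
  \<open>\<Phi> k\<close> at \<open>X k\<close> is measurable for the sigma-algebra of
  \<open>X k\<close>, hence orthogonal to the noise. Square integrability is the assumption, rather
  than boundedness, because the comparison function of the oracle inequality is not
  truncated.\<close>

lemma excess_risk_identity:
  assumes k: "k \<ge> 1" and g: "g \<in> borel_measurable borel"
    and sq: "integrable M (\<lambda>\<omega>. (g (X k \<omega>) - \<Phi> k (X k \<omega>))\<^sup>2)"
  shows "integrable M (\<lambda>\<omega>. (g (X k \<omega>) - Y k \<omega>)\<^sup>2 - (\<Phi> k (X k \<omega>) - Y k \<omega>)\<^sup>2)"
    and "(\<integral>\<omega>. (g (X k \<omega>) - Y k \<omega>)\<^sup>2 - (\<Phi> k (X k \<omega>) - Y k \<omega>)\<^sup>2 \<partial>M) =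
      (\<integral>\<omega>. (g (X k \<omega>) - \<Phi> k (X k \<omega>))\<^sup>2 \<partial>M)"
proof -
  let ?S = "vimage_algebra (space M) (X k) borel"
  interpret S: finite_measure_subalgebra M ?S by (rule subalgebra_X) fact
  note [measurable] = X_meas[OF k] Y_meas[OF k] \<Phi>_meas[OF k] g
  define d where "d \<omega> = g (X k \<omega>) - \<Phi> k (X k \<omega>)" for \<omega>
  have dM [measurable]: "d \<in> borel_measurable M" unfolding d_def by measurable
  have dS: "d \<in> borel_measurable ?S"
  proof -
    have [measurable]: "X k \<in> measurable ?S borel" by (rule measurable_vimage_algebra1) simp
    show ?thesis unfolding d_def by measurable
  qed
  have int_d: "integrable M d"
    by (rule square_integrable_imp_integrable[OF dM]) (use sq in \<open>simp add: d_def\<close>)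
  have int_dY: "integrable M (\<lambda>\<omega>. d \<omega> * Y k \<omega>)"
  proof (rule Bochner_Integration.integrable_bound)
    show "integrable M (\<lambda>\<omega>. B * d \<omega>)" using int_d by simp
    show "AE \<omega> in M. norm (d \<omega> * Y k \<omega>) \<le> norm (B * d \<omega>)"
      using Y_bound[OF k]
    proof eventually_elim
      case (elim \<omega>)
      from mult_left_mono[OF this, of "\<bar>d \<omega>\<bar>"] show ?case
        using B_pos by (simp add: abs_mult mult.commute)
    qed
  qed simp
  have int_d\<Phi>: "integrable M (\<lambda>\<omega>. d \<omega> * \<Phi> k (X k \<omega>))"
  proof (rule Bochner_Integration.integrable_bound)
    show "integrable M (\<lambda>\<omega>. B * d \<omega>)" using int_d by simp
    show "AE \<omega> in M. norm (d \<omega> * \<Phi> k (X k \<omega>)) \<le> norm (B * d \<omega>)"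
      using \<Phi>_bound[OF k]
    proof eventually_elim
      case (elim \<omega>)
      from mult_left_mono[OF this, of "\<bar>d \<omega>\<bar>"] show ?case
        using B_pos by (simp add: abs_mult mult.commute)
    qed
  qed simp
  have "(\<integral>\<omega>. d \<omega> * \<Phi> k (X k \<omega>) \<partial>M) = (\<integral>\<omega>. d \<omega> * real_cond_exp M ?S (Y k) \<omega> \<partial>M)"
    using \<Phi>_cond[OF k] by (intro integral_cong_AE) auto
  also have "\<dots> = (\<integral>\<omega>. d \<omega> * Y k \<omega> \<partial>M)" by (rule S.real_cond_exp_intg(2)[OF int_dY dS Y_meas[OF k]])
  finally have orth: "(\<integral>\<omega>. d \<omega> * \<Phi> k (X k \<omega>) \<partial>M) = (\<integral>\<omega>. d \<omega> * Y k \<omega> \<partial>M)" .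
  have eq: "(g (X k \<omega>) - Y k \<omega>)\<^sup>2 - (\<Phi> k (X k \<omega>) - Y k \<omega>)\<^sup>2 =
      (d \<omega>)\<^sup>2 + (2 * (d \<omega> * \<Phi> k (X k \<omega>)) - 2 * (d \<omega> * Y k \<omega>))" for \<omega>
    by (simp add: d_def power2_eq_square algebra_simps)
  have int_sq: "integrable M (\<lambda>\<omega>. (d \<omega>)\<^sup>2)" using sq by (simp add: d_def)
  show "integrable M (\<lambda>\<omega>. (g (X k \<omega>) - Y k \<omega>)\<^sup>2 - (\<Phi> k (X k \<omega>) - Y k \<omega>)\<^sup>2)"
    unfolding eq using int_sq int_dY int_d\<Phi> by simp
  show "(\<integral>\<omega>. (g (X k \<omega>) - Y k \<omega>)\<^sup>2 - (\<Phi> k (X k \<omega>) - Y k \<omega>)\<^sup>2 \<partial>M) =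
      (\<integral>\<omega>. (g (X k \<omega>) - \<Phi> k (X k \<omega>))\<^sup>2 \<partial>M)"
    unfolding eq using int_sq int_dY int_d\<Phi> orth by (simp add: d_def[symmetric])
qed

definition Z :: "nat \<Rightarrow> 'w \<Rightarrow> 'x \<times> real" where "Z k \<omega> = (X k \<omega>, Y k \<omega>)"

lemma Z_meas: "k \<ge> 1 \<Longrightarrow> Z k \<in> borel_measurable M"
  unfolding Z_def[abs_def] using X_meas Y_meas by (intro borel_measurable_Pair) auto

lemma prob_space_Z: "k \<ge> 1 \<Longrightarrow> prob_space (distr M borel (Z k))"
  using Z_meas by (rule prob_space_distr)

lemma fst_borel [measurable]: "(fst :: 'x \<times> real \<Rightarrow> 'x) \<in> borel_measurable borel"
  by (intro borel_measurable_continuous_onI continuous_intros)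

lemma snd_borel [measurable]: "(snd :: 'x \<times> real \<Rightarrow> real) \<in> borel_measurable borel"
  by (intro borel_measurable_continuous_onI continuous_intros)

lemma excess_meas:
  assumes "k \<ge> 1" "f \<in> borel_measurable borel"
  shows "excess B (\<Phi> k) f \<in> borel_measurable borel"
proof -
  note [measurable] = assms(2) \<Phi>_meas[OF assms(1)]
  have "(\<lambda>z :: 'x \<times> real. truncate B h (fst z)) \<in> borel_measurable borel" if [measurable]: "h \<in> borel_measurable borel" for h
    unfolding truncate_def by measurable
  moreover have "(\<lambda>z :: 'x \<times> real. truncate B id (snd z)) \<in> borel_measurable borel"
    unfolding truncate_def id_def by measurable
  ultimately show ?thesis unfolding excess_def[abs_def] using assms(2) \<Phi>_meas[OF assms(1)]
    by (intro borel_measurable_diff borel_measurable_power) auto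
qed

lemma truncate_id_eq: "\<bar>y\<bar> \<le> B \<Longrightarrow> f x = y \<Longrightarrow> truncate B f x = y"
  by (auto simp: truncate_def)

text \<open>The exceptional set does not depend on \<open>f\<close>, so a data-dependent function
  may be inserted.\<close>

lemma AE_excess_Z:
  assumes "k \<ge> 1"
  shows "AE \<omega> in M. \<forall>f. excess B (\<Phi> k) f (Z k \<omega>) =
    (truncate B f (X k \<omega>) - Y k \<omega>)\<^sup>2 - (\<Phi> k (X k \<omega>) - Y k \<omega>)\<^sup>2"
  using Y_bound[OF assms] \<Phi>_bound[OF assms]
  by eventually_elim (simp add: excess_def Z_def truncate_id_eq)

lemma integrable_truncate_sq:
  assumes "k \<ge> 1" "f \<in> borel_measurable borel"
  shows "integrable M (\<lambda>\<omega>. (truncate B f (X k \<omega>) - \<Phi> k (X k \<omega>))\<^sup>2)"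
proof (rule integrable_const_bound[of _ "(2 * B)\<^sup>2"])
  note [measurable] = assms(2) X_meas[OF assms(1)] \<Phi>_meas[OF assms(1)]
  show "(\<lambda>\<omega>. (truncate B f (X k \<omega>) - \<Phi> k (X k \<omega>))\<^sup>2) \<in> borel_measurable M"
    unfolding truncate_def by measurable
  show "AE \<omega> in M. norm ((truncate B f (X k \<omega>) - \<Phi> k (X k \<omega>))\<^sup>2) \<le> (2 * B)\<^sup>2"
    using \<Phi>_bound[OF assms(1)]
  proof eventually_elim
    case (elim \<omega>)
    have "\<bar>truncate B f (X k \<omega>) - \<Phi> k (X k \<omega>)\<bar> \<le> \<bar>2 * B\<bar>"
      using elim abs_truncate_le[of B f "X k \<omega>"] B_pos by linarith
    then show ?case by (simp add: abs_le_square_iff)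
  qed
qed

text \<open>The second part is a Bernstein condition: the Lipschitz bound gives
  \<open>h^2 \<le> 16 * B^2 * d^2\<close> almost surely, with \<open>d\<close> the truncated
  estimation error, and the first part identifies the mean of \<open>d^2\<close> with that of
  \<open>h\<close>.\<close>

lemma integral_excess:
  assumes "k \<ge> 1" "f \<in> borel_measurable borel"
  shows "(\<integral>z. excess B (\<Phi> k) f z \<partial>distr M borel (Z k)) =
      (\<integral>\<omega>. (truncate B f (X k \<omega>) - \<Phi> k (X k \<omega>))\<^sup>2 \<partial>M)"
    and "(\<integral>z. (excess B (\<Phi> k) f z)\<^sup>2 \<partial>distr M borel (Z k)) \<le>
      16 * B\<^sup>2 * (\<integral>\<omega>. (truncate B f (X k \<omega>) - \<Phi> k (X k \<omega>))\<^sup>2 \<partial>M)"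
proof -
  note [measurable] = X_meas[OF assms(1)] Y_meas[OF assms(1)] \<Phi>_meas[OF assms(1)] Z_meas[OF assms(1)]
    assms(2) excess_meas[OF assms]
  have [measurable]: "(\<lambda>\<omega>. truncate B f (X k \<omega>)) \<in> borel_measurable M" unfolding truncate_def by measurable
  have "(\<integral>z. excess B (\<Phi> k) f z \<partial>distr M borel (Z k)) = (\<integral>\<omega>. excess B (\<Phi> k) f (Z k \<omega>) \<partial>M)"
    by (intro integral_distr) measurable
  also have "\<dots> = (\<integral>\<omega>. (truncate B f (X k \<omega>) - Y k \<omega>)\<^sup>2 - (\<Phi> k (X k \<omega>) - Y k \<omega>)\<^sup>2 \<partial>M)"
    using AE_excess_Z[OF assms(1)] by (intro integral_cong_AE) auto
  also have "\<dots> = (\<integral>\<omega>. (truncate B f (X k \<omega>) - \<Phi> k (X k \<omega>))\<^sup>2 \<partial>M)"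
    by (intro excess_risk_identity assms integrable_truncate_sq truncate_measurable)
  finally show "(\<integral>z. excess B (\<Phi> k) f z \<partial>distr M borel (Z k)) =
      (\<integral>\<omega>. (truncate B f (X k \<omega>) - \<Phi> k (X k \<omega>))\<^sup>2 \<partial>M)" .
  have "(\<integral>z. (excess B (\<Phi> k) f z)\<^sup>2 \<partial>distr M borel (Z k)) = (\<integral>\<omega>. (excess B (\<Phi> k) f (Z k \<omega>))\<^sup>2 \<partial>M)"
    by (intro integral_distr) measurable
  also have "\<dots> \<le> (\<integral>\<omega>. 16 * B\<^sup>2 * (truncate B f (X k \<omega>) - \<Phi> k (X k \<omega>))\<^sup>2 \<partial>M)"
  proof (intro integral_mono_AE)
    show "integrable M (\<lambda>\<omega>. (excess B (\<Phi> k) f (Z k \<omega>))\<^sup>2)"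
    proof (rule integrable_const_bound[of _ "(4 * B\<^sup>2)\<^sup>2"])
      show "AE \<omega> in M. norm ((excess B (\<Phi> k) f (Z k \<omega>))\<^sup>2) \<le> (4 * B\<^sup>2)\<^sup>2"
      proof (rule AE_I2)
        fix \<omega>
        have "\<bar>excess B (\<Phi> k) f (Z k \<omega>)\<bar> \<le> \<bar>4 * B\<^sup>2\<bar>"
          using abs_excess_le(2)[of B "\<Phi> k" f "Z k \<omega>"] B_pos by simp
        then have "(excess B (\<Phi> k) f (Z k \<omega>))\<^sup>2 \<le> (4 * B\<^sup>2)\<^sup>2"
          by (rule abs_le_square_iff[THEN iffD1])
        then show "norm ((excess B (\<Phi> k) f (Z k \<omega>))\<^sup>2) \<le> (4 * B\<^sup>2)\<^sup>2"
          by (simp only: real_norm_def abs_power2)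
      qed
    qed measurable
    show "integrable M (\<lambda>\<omega>. 16 * B\<^sup>2 * (truncate B f (X k \<omega>) - \<Phi> k (X k \<omega>))\<^sup>2)"
      using integrable_truncate_sq[OF assms] by simp
    show "AE \<omega> in M. (excess B (\<Phi> k) f (Z k \<omega>))\<^sup>2 \<le> 16 * B\<^sup>2 * (truncate B f (X k \<omega>) - \<Phi> k (X k \<omega>))\<^sup>2"
      using \<Phi>_bound[OF assms(1)]
    proof eventually_elim
      case (elim \<omega>)
      have "\<bar>excess B (\<Phi> k) f (Z k \<omega>)\<bar> \<le> \<bar>4 * B * (truncate B f (X k \<omega>) - \<Phi> k (X k \<omega>))\<bar>"
        using abs_excess_le(1)[of B "\<Phi> k" f "Z k \<omega>"] B_pos elim
        by (simp add: Z_def truncate_id_eq abs_mult)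
      then have "(excess B (\<Phi> k) f (Z k \<omega>))\<^sup>2 \<le> (4 * B * (truncate B f (X k \<omega>) - \<Phi> k (X k \<omega>)))\<^sup>2"
        by (rule abs_le_square_iff[THEN iffD1])
      then show ?case by (simp add: power_mult_distrib)
    qed
  qed
  also have "\<dots> = 16 * B\<^sup>2 * (\<integral>\<omega>. (truncate B f (X k \<omega>) - \<Phi> k (X k \<omega>))\<^sup>2 \<partial>M)" by simp
  finally show "(\<integral>z. (excess B (\<Phi> k) f z)\<^sup>2 \<partial>distr M borel (Z k)) \<le>
      16 * B\<^sup>2 * (\<integral>\<omega>. (truncate B f (X k \<omega>) - \<Phi> k (X k \<omega>))\<^sup>2 \<partial>M)" .
qed

end

section \<open>Deviations of the excess losses with offset\<close>

context bounded_regression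
begin

lemma abs_excess_bound: "\<bar>excess B \<phi> f z\<bar> \<le> 4 * B\<^sup>2"
  using B_pos by (intro abs_excess_le) simp

text \<open>The coefficient is \<open>2 * \<gamma>\<close> for the \<open>\<gamma>\<close> of
  \<open>sum_Pow_Max_excess_le\<close>: multiplied by the second-moment factor
  \<open>16 * B^2\<close> it gives exactly \<open>lam - 1\<close>.\<close>

definition offset_excess :: "real \<Rightarrow> ('x \<Rightarrow> real) \<Rightarrow> nat \<Rightarrow> 'x \<times> real \<Rightarrow> real" where
  "offset_excess lam f k z = lam * excess B (\<Phi> k) f z
     - 2 * ((lam - 1) / (32 * B\<^sup>2)) * (excess B (\<Phi> k) f z)\<^sup>2"

text \<open>Since \<open>E h\<^sup>2 \<le> 16 B\<^sup>2 E h\<close> for an excess loss \<open>h\<close>, the offset is paid for by \<open>(\<lambda> - 1) E h\<close>;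
  see \<open>deviation_ge\<close>.\<close>

definition deviation :: "real \<Rightarrow> ('x \<Rightarrow> real) \<Rightarrow> nat \<Rightarrow> 'x \<times> real \<Rightarrow> real" where
  "deviation lam f k z =
     (\<integral>z. offset_excess lam f k z \<partial>distr M borel (Z k)) + - lam * excess B (\<Phi> k) f z"

text \<open>Any finite bound would do: it serves integrability and acts as \<open>Rp\<close>, which
  does not occur in the cost of decoupling.\<close>

definition offset_bound :: "real \<Rightarrow> real" where
  "offset_bound lam = \<bar>lam\<bar> * (4 * B\<^sup>2) + \<bar>2 * ((lam - 1) / (32 * B\<^sup>2))\<bar> * (4 * B\<^sup>2)\<^sup>2"

lemma abs_offset_excess_le: "\<bar>offset_excess lam f k z\<bar> \<le> offset_bound lam"
proof -
  have e: "\<bar>excess B (\<Phi> k) f z\<bar> \<le> 4 * B\<^sup>2" by (rule abs_excess_bound)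
  then have "\<bar>(excess B (\<Phi> k) f z)\<^sup>2\<bar> \<le> (4 * B\<^sup>2)\<^sup>2"
    unfolding power_abs by (intro power_mono) auto
  with e show ?thesis
    unfolding offset_excess_def offset_bound_def
    by (intro order_trans[OF abs_triangle_ineq4] add_mono) (simp_all only: abs_mult mult_left_mono abs_ge_zero)
qed

lemma offset_excess_meas:
  assumes "k \<ge> 1" "f \<in> borel_measurable borel"
  shows "offset_excess lam f k \<in> borel_measurable borel"
  using excess_meas[OF assms] unfolding offset_excess_def[abs_def] by measurable

lemma deviation_meas:
  assumes "k \<ge> 1" "f \<in> borel_measurable borel"
  shows "deviation lam f k \<in> borel_measurable borel"
  using excess_meas[OF assms] unfolding deviation_def[abs_def] by measurable

lemma integrable_offset_excess:
  assumes "k \<ge> 1" "f \<in> borel_measurable borel"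
  shows "integrable (distr M borel (Z k)) (offset_excess lam f k)"
proof -
  interpret \<nu>: prob_space "distr M borel (Z k)" by (rule prob_space_Z) fact
  show ?thesis using abs_offset_excess_le offset_excess_meas[OF assms]
    by (intro \<nu>.integrable_const_bound[of _ "offset_bound lam"]) auto
qed

lemma abs_deviation_le:
  assumes "k \<ge> 1" "f \<in> borel_measurable borel"
  shows "\<bar>deviation lam f k z\<bar> \<le> offset_bound lam + \<bar>lam\<bar> * (4 * B\<^sup>2)"
proof -
  interpret \<nu>: prob_space "distr M borel (Z k)" by (rule prob_space_Z) fact
  have "\<bar>\<integral>z. offset_excess lam f k z \<partial>distr M borel (Z k)\<bar> \<le> (\<integral>z. \<bar>offset_excess lam f k z\<bar> \<partial>distr M borel (Z k))"
    by (rule integral_abs_bound)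
  also have "\<dots> \<le> (\<integral>z. offset_bound lam \<partial>distr M borel (Z k))"
    using abs_offset_excess_le integrable_offset_excess[OF assms]
    by (intro integral_mono integrable_abs \<nu>.integrable_const) auto
  also have "\<dots> = offset_bound lam" using \<nu>.prob_space by simp
  finally have 1: "\<bar>\<integral>z. offset_excess lam f k z \<partial>distr M borel (Z k)\<bar> \<le> offset_bound lam" .
  have "\<bar>excess B (\<Phi> k) f z\<bar> \<le> 4 * B\<^sup>2" by (rule abs_excess_bound)
  then have "\<bar>- lam * excess B (\<Phi> k) f z\<bar> \<le> \<bar>lam\<bar> * (4 * B\<^sup>2)"
    unfolding abs_mult abs_minus_cancel by (intro mult_left_mono) auto
  with 1 show ?thesis unfolding deviation_def by linarith
qed

text \<open>The excess at \<open>z\<close> cancels, so \<open>z\<close> is arbitrary. With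
  \<open>r\<close> the truncated risk, what remains is \<open>lam * r - 2 * \<gamma> * E h^2 \<ge>
  lam * r - (lam - 1) * r = r\<close>.\<close>

lemma deviation_ge:
  assumes "k \<ge> 1" "f \<in> borel_measurable borel" "lam > 1"
  shows "(\<integral>\<omega>. (truncate B f (X k \<omega>) - \<Phi> k (X k \<omega>))\<^sup>2 \<partial>M) \<le> deviation lam f k z + lam * excess B (\<Phi> k) f z"
proof -
  interpret \<nu>: prob_space "distr M borel (Z k)" by (rule prob_space_Z) fact
  let ?r = "\<integral>\<omega>. (truncate B f (X k \<omega>) - \<Phi> k (X k \<omega>))\<^sup>2 \<partial>M"
  let ?g = "2 * ((lam - 1) / (32 * B\<^sup>2))"
  note [measurable] = excess_meas[OF assms(1,2)]
  have e: "\<bar>excess B (\<Phi> k) f z\<bar> \<le> 4 * B\<^sup>2" for z by (rule abs_excess_bound)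
  have i1: "integrable (distr M borel (Z k)) (excess B (\<Phi> k) f)"
    using e by (intro \<nu>.integrable_const_bound[of _ "4 * B\<^sup>2"]) auto
  have i2: "integrable (distr M borel (Z k)) (\<lambda>z. (excess B (\<Phi> k) f z)\<^sup>2)"
  proof (rule \<nu>.integrable_const_bound[of _ "(4 * B\<^sup>2)\<^sup>2"])
    show "AE z in distr M borel (Z k). norm ((excess B (\<Phi> k) f z)\<^sup>2) \<le> (4 * B\<^sup>2)\<^sup>2"
    proof (rule AE_I2)
      fix z
      show "norm ((excess B (\<Phi> k) f z)\<^sup>2) \<le> (4 * B\<^sup>2)\<^sup>2"
        unfolding real_norm_def power_abs using e[of z] by (intro power_mono) auto
    qed
  qed measurable
  have "?g * (\<integral>z. (excess B (\<Phi> k) f z)\<^sup>2 \<partial>distr M borel (Z k)) \<le> ?g * (16 * B\<^sup>2 * ?r)"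
    using integral_excess(2)[OF assms(1,2)] \<open>lam > 1\<close> by (intro mult_left_mono) auto
  also have "\<dots> = (lam - 1) * ?r" using B_pos by (simp add: field_simps)
  finally have "?r \<le> lam * ?r - ?g * (\<integral>z. (excess B (\<Phi> k) f z)\<^sup>2 \<partial>distr M borel (Z k))"
    by (simp add: left_diff_distrib)
  also have "\<dots> = (\<integral>z. offset_excess lam f k z \<partial>distr M borel (Z k))"
    unfolding offset_excess_def using i1 i2 integral_excess(1)[OF assms(1,2)] by simp
  finally show ?thesis unfolding deviation_def by simp
qed

text \<open>Distinct indices of a residue class modulo \<open>m\<close> are at least
  \<open>m\<close> apart, so the block estimate applies, and the maximum of a sum is at most the sum
  of the maxima over the classes. Each class pays the complexity once, each observation one mixing
  coefficient.\<close>

lemma expectation_Max_deviation_le: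
  fixes V m n :: nat
  assumes vc: "vc_dim F = enat V" and F: "F \<subseteq> borel_measurable borel"
    and H: "finite H" "H \<subseteq> F" "H \<noteq> {}" and "lam > 1" "m \<ge> 1"
    and W: "W > real V"
    and W_ge: "\<And>l. l \<le> n div m + 1 \<Longrightarrow> V * ln (exp 1 * (2 * real l / 3 + 1) / V) \<le> W"
    and b: "beta_mixing M Z m \<le> ennreal b" "b \<ge> 0"
  shows "(\<integral>\<omega>. (MAX f\<in>H. \<Sum>k=1..n. deviation lam f k (Z k \<omega>)) \<partial>M)
    \<le> m * (32 * (2 * lam - 1)\<^sup>2 * (lam / (lam - 1)) * B\<^sup>2 * W) + n * (8 * B\<^sup>2 * lam * b)"
proof -
  define C where "C = 32 * (2 * lam - 1)\<^sup>2 * (lam / (lam - 1)) * B\<^sup>2 * W"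
  have W0: "W > 0" using W by simp
  have C0: "C \<ge> 0" unfolding C_def using W0 \<open>lam > 1\<close> by (intro mult_nonneg_nonneg) auto
  define J where "J r = {k\<in>{1..n}. k mod m = r}" for r
  have fJ: "finite (J r)" for r by (simp add: J_def)
  have J_un: "(\<Union>r<m. J r) = {1..n}" using \<open>m \<ge> 1\<close> by (auto simp: J_def)
  \<comment> \<open>A class can have one element more than \<open>n div m\<close>, hence the range
    of \<open>l\<close> in \<open>W_ge\<close>.\<close>
  have cJ: "card (J r) \<le> n div m + 1" for r
  proof -
    have "inj_on (\<lambda>k. k div m) (J r)"
    proof (rule inj_onI)
      fix k l assume "k \<in> J r" "l \<in> J r" "k div m = l div m"
      then show "k = l" by (metis (mono_tags, lifting) J_def div_mult_mod_eq mem_Collect_eq)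
    qed
    then have "card (J r) \<le> card {0..n div m}"
      by (rule card_inj_on_le) (auto simp: J_def intro: div_le_mono)
    then show ?thesis by simp
  qed
  have fM: "f \<in> borel_measurable borel" if "f \<in> H" for f using that H F by blast
  have int: "integrable M (\<lambda>\<omega>. MAX f\<in>H. \<Sum>k\<in>A. deviation lam f k (Z k \<omega>))" if A: "A \<subseteq> {1..n}" for A
  proof (rule integrable_const_bound[of _ "card A * (offset_bound lam + \<bar>lam\<bar> * (4 * B\<^sup>2))"])
    show "AE \<omega> in M. norm (MAX f\<in>H. \<Sum>k\<in>A. deviation lam f k (Z k \<omega>))
      \<le> card A * (offset_bound lam + \<bar>lam\<bar> * (4 * B\<^sup>2))"
      unfolding real_norm_def
    proof (intro AE_I2 abs_Max_image_le H)
      fix \<omega> f assume f: "f \<in> H"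
      have "\<bar>\<Sum>k\<in>A. deviation lam f k (Z k \<omega>)\<bar> \<le> (\<Sum>k\<in>A. \<bar>deviation lam f k (Z k \<omega>)\<bar>)" by (rule sum_abs)
      also have "\<dots> \<le> (\<Sum>k\<in>A. offset_bound lam + \<bar>lam\<bar> * (4 * B\<^sup>2))"
        using A f fM by (intro sum_mono abs_deviation_le) auto
      finally show "\<bar>\<Sum>k\<in>A. deviation lam f k (Z k \<omega>)\<bar> \<le> card A * (offset_bound lam + \<bar>lam\<bar> * (4 * B\<^sup>2))"
        by simp
    qed
    show "(\<lambda>\<omega>. MAX f\<in>H. \<Sum>k\<in>A. deviation lam f k (Z k \<omega>)) \<in> borel_measurable M"
    proof (intro borel_measurable_Max H borel_measurable_sum)
      fix f k assume "f \<in> H" "k \<in> A"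
      then have "k \<ge> 1" using A by auto
      then show "(\<lambda>\<omega>. deviation lam f k (Z k \<omega>)) \<in> borel_measurable M"
        using measurable_compose[OF Z_meas deviation_meas] fM \<open>f \<in> H\<close> by blast
    qed
  qed
  have block: "(\<integral>\<omega>. (MAX f\<in>H. \<Sum>k\<in>J r. deviation lam f k (Z k \<omega>)) \<partial>M) \<le> C + card (J r) * (8 * B\<^sup>2 * lam * b)" for r
  proof (cases "J r = {}")
    case True
    then show ?thesis using C0 H by (simp add: prob_space)
  next
    case False
    have k1: "k \<ge> 1" if "k \<in> J r" for k using that by (simp add: J_def)
    \<comment> \<open>The sample half has range \<open>Rm = 4 * B^2 * lam\<close>, so an observation
      is charged \<open>2 * Rm * b = 8 * B^2 * lam * b\<close>.\<close>
    have "(\<integral>\<omega>. (MAX f\<in>H. \<Sum>k\<in>J r. (\<integral>z. offset_excess lam f k z \<partial>distr M borel (Z k)) + - lam * excess B (\<Phi> k) f (Z k \<omega>)) \<partial>M)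
      \<le> C + card (J r) * (2 * (4 * B\<^sup>2 * lam) * b)"
    proof (rule expectation_Max_block_le[OF prob_space_axioms Z_meas H(1,3), where Rp = "offset_bound lam" and m = m])
      fix f k assume "f \<in> H" "k \<in> J r"
      then show "offset_excess lam f k \<in> borel_measurable borel"
        "(\<lambda>z. - lam * excess B (\<Phi> k) f z) \<in> borel_measurable borel"
        using excess_meas[of k f] offset_excess_meas[of k f] k1 fM by auto
    next
      fix f k z
      have "\<bar>excess B (\<Phi> k) f z\<bar> \<le> 4 * B\<^sup>2" by (rule abs_excess_bound)
      then have "\<bar>excess B (\<Phi> k) f z\<bar> * \<bar>lam\<bar> \<le> 4 * B\<^sup>2 * \<bar>lam\<bar>" by (intro mult_right_mono) auto
      then show "\<bar>- lam * excess B (\<Phi> k) f z\<bar> \<le> 4 * B\<^sup>2 * lam"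
        using \<open>lam > 1\<close> by (simp add: abs_mult mult.commute)
    next
      fix k l assume kl: "k \<in> J r" "l \<in> J r" "k < l"
      then have "k div m < l div m"
        by (metis (mono_tags, lifting) J_def div_le_mono div_mult_mod_eq le_neq_implies_less less_imp_le_nat mem_Collect_eq nat_neq_iff)
      then have "(k div m + 1) * m \<le> l div m * m" by (intro mult_right_mono) auto
      moreover have "k = k div m * m + r" "l = l div m * m + r"
        using kl div_mult_mod_eq[of k m] div_mult_mod_eq[of l m] by (auto simp: J_def)
      ultimately show "k + m \<le> l" by (simp add: distrib_right)
    next
      fix z :: "nat \<Rightarrow> 'x \<times> real"
      show "(\<Sum>S\<in>Pow (J r). MAX f\<in>H. \<Sum>k\<in>J r. 2 * (if k \<in> S then offset_excess lam f k (z k)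
          else - lam * excess B (\<Phi> k) f (z k))) \<le> 2 ^ card (J r) * C"
        unfolding C_def offset_excess_def
        by (rule sum_Pow_Max_excess_le[OF vc H fJ False B_pos \<open>lam > 1\<close> W W_ge[OF cJ] refl])
    qed (use abs_offset_excess_le B_pos \<open>lam > 1\<close> b in \<open>auto simp: J_def\<close>)
    then show ?thesis unfolding deviation_def by (simp add: mult_ac)
  qed
  have "(\<integral>\<omega>. (MAX f\<in>H. \<Sum>k=1..n. deviation lam f k (Z k \<omega>)) \<partial>M)
    \<le> (\<integral>\<omega>. (\<Sum>r<m. MAX f\<in>H. \<Sum>k\<in>J r. deviation lam f k (Z k \<omega>)) \<partial>M)"
  proof (rule integral_mono)
    fix \<omega>
    show "(MAX f\<in>H. \<Sum>k=1..n. deviation lam f k (Z k \<omega>)) \<le> (\<Sum>r<m. MAX f\<in>H. \<Sum>k\<in>J r. deviation lam f k (Z k \<omega>))"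
    proof (rule Max.boundedI)
      fix y assume "y \<in> (\<lambda>f. \<Sum>k=1..n. deviation lam f k (Z k \<omega>)) ` H"
      then obtain f where f: "f \<in> H" "y = (\<Sum>k=1..n. deviation lam f k (Z k \<omega>))" by auto
      have "y = (\<Sum>r<m. \<Sum>k\<in>J r. deviation lam f k (Z k \<omega>))"
        unfolding f(2) J_un[symmetric] by (intro sum.UNION_disjoint) (auto simp: J_def)
      also have "\<dots> \<le> (\<Sum>r<m. MAX f\<in>H. \<Sum>k\<in>J r. deviation lam f k (Z k \<omega>))"
        using f H by (intro sum_mono Max_ge) auto
      finally show "y \<le> (\<Sum>r<m. MAX f\<in>H. \<Sum>k\<in>J r. deviation lam f k (Z k \<omega>))" .
    qed (use H in auto)
  qed (auto intro!: int Bochner_Integration.integrable_sum simp: J_def)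
  also have "\<dots> = (\<Sum>r<m. \<integral>\<omega>. (MAX f\<in>H. \<Sum>k\<in>J r. deviation lam f k (Z k \<omega>)) \<partial>M)"
    by (intro Bochner_Integration.integral_sum int) (auto simp: J_def)
  also have "\<dots> \<le> (\<Sum>r<m. C + card (J r) * (8 * B\<^sup>2 * lam * b))" by (intro sum_mono block)
  also have "\<dots> = m * C + (\<Sum>r<m. card (J r)) * (8 * B\<^sup>2 * lam * b)"
    by (simp add: sum.distrib sum_distrib_right)
  also have "(\<Sum>r<m. card (J r)) = card {1..n}"
    unfolding J_un[symmetric] by (intro card_UN_disjoint[symmetric]) (auto simp: J_def)
  finally show ?thesis by (simp add: C_def)
qed

end

section \<open>From finite subclasses to the least-squares estimator\<close>

context bounded_regression
begin

text \<open>Truncation is continuous and the offset excess is bounded uniformly over functions, so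
  dominated convergence needs no more than the pointwise limits that a pointwise measurable class
  provides.\<close>

lemma deviation_tendsto:
  assumes k: "k \<ge> 1" and g: "\<And>j. g j \<in> borel_measurable borel" and f: "f \<in> borel_measurable borel"
    and lim: "\<And>x. (\<lambda>j. g j x) \<longlonglongrightarrow> f x"
  shows "(\<lambda>j. deviation lam (g j) k z) \<longlonglongrightarrow> deviation lam f k z"
proof -
  interpret \<nu>: prob_space "distr M borel (Z k)" by (rule prob_space_Z) fact
  have ex: "(\<lambda>j. excess B (\<Phi> k) (g j) z) \<longlonglongrightarrow> excess B (\<Phi> k) f z" for z
    unfolding excess_def truncate_def by (intro tendsto_intros lim)
  have "(\<lambda>j. \<integral>z. offset_excess lam (g j) k z \<partial>distr M borel (Z k)) \<longlonglongrightarrow>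
      (\<integral>z. offset_excess lam f k z \<partial>distr M borel (Z k))"
  proof (rule integral_dominated_convergence[where w = "\<lambda>_. offset_bound lam"])
    show "AE z in distr M borel (Z k). (\<lambda>j. offset_excess lam (g j) k z) \<longlonglongrightarrow> offset_excess lam f k z"
      unfolding offset_excess_def by (intro AE_I2 tendsto_intros ex)
  qed (use offset_excess_meas[OF k] f g abs_offset_excess_le in auto)
  then show ?thesis unfolding deviation_def by (intro tendsto_intros ex)
qed

text \<open>A countable pointwise dense subclass and monotone limits of finite maxima take care of
  the supremum over \<open>F\<close>, which need not be attained or measurable.\<close>

lemma ex_deviation_envelope:
  fixes n :: nat and lam C :: real
  assumes F: "F \<subseteq> borel_measurable borel" "pointwise_measurable F" "F \<noteq> {}"
    and C: "\<And>H. finite H \<Longrightarrow> H \<subseteq> F \<Longrightarrow> H \<noteq> {} \<Longrightarrow>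
      (\<integral>\<omega>. (MAX f\<in>H. \<Sum>k=1..n. deviation lam f k (Z k \<omega>)) \<partial>M) \<le> C"
  obtains S where "integrable M S" "(\<integral>\<omega>. S \<omega> \<partial>M) \<le> C"
    "\<And>f \<omega>. f \<in> F \<Longrightarrow> (\<Sum>k=1..n. deviation lam f k (Z k \<omega>)) \<le> S \<omega>"
proof -
  obtain G where G: "G \<subseteq> F" "countable G"
    "\<And>f. f \<in> F \<Longrightarrow> \<exists>g :: nat \<Rightarrow> 'x \<Rightarrow> real. range g \<subseteq> G \<and> (\<forall>x. (\<lambda>j. g j x) \<longlonglongrightarrow> f x)"
    using F(2) unfolding pointwise_measurable_def by blast
  have "G \<noteq> {}" using G(3) F(3) by blast
  define e where "e = from_nat_into G"
  have e: "range e = G" unfolding e_def using \<open>G \<noteq> {}\<close> G(2) by (rule range_from_nat_into)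
  define D where "D f \<omega> = (\<Sum>k=1..n. deviation lam f k (Z k \<omega>))" for f \<omega>
  define S' where "S' j \<omega> = (MAX f\<in>e ` {..j}. D f \<omega>)" for j \<omega>
  define S where "S \<omega> = (SUP j. S' j \<omega>)" for \<omega>
  define K where "K = n * (offset_bound lam + \<bar>lam\<bar> * (4 * B\<^sup>2))"
  have FM: "f \<in> borel_measurable borel" if "f \<in> F" for f using that F by blast
  have eF: "e j \<in> F" for j using e G(1) by blast
  have D_bound: "\<bar>D f \<omega>\<bar> \<le> K" if "f \<in> F" for f \<omega>
  proof -
    have "\<bar>D f \<omega>\<bar> \<le> (\<Sum>k=1..n. \<bar>deviation lam f k (Z k \<omega>)\<bar>)" unfolding D_def by (rule sum_abs)
    also have "\<dots> \<le> (\<Sum>k=1..n. offset_bound lam + \<bar>lam\<bar> * (4 * B\<^sup>2))"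
      using FM[OF that] by (intro sum_mono abs_deviation_le) auto
    finally show ?thesis by (simp add: K_def)
  qed
  have D_meas: "D f \<in> borel_measurable M" if "f \<in> F" for f
    unfolding D_def
  proof (rule borel_measurable_sum)
    fix k assume "k \<in> {1..n}"
    then have "k \<ge> 1" by simp
    then show "(\<lambda>\<omega>. deviation lam f k (Z k \<omega>)) \<in> borel_measurable M"
      by (intro measurable_compose[OF Z_meas deviation_meas] FM that)
  qed
  have S'_meas: "S' j \<in> borel_measurable M" for j
    unfolding S'_def using eF D_meas by (intro borel_measurable_Max) auto
  have S'_bound: "\<bar>S' j \<omega>\<bar> \<le> K" for j \<omega>
    unfolding S'_def using eF D_bound by (intro abs_Max_image_le) auto
  have mono: "incseq (\<lambda>j. S' j \<omega>)" for \<omega>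
  proof (rule incseq_SucI)
    fix j
    have "(\<lambda>f. D f \<omega>) ` e ` {..j} \<subseteq> (\<lambda>f. D f \<omega>) ` e ` {..Suc j}" by (intro image_mono) auto
    then show "S' j \<omega> \<le> S' (Suc j) \<omega>" unfolding S'_def by (rule Max_mono) auto
  qed
  have bdd: "bdd_above (range (\<lambda>j. S' j \<omega>))" for \<omega>
  proof (rule bdd_aboveI)
    fix y assume "y \<in> range (\<lambda>j. S' j \<omega>)"
    then obtain j where "y = S' j \<omega>" by blast
    then show "y \<le> K" using S'_bound[of j \<omega>] by linarith
  qed
  have lim: "(\<lambda>j. S' j \<omega>) \<longlonglongrightarrow> S \<omega>" for \<omega>
    unfolding S_def using bdd mono by (rule LIMSEQ_incseq_SUP)
  have S_meas: "S \<in> borel_measurable M" by (rule borel_measurable_LIMSEQ_real[OF lim S'_meas])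
  have S_bound: "\<bar>S \<omega>\<bar> \<le> K" for \<omega>
    using tendsto_rabs[OF lim[of \<omega>]] by (rule LIMSEQ_le_const2) (use S'_bound in auto)
  have G_le: "D g \<omega> \<le> S \<omega>" if "g \<in> G" for g \<omega>
  proof -
    have "g \<in> range e" using that e by simp
    then obtain j where j: "g = e j" by blast
    have "D g \<omega> \<le> S' j \<omega>" unfolding S'_def j by (intro Max_ge) auto
    also have "\<dots> \<le> S \<omega>" unfolding S_def using bdd by (intro cSUP_upper) auto
    finally show ?thesis .
  qed
  show ?thesis
  proof (rule that[of S])
    show "integrable M S" using S_meas S_bound by (intro integrable_const_bound[of _ K]) auto
    have "(\<lambda>j. \<integral>\<omega>. S' j \<omega> \<partial>M) \<longlonglongrightarrow> (\<integral>\<omega>. S \<omega> \<partial>M)"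
      by (rule integral_dominated_convergence[where w = "\<lambda>_. K"]) (use S_meas S'_meas S'_bound lim in auto)
    then show "(\<integral>\<omega>. S \<omega> \<partial>M) \<le> C"
    proof (rule LIMSEQ_le_const2)
      have "(\<integral>\<omega>. S' j \<omega> \<partial>M) \<le> C" for j
        unfolding S'_def D_def using eF by (intro C) auto
      then show "\<exists>N. \<forall>j\<ge>N. (\<integral>\<omega>. S' j \<omega> \<partial>M) \<le> C" by blast
    qed
    \<comment> \<open>Limits are taken at a fixed \<open>\<omega>\<close>, so the bound has no
      exceptional set depending on \<open>f\<close>; this permits inserting the random minimiser
      later.\<close>
    fix f \<omega> assume f: "f \<in> F"
    from G(3)[OF this] obtain g :: "nat \<Rightarrow> 'x \<Rightarrow> real"
      where g: "range g \<subseteq> G" "\<And>x. (\<lambda>j. g j x) \<longlonglongrightarrow> f x" by blast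
    have gM: "g j \<in> borel_measurable borel" for j using g(1) G(1) F(1) by blast
    have "(\<lambda>j. D (g j) \<omega>) \<longlonglongrightarrow> D f \<omega>"
      unfolding D_def by (intro tendsto_sum deviation_tendsto gM FM f g(2)) auto
    then have "D f \<omega> \<le> S \<omega>"
    proof (rule LIMSEQ_le_const2)
      have "D (g j) \<omega> \<le> S \<omega>" for j using g(1) by (intro G_le) auto
      then show "\<exists>N. \<forall>j\<ge>N. D (g j) \<omega> \<le> S \<omega>" by blast
    qed
    then show "(\<Sum>k=1..n. deviation lam f k (Z k \<omega>)) \<le> S \<omega>" unfolding D_def .
  qed
qed

lemma nn_integral_distr_sq:
  assumes "k \<ge> 1" "f \<in> borel_measurable borel"
  shows "(\<integral>\<^sup>+x. ennreal ((f x - \<Phi> k x)\<^sup>2) \<partial>distr M borel (X k)) =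
    (\<integral>\<^sup>+\<omega>. ennreal ((f (X k \<omega>) - \<Phi> k (X k \<omega>))\<^sup>2) \<partial>M)"
proof -
  note [measurable] = assms(2) \<Phi>_meas[OF assms(1)] X_meas[OF assms(1)]
  show ?thesis by (subst nn_integral_distr) auto
qed

lemma mu_sq_dist_eq_ennreal:
  assumes "n \<ge> 1" "f \<in> borel_measurable borel"
    and "\<And>k. k \<in> {1..n} \<Longrightarrow> integrable M (\<lambda>\<omega>. (f (X k \<omega>) - \<Phi> k (X k \<omega>))\<^sup>2)"
  shows "mu_sq_dist M X n \<Phi> f = ennreal ((\<Sum>k=1..n. \<integral>\<omega>. (f (X k \<omega>) - \<Phi> k (X k \<omega>))\<^sup>2 \<partial>M) / n)"
proof -
  have "(\<Sum>k=1..n. \<integral>\<^sup>+x. ennreal ((f x - \<Phi> k x)\<^sup>2) \<partial>distr M borel (X k)) =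
      (\<Sum>k=1..n. ennreal (\<integral>\<omega>. (f (X k \<omega>) - \<Phi> k (X k \<omega>))\<^sup>2 \<partial>M))"
  proof (rule sum.cong[OF refl])
    fix k assume k: "k \<in> {1..n}"
    then have "(\<integral>\<^sup>+x. ennreal ((f x - \<Phi> k x)\<^sup>2) \<partial>distr M borel (X k)) =
        (\<integral>\<^sup>+\<omega>. ennreal ((f (X k \<omega>) - \<Phi> k (X k \<omega>))\<^sup>2) \<partial>M)"
      using assms(2) by (intro nn_integral_distr_sq) auto
    also have "\<dots> = ennreal (\<integral>\<omega>. (f (X k \<omega>) - \<Phi> k (X k \<omega>))\<^sup>2 \<partial>M)"
      by (rule nn_integral_eq_integral[OF assms(3)[OF k]]) simp
    finally show "(\<integral>\<^sup>+x. ennreal ((f x - \<Phi> k x)\<^sup>2) \<partial>distr M borel (X k)) =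
      ennreal (\<integral>\<omega>. (f (X k \<omega>) - \<Phi> k (X k \<omega>))\<^sup>2 \<partial>M)" .
  qed
  also have "\<dots> = ennreal (\<Sum>k=1..n. \<integral>\<omega>. (f (X k \<omega>) - \<Phi> k (X k \<omega>))\<^sup>2 \<partial>M)"
    by (intro sum_ennreal) auto
  finally show ?thesis
    unfolding mu_sq_dist_def power2_abs ennreal_of_nat_eq_real_of_nat using assms(1)
    by (simp only:) (rule divide_ennreal, auto intro!: sum_nonneg)
qed

lemma integrable_of_mu_sq_dist:
  assumes "n \<ge> 1" "f \<in> borel_measurable borel" "mu_sq_dist M X n \<Phi> f < \<infinity>" "k \<in> {1..n}"
  shows "integrable M (\<lambda>\<omega>. (f (X k \<omega>) - \<Phi> k (X k \<omega>))\<^sup>2)"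
proof (rule integrableI_nonneg)
  note [measurable] = assms(2) \<Phi>_meas X_meas
  show "(\<lambda>\<omega>. (f (X k \<omega>) - \<Phi> k (X k \<omega>))\<^sup>2) \<in> borel_measurable M"
    using assms(4) \<Phi>_meas[of k] X_meas[of k] by simp
  have "(\<Sum>k=1..n. \<integral>\<^sup>+x. ennreal ((f x - \<Phi> k x)\<^sup>2) \<partial>distr M borel (X k)) \<noteq> top"
  proof
    assume "(\<Sum>k=1..n. \<integral>\<^sup>+x. ennreal ((f x - \<Phi> k x)\<^sup>2) \<partial>distr M borel (X k)) = top"
    then have "mu_sq_dist M X n \<Phi> f = top / of_nat n" unfolding mu_sq_dist_def power2_abs by (rule arg_cong)
    then show False using assms(3) by (simp add: ennreal_top_divide)
  qed
  moreover have "(\<integral>\<^sup>+x. ennreal ((f x - \<Phi> k x)\<^sup>2) \<partial>distr M borel (X k)) \<le>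
      (\<Sum>k=1..n. \<integral>\<^sup>+x. ennreal ((f x - \<Phi> k x)\<^sup>2) \<partial>distr M borel (X k))"
    using assms(4) by (intro member_le_sum) auto
  ultimately have "(\<integral>\<^sup>+x. ennreal ((f x - \<Phi> k x)\<^sup>2) \<partial>distr M borel (X k)) \<noteq> top"
    by (simp only: less_top)
  then show "(\<integral>\<^sup>+\<omega>. ennreal ((f (X k \<omega>) - \<Phi> k (X k \<omega>))\<^sup>2) \<partial>M) < \<infinity>"
    using assms(2,4) by (subst nn_integral_distr_sq[symmetric]) (auto simp: less_top[symmetric])
qed simp

text \<open>Clipping is a contraction that fixes \<open>y\<close>.\<close>

lemma truncate_sq_le:
  assumes "\<bar>y\<bar> \<le> B" shows "(truncate B f x - y)\<^sup>2 \<le> (f x - y)\<^sup>2"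
proof (rule abs_le_square_iff[THEN iffD1])
  show "\<bar>truncate B f x - y\<bar> \<le> \<bar>f x - y\<bar>"
    using assms by (auto simp: truncate_def max_def min_def)
qed

text \<open>An oracle inequality against one \<open>f\<close>. At the data, truncation and
  minimality bound the excess of the estimator by the loss difference \<open>d\<close> of
  \<open>f\<close>; the envelope \<open>S\<close> controls the deviation, and the mean of
  \<open>d\<close> is the squared distance from \<open>f\<close> to the regression function. The
  random function is only compared pointwise with the integrable \<open>U\<close>.\<close>

lemma expectation_least_squares_le:
  fixes F :: "('x \<Rightarrow> real) set" and n :: nat and lam C :: real
  assumes F: "F \<subseteq> borel_measurable borel" "pointwise_measurable F"
    and "n \<ge> 1" "lam > 1"
    and C: "\<And>H. finite H \<Longrightarrow> H \<subseteq> F \<Longrightarrow> H \<noteq> {} \<Longrightarrow>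
      (\<integral>\<omega>. (MAX f\<in>H. \<Sum>k=1..n. deviation lam f k (Z k \<omega>)) \<partial>M) \<le> n * C"
    and "C \<ge> 0"
    and ls: "\<And>\<omega>. \<omega> \<in> space M \<Longrightarrow> least_squares_solution F n (\<lambda>k. X k \<omega>) (\<lambda>k. Y k \<omega>) (fhat \<omega>)"
    and f: "f \<in> F"
  shows "(\<integral>\<^sup>+\<omega>. mu_sq_dist M X n \<Phi> (truncate B (fhat \<omega>)) \<partial>M)
    \<le> ennreal C + ennreal lam * mu_sq_dist M X n \<Phi> f"
proof (cases "mu_sq_dist M X n \<Phi> f = \<infinity>")
  case True
  then show ?thesis using \<open>lam > 1\<close> by (simp add: ennreal_mult_top)
next
  case False
  have fM: "f \<in> borel_measurable borel" using f F by blast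
  have fhat: "fhat \<omega> \<in> F" "(\<Sum>k=1..n. (fhat \<omega> (X k \<omega>) - Y k \<omega>)\<^sup>2) \<le> (\<Sum>k=1..n. (f (X k \<omega>) - Y k \<omega>)\<^sup>2)"
    if "\<omega> \<in> space M" for \<omega>
  proof -
    have "is_arg_min (\<lambda>f. (1 / real n) * (\<Sum>k=1..n. \<bar>f (X k \<omega>) - Y k \<omega>\<bar>\<^sup>2)) (\<lambda>f. f \<in> F) (fhat \<omega>)"
      using ls[OF that] by (simp only: least_squares_solution_def)
    then have "fhat \<omega> \<in> F" and le: "(1 / real n) * (\<Sum>k=1..n. \<bar>fhat \<omega> (X k \<omega>) - Y k \<omega>\<bar>\<^sup>2) \<le>
        (1 / real n) * (\<Sum>k=1..n. \<bar>f (X k \<omega>) - Y k \<omega>\<bar>\<^sup>2)"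
      using f unfolding is_arg_min_linorder by blast+
    show "fhat \<omega> \<in> F" by fact
    show "(\<Sum>k=1..n. (fhat \<omega> (X k \<omega>) - Y k \<omega>)\<^sup>2) \<le> (\<Sum>k=1..n. (f (X k \<omega>) - Y k \<omega>)\<^sup>2)"
      using le \<open>n \<ge> 1\<close> unfolding power2_abs by (simp add: divide_le_cancel)
  qed
  have fhatM: "fhat \<omega> \<in> borel_measurable borel" if "\<omega> \<in> space M" for \<omega> using fhat(1)[OF that] F by blast
  have sq: "integrable M (\<lambda>\<omega>. (f (X k \<omega>) - \<Phi> k (X k \<omega>))\<^sup>2)" if "k \<in> {1..n}" for k
    using False that \<open>n \<ge> 1\<close> fM by (intro integrable_of_mu_sq_dist) (auto simp: less_top)
  have ne: "F \<noteq> {}" using f by blast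
  have "\<exists>S. integrable M S \<and> (\<integral>\<omega>. S \<omega> \<partial>M) \<le> n * C \<and>
      (\<forall>g\<in>F. \<forall>\<omega>. (\<Sum>k=1..n. deviation lam g k (Z k \<omega>)) \<le> S \<omega>)"
  proof (rule ex_deviation_envelope[OF F ne, where n = n and lam = lam and C = "n * C"])
    fix H assume "finite H" "H \<subseteq> F" "H \<noteq> {}"
    then show "(\<integral>\<omega>. (MAX f\<in>H. \<Sum>k=1..n. deviation lam f k (Z k \<omega>)) \<partial>M) \<le> n * C" by (rule C)
  next
    fix S assume "integrable M S" "(\<integral>\<omega>. S \<omega> \<partial>M) \<le> n * C"
      "\<And>g \<omega>. g \<in> F \<Longrightarrow> (\<Sum>k=1..n. deviation lam g k (Z k \<omega>)) \<le> S \<omega>"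
    then show ?thesis by blast
  qed
  then obtain S where S: "integrable M S" "(\<integral>\<omega>. S \<omega> \<partial>M) \<le> n * C"
    "\<And>g \<omega>. g \<in> F \<Longrightarrow> (\<Sum>k=1..n. deviation lam g k (Z k \<omega>)) \<le> S \<omega>" by blast
  define d where "d k \<omega> = (f (X k \<omega>) - Y k \<omega>)\<^sup>2 - (\<Phi> k (X k \<omega>) - Y k \<omega>)\<^sup>2" for k \<omega>
  have int_d: "integrable M (d k)" and d_eq: "(\<integral>\<omega>. d k \<omega> \<partial>M) = (\<integral>\<omega>. (f (X k \<omega>) - \<Phi> k (X k \<omega>))\<^sup>2 \<partial>M)"
    if "k \<in> {1..n}" for k
    unfolding d_def using excess_risk_identity[OF _ fM sq[OF that]] that by auto
  define r where "r g k = (\<integral>\<omega>. (truncate B g (X k \<omega>) - \<Phi> k (X k \<omega>))\<^sup>2 \<partial>M)" for g k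
  define U where "U \<omega> = (S \<omega> + lam * (\<Sum>k=1..n. d k \<omega>)) / n" for \<omega>
  have int_U: "integrable M U"
    unfolding U_def using S(1) int_d by (intro integrable_divide_zero Bochner_Integration.integrable_add
      integrable_mult_right Bochner_Integration.integrable_sum) auto
  have mu_trunc: "mu_sq_dist M X n \<Phi> (truncate B (fhat \<omega>)) = ennreal ((\<Sum>k=1..n. r (fhat \<omega>) k) / n)"
    if "\<omega> \<in> space M" for \<omega>
    unfolding r_def using fhatM[OF that] \<open>n \<ge> 1\<close>
    by (intro mu_sq_dist_eq_ennreal truncate_measurable integrable_truncate_sq) auto
  have AE_r: "AE \<omega> in M. \<omega> \<in> space M \<longrightarrow> (\<Sum>k=1..n. r (fhat \<omega>) k) / n \<le> U \<omega>"
  proof -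
    have "AE \<omega> in M. \<forall>k\<in>{1..n}. (\<forall>g. excess B (\<Phi> k) g (Z k \<omega>) =
        (truncate B g (X k \<omega>) - Y k \<omega>)\<^sup>2 - (\<Phi> k (X k \<omega>) - Y k \<omega>)\<^sup>2) \<and> \<bar>Y k \<omega>\<bar> \<le> B"
      using AE_excess_Z Y_bound by (intro AE_finite_allI) auto
    then show ?thesis
    proof eventually_elim
      case (elim \<omega>)
      show ?case
      proof
        assume \<omega>: "\<omega> \<in> space M"
        let ?g = "fhat \<omega>"
        have "(\<Sum>k=1..n. r ?g k) \<le> (\<Sum>k=1..n. deviation lam ?g k (Z k \<omega>) + lam * excess B (\<Phi> k) ?g (Z k \<omega>))"
          unfolding r_def using fhatM[OF \<omega>] \<open>lam > 1\<close> by (intro sum_mono deviation_ge) auto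
        also have "\<dots> = (\<Sum>k=1..n. deviation lam ?g k (Z k \<omega>)) + lam * (\<Sum>k=1..n. excess B (\<Phi> k) ?g (Z k \<omega>))"
          by (simp add: sum.distrib sum_distrib_left)
        \<comment> \<open>\<open>S\<close> bounds the deviations of all members at once. In the
          empirical part, truncation does not increase the loss and the minimiser does at least as
          well as \<open>f\<close>.\<close>
        also have "\<dots> \<le> S \<omega> + lam * (\<Sum>k=1..n. d k \<omega>)"
        proof (intro add_mono mult_left_mono)
          have "(\<Sum>k=1..n. excess B (\<Phi> k) ?g (Z k \<omega>)) \<le>
              (\<Sum>k=1..n. (?g (X k \<omega>) - Y k \<omega>)\<^sup>2 - (\<Phi> k (X k \<omega>) - Y k \<omega>)\<^sup>2)"
          proof (rule sum_mono)
            fix k assume "k \<in> {1..n}"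
            then show "excess B (\<Phi> k) ?g (Z k \<omega>) \<le> (?g (X k \<omega>) - Y k \<omega>)\<^sup>2 - (\<Phi> k (X k \<omega>) - Y k \<omega>)\<^sup>2"
              using elim truncate_sq_le[of "Y k \<omega>" ?g "X k \<omega>"] by simp
          qed
          also have "\<dots> \<le> (\<Sum>k=1..n. d k \<omega>)"
            unfolding d_def sum_subtractf using fhat(2)[OF \<omega>] by simp
          finally show "(\<Sum>k=1..n. excess B (\<Phi> k) ?g (Z k \<omega>)) \<le> (\<Sum>k=1..n. d k \<omega>)" .
        qed (use S(3)[OF fhat(1)[OF \<omega>]] \<open>lam > 1\<close> in auto)
        finally show "(\<Sum>k=1..n. r ?g k) / n \<le> U \<omega>" unfolding U_def by (rule divide_right_mono) simp
      qed
    qed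
  qed
  have r0: "0 \<le> (\<Sum>k=1..n. r g k) / n" for g
    unfolding r_def by (intro divide_nonneg_nonneg sum_nonneg integral_nonneg) auto
  \<comment> \<open>By construction \<open>U\<close> could be negative, but almost surely it
    dominates a nonnegative risk; hence its Bochner and nonnegative integrals agree.\<close>
  have U0: "AE \<omega> in M. 0 \<le> U \<omega>"
    using AE_r AE_space
  proof eventually_elim
    case (elim \<omega>)
    then show ?case using r0[of "fhat \<omega>"] by linarith
  qed
  have "(\<integral>\<^sup>+\<omega>. mu_sq_dist M X n \<Phi> (truncate B (fhat \<omega>)) \<partial>M) \<le> (\<integral>\<^sup>+\<omega>. ennreal (U \<omega>) \<partial>M)"
  proof (rule nn_integral_mono_AE)
    show "AE \<omega> in M. mu_sq_dist M X n \<Phi> (truncate B (fhat \<omega>)) \<le> ennreal (U \<omega>)"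
      using AE_r AE_space by eventually_elim (simp add: mu_trunc ennreal_leI)
  qed
  also have "\<dots> = ennreal (\<integral>\<omega>. U \<omega> \<partial>M)" by (rule nn_integral_eq_integral[OF int_U U0])
  finally have lhs: "(\<integral>\<^sup>+\<omega>. mu_sq_dist M X n \<Phi> (truncate B (fhat \<omega>)) \<partial>M) \<le> ennreal (\<integral>\<omega>. U \<omega> \<partial>M)" .
  define R where "R = (\<Sum>k=1..n. \<integral>\<omega>. (f (X k \<omega>) - \<Phi> k (X k \<omega>))\<^sup>2 \<partial>M)"
  have R0: "R \<ge> 0" unfolding R_def by (intro sum_nonneg integral_nonneg) auto
  have mu_f: "mu_sq_dist M X n \<Phi> f = ennreal (R / n)"
    unfolding R_def by (rule mu_sq_dist_eq_ennreal[OF \<open>n \<ge> 1\<close> fM sq])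
  have int_sum: "integrable M (\<lambda>\<omega>. lam * (\<Sum>k=1..n. d k \<omega>))"
    using int_d by (intro integrable_mult_right Bochner_Integration.integrable_sum) auto
  have "(\<integral>\<omega>. U \<omega> \<partial>M) = (\<integral>\<omega>. S \<omega> + lam * (\<Sum>k=1..n. d k \<omega>) \<partial>M) / n"
    unfolding U_def by simp
  also have "(\<integral>\<omega>. S \<omega> + lam * (\<Sum>k=1..n. d k \<omega>) \<partial>M) = (\<integral>\<omega>. S \<omega> \<partial>M) + lam * (\<integral>\<omega>. (\<Sum>k=1..n. d k \<omega>) \<partial>M)"
    using Bochner_Integration.integral_add[OF S(1) int_sum] by simp
  also have "(\<integral>\<omega>. (\<Sum>k=1..n. d k \<omega>) \<partial>M) = (\<Sum>k=1..n. \<integral>\<omega>. d k \<omega> \<partial>M)"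
    by (rule Bochner_Integration.integral_sum[OF int_d])
  also have "(\<Sum>k=1..n. \<integral>\<omega>. d k \<omega> \<partial>M) = R"
    unfolding R_def by (rule sum.cong[OF refl d_eq])
  also have "((\<integral>\<omega>. S \<omega> \<partial>M) + lam * R) / n \<le> (n * C + lam * R) / n"
    using S(2) by (intro divide_right_mono) auto
  also have "\<dots> = C + lam * (R / n)" using \<open>n \<ge> 1\<close> by (simp add: add_divide_distrib)
  finally have "ennreal (\<integral>\<omega>. U \<omega> \<partial>M) \<le> ennreal (C + lam * (R / n))" by (rule ennreal_leI)
  also have "\<dots> = ennreal C + ennreal (lam * (R / n))"
    using \<open>C \<ge> 0\<close> \<open>lam > 1\<close> R0 by (intro ennreal_plus) auto
  also have "ennreal (lam * (R / n)) = ennreal lam * ennreal (R / n)"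
    using \<open>lam > 1\<close> by (intro ennreal_mult') auto
  finally show ?thesis using lhs unfolding mu_f by (rule order_trans[rotated])
qed

end

section \<open>The infimum over the class and the final estimate\<close>

text \<open>The infimum need not be attained, so near-minimisers with slack \<open>e / lam\<close>
  are used; positivity of \<open>lam\<close> settles an infinite infimum.\<close>

lemma ennreal_le_add_cmult_INF:
  fixes g :: "'i \<Rightarrow> ennreal" and lam :: real
  assumes "lam > 0" "\<And>i. i \<in> I \<Longrightarrow> x \<le> a + ennreal lam * g i"
  shows "x \<le> a + ennreal lam * (INF i\<in>I. g i)"
proof (rule ennreal_le_epsilon)
  fix e :: real assume e: "a + ennreal lam * (INF i\<in>I. g i) < top" "0 < e"
  have "(INF i\<in>I. g i) \<noteq> top"
  proof
    assume "(INF i\<in>I. g i) = top"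
    then show False using e(1) assms(1) by (simp only: ennreal_mult_top) (simp add: ennreal_mult_top)
  qed
  moreover have "0 < ennreal (e / lam)" using e assms by simp
  ultimately have "(INF i\<in>I. g i) < (INF i\<in>I. g i) + ennreal (e / lam)" by (simp add: ennreal_add_left_cancel_less)
  then obtain i where i: "i \<in> I" "g i < (INF i\<in>I. g i) + ennreal (e / lam)" by (auto simp: INF_less_iff)
  have "x \<le> a + ennreal lam * g i" using assms(2)[OF i(1)] .
  also have "\<dots> \<le> a + ennreal lam * ((INF i\<in>I. g i) + ennreal (e / lam))"
    using i(2) by (intro add_left_mono mult_left_mono) auto
  also have "\<dots> = a + ennreal lam * (INF i\<in>I. g i) + ennreal e"
    using e assms by (simp add: distrib_left ennreal_mult'[symmetric] add.assoc)
  finally show "x \<le> a + ennreal lam * (INF i\<in>I. g i) + ennreal e" .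
qed

theorem theorem3p10:
  fixes M :: "'w measure"
    and X :: "nat \<Rightarrow> 'w \<Rightarrow> real ^ 'd"
    and Y :: "nat \<Rightarrow> 'w \<Rightarrow> real"
    and \<Phi> :: "nat \<Rightarrow> real ^ 'd \<Rightarrow> real"
    and F :: "(real ^ 'd \<Rightarrow> real) set"
    and \<Phi>hat :: "'w \<Rightarrow> real ^ 'd \<Rightarrow> real"
    and B c lam :: real and n m V :: nat
  assumes "prob_space M"
    and "\<And>k. k \<ge> 1 \<Longrightarrow> X k \<in> borel_measurable M"
    and "\<And>k. k \<ge> 1 \<Longrightarrow> Y k \<in> borel_measurable M"
    and "\<And>k. k \<ge> 1 \<Longrightarrow> \<Phi> k \<in> borel_measurable borel"
    and "\<And>k. k \<ge> 1 \<Longrightarrow>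
           AE \<omega> in M. \<Phi> k (X k \<omega>) = real_cond_exp M (vimage_algebra (space M) (X k) borel) (Y k) \<omega>"
    and "F \<subseteq> borel_measurable borel"
    and "pointwise_measurable F"
    and "vc_dim F = enat V"
    and "B > 0"
    and "\<And>k. k \<ge> 1 \<Longrightarrow> esssup M (\<lambda>\<omega>. ereal \<bar>Y k \<omega>\<bar>) \<le> ereal B"
    and "c > 1" and "lam > 1" and "n \<ge> 1" and "m \<ge> 1"
    and "lam \<le> (3 + sqrt (1 + 8 * c)) / 4"
    and "real_of_int \<lfloor>real n / real m\<rfloor> \<ge> exp ((c\<^sup>2 - 71) / (4 * real V))"
    and "\<And>\<omega>. \<omega> \<in> space M \<Longrightarrow>
           least_squares_solution F n (\<lambda>k. X k \<omega>) (\<lambda>k. Y k \<omega>) (\<Phi>hat \<omega>)"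
  shows "(\<integral>\<^sup>+ \<omega>. mu_sq_dist M X n \<Phi> (truncate B (\<Phi>hat \<omega>)) \<partial>M)
    \<le> ennreal (B\<^sup>2 / real_of_int \<lfloor>real n / real m\<rfloor> * theta0 c lam *
          (1 + theta1 c m
             + real V * (theta2 c (real_of_int \<lfloor>real n / real m\<rfloor>)
                         + ln (theta2 c (real_of_int \<lfloor>real n / real m\<rfloor>)))))
      + ennreal (16 * B\<^sup>2 * (1 + lam) * real n) * beta_mixing M (\<lambda>k \<omega>. (X k \<omega>, Y k \<omega>)) m
      + ennreal lam * (INF f\<in>F. mu_sq_dist M X n \<Phi> f)"
proof -
  define N where "N = n div m"
  have floor_N: "real_of_int \<lfloor>real n / real m\<rfloor> = real N"
    by (simp add: N_def floor_divide_of_nat_eq)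
  define W where "W = 1 + theta1 c m + real V * (theta2 c N + ln (theta2 c N))"
  have N_exp: "real N \<ge> exp ((c\<^sup>2 - 71) / (4 * real V))" using assms(16) unfolding floor_N .
  \<comment> \<open>A natural number above a positive exponential is at least 1, also when
    \<open>V = 0\<close> and the exponent is 0.\<close>
  have "real N > 0" using N_exp less_le_trans[OF exp_gt_zero] by blast
  then have N1: "real N \<ge> 1" by simp
  interpret prob_space M by fact
  interpret bounded_regression M X Y \<Phi> B
  proof
    fix k :: nat assume k: "k \<ge> 1"
    show "X k \<in> borel_measurable M" "Y k \<in> borel_measurable M" "\<Phi> k \<in> borel_measurable borel"
      "AE \<omega> in M. \<Phi> k (X k \<omega>) = real_cond_exp M (vimage_algebra (space M) (X k) borel) (Y k) \<omega>"
      using assms(2-5) k by blast+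
    show "AE \<omega> in M. \<bar>Y k \<omega>\<bar> \<le> B"
      using esssup_AE[of "\<lambda>\<omega>. ereal \<bar>Y k \<omega>\<bar>" M]
    proof eventually_elim
      case (elim \<omega>)
      then show ?case using assms(10)[OF k] by (metis ereal_less_eq(3) order_trans)
    qed
  qed (rule \<open>B > 0\<close>)
  have Z_eq: "Z = (\<lambda>k \<omega>. (X k \<omega>, Y k \<omega>))" by (intro ext) (simp add: Z_def)
  define \<beta> where "\<beta> = beta_mixing M Z m"
  define A where "A = B\<^sup>2 / real N * theta0 c lam * W"
  let ?L = "\<integral>\<^sup>+ \<omega>. mu_sq_dist M X n \<Phi> (truncate B (\<Phi>hat \<omega>)) \<partial>M"
  have coef: "16 * B\<^sup>2 * (1 + lam) * real n > 0" using assms(9,12,13) by simp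
  have "?L \<le> ennreal A + ennreal (16 * B\<^sup>2 * (1 + lam) * real n) * \<beta> + ennreal lam * (INF f\<in>F. mu_sq_dist M X n \<Phi> f)"
  \<comment> \<open>The factor of the mixing coefficient is positive, so an infinite coefficient
    makes the right side infinite.\<close>
  proof (cases "\<beta> = top")
    case True
    have "ennreal r * top = top" if "r > 0" for r using that by (simp add: ennreal_mult_top)
    from this[OF coef] show ?thesis by (simp only: True) simp
  next
    case False
    define b where "b = enn2real \<beta>"
    have b: "\<beta> = ennreal b" "b \<ge> 0" using False by (simp_all add: b_def less_top)
    have W: "W > real V" "V * ln (exp 1 * (2 * real l / 3 + 1) / V) \<le> W" if "l \<le> N + 1" for l
    proof -
      have l: "real l \<le> real N + 1" using that by linarith
      show "W > real V" "V * ln (exp 1 * (2 * real l / 3 + 1) / V) \<le> W"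
        using theta2_entropy_bounds[OF assms(11) N1 N_exp l assms(14) W_def] by blast+
    qed
    have WV: "W > real V" by (rule W(1)[of 0]) simp
    define C0 where "C0 = 32 * (2 * lam - 1)\<^sup>2 * (lam / (lam - 1)) * B\<^sup>2 * W"
    \<comment> \<open>Complexity and mixing shares per observation. The mixing share is enlarged at
      the end to the one in the theorem, by \<open>n \<ge> 1\<close>.\<close>
    define C where "C = A + 8 * B\<^sup>2 * lam * b"
    have C0_le: "C0 \<le> theta0 c lam * B\<^sup>2 * W"
      unfolding C0_def using theta0_ge[OF assms(11,12)] WV by (intro mult_right_mono) auto
    have C0: "C0 \<ge> 0" unfolding C0_def using WV assms(12) by (intro mult_nonneg_nonneg) auto
    then have A0: "A \<ge> 0" unfolding A_def using C0_le N1 by (simp add: mult_ac)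
    \<comment> \<open>There are \<open>m\<close> classes and \<open>N * m \<le> n\<close>, so
      \<open>m / n \<le> 1 / N\<close>: this produces the factor \<open>B^2 / N\<close> of the
      theorem.\<close>
    have mC0: "m * C0 \<le> n * A"
    proof -
      have "real m \<le> n / N"
      proof -
        have "N * m \<le> n" by (simp add: N_def)
        then have "real m * real N \<le> real n" by (metis mult.commute of_nat_le_iff of_nat_mult)
        then show ?thesis using N1 by (simp add: pos_le_divide_eq)
      qed
      then have "m * C0 \<le> n / N * (theta0 c lam * B\<^sup>2 * W)" using C0_le C0 by (intro mult_mono) auto
      then show ?thesis by (simp add: A_def mult_ac)
    qed
    have bound: "(\<integral>\<omega>. (MAX f\<in>H. \<Sum>k=1..n. deviation lam f k (Z k \<omega>)) \<partial>M) \<le> n * C"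
      if H: "finite H" "H \<subseteq> F" "H \<noteq> {}" for H
    proof -
      have "(\<integral>\<omega>. (MAX f\<in>H. \<Sum>k=1..n. deviation lam f k (Z k \<omega>)) \<partial>M) \<le> m * C0 + n * (8 * B\<^sup>2 * lam * b)"
        unfolding C0_def
        using W(2) b by (intro expectation_Max_deviation_le[OF assms(8,6) H assms(12,14) WV])
          (auto simp: N_def \<beta>_def)
      also have "\<dots> \<le> n * C" using mC0 by (simp add: C_def distrib_left)
      finally show ?thesis .
    qed
    have C_nonneg: "C \<ge> 0" using A0 b assms(12) by (simp add: C_def)
    have "?L \<le> ennreal C + ennreal lam * (INF f\<in>F. mu_sq_dist M X n \<Phi> f)"
    proof (rule ennreal_le_add_cmult_INF)
      fix f assume "f \<in> F"
      show "?L \<le> ennreal C + ennreal lam * mu_sq_dist M X n \<Phi> f"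
        by (rule expectation_least_squares_le[OF assms(6,7,13,12)])
          (use bound C_nonneg assms(17) \<open>f \<in> F\<close> in auto)
    qed (use assms(12) in simp)
    also have "ennreal C \<le> ennreal (A + 16 * B\<^sup>2 * (1 + lam) * real n * b)"
    proof (intro ennreal_leI)
      have "8 * B\<^sup>2 * lam * 1 \<le> (16 * B\<^sup>2 * (1 + lam)) * real n"
        using assms(12,13) by (intro mult_mono) auto
      then have "8 * B\<^sup>2 * lam * b \<le> 16 * B\<^sup>2 * (1 + lam) * real n * b"
        using b(2) by (intro mult_right_mono) auto
      then show "C \<le> A + 16 * B\<^sup>2 * (1 + lam) * real n * b" by (simp add: C_def)
    qed
    also have "\<dots> = ennreal A + ennreal (16 * B\<^sup>2 * (1 + lam) * real n) * \<beta>"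
    proof -
      have "ennreal (A + 16 * B\<^sup>2 * (1 + lam) * real n * b) = ennreal A + ennreal (16 * B\<^sup>2 * (1 + lam) * real n * b)"
        by (intro ennreal_plus A0 mult_nonneg_nonneg[OF less_imp_le[OF coef] b(2)])
      also have "ennreal (16 * B\<^sup>2 * (1 + lam) * real n * b) = ennreal (16 * B\<^sup>2 * (1 + lam) * real n) * ennreal b"
        using coef by (intro ennreal_mult') linarith
      finally show ?thesis by (simp only: b(1))
    qed
    finally show ?thesis by (simp add: add_right_mono)
  qed
  then show ?thesis unfolding floor_N A_def W_def \<beta>_def Z_eq .
qed

end
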